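(* Let $G$ be a finite group and let $\mathcal{P}$ be a partition of $G$ into $\ell$ parts, each of which is $G$-invariant (a union of conjugacy classes of $G$), and assume that $\{1\}\in\mathcal{P}$. Let $C\subseteq G$ be a set of representatives for the parts of $\mathcal{P}$, and let $x_g$ ($g\in C$) be independent indeterminates over $\mathbb{C}$ indexed by the elements of $C$. For $g\in G$ let $K_g$ denote the part of $\mathcal{P}$ containing $g$, and let $\kappa:G\to C$ be the function that maps an element of $G$ to the representative in $C$ of its part. Let $\Theta_{\mathcal{P}}=\det\bigl(x_{\kappa(gh^{-1})}\bigr)_{g,h\in G}$ be the determinant of the matrix with rows and columns indexed by $G$ whose $(g,h)$-entry is $x_{\kappa(gh^{-1})}$. Then $\mathcal{P}$ is the set $\mathrm{Cl}(\mathsf{S})$ of superclasses of a supercharacter theory $\mathsf{S}$ of $G$ if and only if $\Theta_{\mathcal{P}}$ factors in $\mathbb{C}[x_g:g\in C]$ into a product of (positive) powers of $\ell$ distinct linear factors, each monic in $x_1$. In this event, if \[\Theta_{\mathcal{P}}=\prod_{j=1}^{\ell}\left(\sum_{g\in C}\xi_g^{j}\,x_g\right)^{m_j}\] is the factorization of $\Theta_{\mathcal{P}}$ into a product of powers of distinct linear factors that are monic in $x_1$, then the basic $\mathsf{S}$-characters (the elements of $\mathrm{BCh}(\mathsf{S})$) are exactly the functions $\chi_j:G\to\mathbb{C}$, $1\le j\le\ell$, defined by \[\chi_j(g)=\frac{m_j\,\xi_{\kappa(g)}^{j}}{|K_g|}.\] Moreover, $\chi_j(1)=m_j$ for each $1\le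 j\le\ell$.
   Context: Let $G$ be a finite group and $\mathrm{Irr}(G)$ its set of irreducible complex characters. A supercharacter theory of $G$ is a subspace $\mathsf{S}$ of the center $Z(\mathbb{C}G)$ of the group algebra that is a unital subalgebra both for the ordinary product of $\mathbb{C}G$ (with unit $1$) and for the Hadamard product $\bigl(\sum_g a_g g\bigr)\circ\bigl(\sum_g b_g g\bigr)=\sum_g a_gb_g g$ (with unit $\sum_{g\in G} g$). For $K\subseteq G$ write $\widehat{K}=\sum_{g\in K}g$. For a supercharacter theory $\mathsf{S}$ there is a unique partition $\mathrm{Cl}(\mathsf{S})$ of $G$, whose parts are called $\mathsf{S}$-classes (superclasses), such that $\{\widehat{K}:K\in\mathrm{Cl}(\mathsf{S})\}$ is a basis of orthogonal idempotents of $\mathsf{S}$ for the Hadamard product; each $\mathsf{S}$-class is a union of conjugacy classes of $G$. For $\psi\in\mathrm{Irr}(G)$ let $e_\psi=\frac{\psi(1)}{|G|}\sum_{g\in G}\psi(g^{-1})g$. There is a unique partition $\mathrm{Ch}(\mathsf{S})$ of $\mathrm{Irr}(G)$ such that $\{\sum_{\psi\in X}e_\psi: X\in\mathrm{Ch}(\mathsf{S})\}$ is a basis of orthogonal idempotents of $\mathsf{S}$ for the ordinary product. For $X\subseteq\mathrm{Irr}(G)$ put $\sigma_X=\sum_{\psi\in X}\psi(1)\psi$. The set of basic $\mathsf{S}$-characters is $\mathrm{BCh}(\mathsf{S})=\{\sigma_X: X\in\mathrm{Ch}(\mathsf{S})\}$. A linear factor $\sum_{g\in C}\xi_g x_g$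 is monic in $x_1$ if $\xi_1=1$ (note $1\in C$ since $\{1\}\in\mathcal{P}$). *)

theory Defs
  imports
    "HOL-Algebra.Group"
    "HOL-Combinatorics.Permutations"
    "HOL-Library.Disjoint_Sets"
    "HOL-Library.Function_Algebras"
    "HOL-Library.Poly_Mapping"
    "Jordan_Normal_Form.VS_Connect"
begin

section \<open>The group algebra\<close>

text \<open>
  Elements of the group algebra of \<open>G\<close> over the complex numbers, and complex-valued functions on
  \<open>G\<close>, are both represented by functions of type \<open>'a \<Rightarrow> complex\<close> that vanish outside
  \<open>carrier G\<close>. The element \<open>\<Sum>\<^sub>g a\<^sub>g g\<close> is the function \<open>g \<mapsto> a\<^sub>g\<close>, so the pointwise product on
  functions is the Hadamard product.
\<close>

definition on_group :: "('a, 'b) monoid_scheme \<Rightarrow> ('a \<Rightarrow> complex) \<Rightarrow> 'a \<Rightarrow> complex" where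
  "on_group G f = (\<lambda>g. if g \<in> carrier G then f g else 0)"

definition group_algebra :: "('a, 'b) monoid_scheme \<Rightarrow> ('a \<Rightarrow> complex) set" where
  "group_algebra G = {a. \<forall>g. g \<notin> carrier G \<longrightarrow> a g = 0}"

definition scale_fun :: "complex \<Rightarrow> ('a \<Rightarrow> complex) \<Rightarrow> 'a \<Rightarrow> complex" where
  "scale_fun c a = (\<lambda>g. c * a g)"

global_interpretation cfun: vector_space scale_fun
  by standard (auto simp: scale_fun_def fun_eq_iff algebra_simps)

definition basis_of :: "('a \<Rightarrow> complex) set \<Rightarrow> ('a \<Rightarrow> complex) set \<Rightarrow> bool" where
  "basis_of B S \<longleftrightarrow> cfun.independent B \<and> cfun.span B = S"

definition ga_mult ::
    "('a, 'b) monoid_scheme \<Rightarrow> ('a \<Rightarrow> complex) \<Rightarrow> ('a \<Rightarrow> complex) \<Rightarrow> 'a \<Rightarrow> complex" where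
  "ga_mult G a b = (\<lambda>g. \<Sum>(h, k) \<in> {(h, k) \<in> carrier G \<times> carrier G. h \<otimes>\<^bsub>G\<^esub> k = g}. a h * b k)"

definition hat :: "'a set \<Rightarrow> 'a \<Rightarrow> complex" where
  "hat K = (\<lambda>g. if g \<in> K then 1 else 0)"

definition ga_center :: "('a, 'b) monoid_scheme \<Rightarrow> ('a \<Rightarrow> complex) set" where
  "ga_center G = {z \<in> group_algebra G. \<forall>a \<in> group_algebra G. ga_mult G z a = ga_mult G a z}"

definition orthogonal_idempotents ::
    "(('a \<Rightarrow> complex) \<Rightarrow> ('a \<Rightarrow> complex) \<Rightarrow> ('a \<Rightarrow> complex)) \<Rightarrow> ('a \<Rightarrow> complex) set \<Rightarrow> bool" where
  "orthogonal_idempotents mul B \<longleftrightarrow> (\<forall>u \<in> B. \<forall>v \<in> B. mul u v = (if u = v then u else 0))"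


section \<open>Irreducible characters\<close>

definition GL :: "nat \<Rightarrow> complex mat monoid" where
  "GL n = units_of (ring_mat TYPE(complex) n ())"

definition irreducible_rep ::
    "('a, 'b) monoid_scheme \<Rightarrow> nat \<Rightarrow> ('a \<Rightarrow> complex mat) \<Rightarrow> bool" where
  "irreducible_rep G n \<rho> \<longleftrightarrow>
     n > 0 \<and> \<rho> \<in> hom G (GL n) \<and>
     (\<forall>W. subspace class_ring W (module_vec TYPE(complex) n) \<longrightarrow>
          (\<forall>g \<in> carrier G. \<forall>w \<in> W. \<rho> g *\<^sub>v w \<in> W) \<longrightarrow>
          W = {0\<^sub>v n} \<or> W = carrier_vec n)"

definition trace_mat :: "complex mat \<Rightarrow> complex" where
  "trace_mat A = (\<Sum>i < dim_row A. A $$ (i, i))"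

definition Irr :: "('a, 'b) monoid_scheme \<Rightarrow> ('a \<Rightarrow> complex) set" where
  "Irr G = {on_group G (\<lambda>g. trace_mat (\<rho> g)) | n \<rho>. irreducible_rep G n \<rho>}"

definition central_idempotent :: "('a, 'b) monoid_scheme \<Rightarrow> ('a \<Rightarrow> complex) \<Rightarrow> 'a \<Rightarrow> complex" where
  "central_idempotent G \<psi> =
     on_group G (\<lambda>g. \<psi> \<one>\<^bsub>G\<^esub> / of_nat (card (carrier G)) * \<psi> (inv\<^bsub>G\<^esub> g))"


section \<open>Supercharacter theories\<close>

definition supercharacter_theory :: "('a, 'b) monoid_scheme \<Rightarrow> ('a \<Rightarrow> complex) set \<Rightarrow> bool" where
  "supercharacter_theory G S \<longleftrightarrow>
     S \<subseteq> ga_center G \<and> cfun.subspace S \<and>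
     hat {\<one>\<^bsub>G\<^esub>} \<in> S \<and> (\<forall>a \<in> S. \<forall>b \<in> S. ga_mult G a b \<in> S) \<and>
     hat (carrier G) \<in> S \<and> (\<forall>a \<in> S. \<forall>b \<in> S. a * b \<in> S)"

definition Cl :: "('a, 'b) monoid_scheme \<Rightarrow> ('a \<Rightarrow> complex) set \<Rightarrow> 'a set set" where
  "Cl G S = (THE \<K>. partition_on (carrier G) \<K> \<and> basis_of (hat ` \<K>) S \<and>
                   orthogonal_idempotents (*) (hat ` \<K>))"

definition Ch :: "('a, 'b) monoid_scheme \<Rightarrow> ('a \<Rightarrow> complex) set \<Rightarrow> ('a \<Rightarrow> complex) set set" where
  "Ch G S = (THE \<X>. partition_on (Irr G) \<X> \<and>
                   basis_of ((\<lambda>X. \<Sum>\<psi> \<in> X. central_idempotent G \<psi>) ` \<X>) S \<and>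
                   orthogonal_idempotents (ga_mult G)
                     ((\<lambda>X. \<Sum>\<psi> \<in> X. central_idempotent G \<psi>) ` \<X>))"

definition sigma :: "('a, 'b) monoid_scheme \<Rightarrow> ('a \<Rightarrow> complex) set \<Rightarrow> 'a \<Rightarrow> complex" where
  "sigma G X = (\<Sum>\<psi> \<in> X. scale_fun (\<psi> \<one>\<^bsub>G\<^esub>) \<psi>)"

definition BCh :: "('a, 'b) monoid_scheme \<Rightarrow> ('a \<Rightarrow> complex) set \<Rightarrow> ('a \<Rightarrow> complex) set" where
  "BCh G S = sigma G ` Ch G S"


section \<open>Determinants of partitions\<close>

definition conj_invariant :: "('a, 'b) monoid_scheme \<Rightarrow> 'a set \<Rightarrow> bool" where
  "conj_invariant G K \<longleftrightarrow> (\<forall>k \<in> K. \<forall>g \<in> carrier G. g \<otimes>\<^bsub>G\<^esub> k \<otimes>\<^bsub>G\<^esub> inv\<^bsub>G\<^esub> g \<in> K)"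

definition part_of :: "'a set set \<Rightarrow> 'a \<Rightarrow> 'a set" where
  "part_of P g = (THE K. K \<in> P \<and> g \<in> K)"

definition representatives :: "'a set set \<Rightarrow> 'a set \<Rightarrow> bool" where
  "representatives P C \<longleftrightarrow> C \<subseteq> \<Union>P \<and> (\<forall>K \<in> P. \<exists>!c. c \<in> C \<inter> K)"

definition rep_of :: "'a set set \<Rightarrow> 'a set \<Rightarrow> 'a \<Rightarrow> 'a" where
  "rep_of P C g = (THE c. c \<in> C \<inter> part_of P g)"

text \<open>
  Complex polynomials in indeterminates indexed by \<open>'a\<close>, as finitely supported functions on
  monomials, a monomial being its finitely supported exponent function.
\<close>

type_synonym 'a cpoly = "('a \<Rightarrow>\<^sub>0 nat) \<Rightarrow>\<^sub>0 complex"

definition indet :: "'a \<Rightarrow> 'a cpoly" where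
  "indet g = Poly_Mapping.single (Poly_Mapping.single g 1) 1"

definition const_poly :: "complex \<Rightarrow> 'a cpoly" where
  "const_poly c = Poly_Mapping.single 0 c"

definition linear_form :: "'a set \<Rightarrow> ('a \<Rightarrow> complex) \<Rightarrow> 'a cpoly" where
  "linear_form C \<xi> = (\<Sum>g \<in> C. const_poly (\<xi> g) * indet g)"

text \<open>The determinant of a matrix with rows and columns indexed by a finite set.\<close>

definition det_on :: "'i set \<Rightarrow> ('i \<Rightarrow> 'i \<Rightarrow> 'r :: comm_ring_1) \<Rightarrow> 'r" where
  "det_on I M = (\<Sum>p \<in> {p. p permutes I}. of_int (sign p) * (\<Prod>i \<in> I. M i (p i)))"

lemma det_on_conv_det:
  assumes e: "bij_betw e {0..<n} I"
  shows "det_on I M = det (mat n n (\<lambda>(i, j). M (e i) (e j)))"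
proof -
  let ?N = "{0..<n}"
  let ?f = "\<lambda>\<pi> x. if x \<in> I then e (\<pi> (inv_into ?N e x)) else x"
  have inj: "inj_on e ?N" and im: "e ` ?N = I"
    using e by (auto simp: bij_betw_def)
  have f: "?f p = map_permutation ?N e p" for p
    using im by (auto simp: map_permutation_def restrict_id_def fun_eq_iff)
  have bij: "bij_betw (map_permutation ?N e) {p. p permutes ?N} {p. p permutes I}"
    using bij_betw_permutations[OF e] by (simp add: f)
  have "det_on I M = (\<Sum>p \<in> {p. p permutes ?N}. of_int (sign (map_permutation ?N e p)) *
          (\<Prod>i \<in> I. M i (map_permutation ?N e p i)))"
    unfolding det_on_def by (rule sum.reindex_bij_betw[OF bij, symmetric])
  also have "\<dots> = (\<Sum>p \<in> {p. p permutes ?N}. signof p * (\<Prod>i = 0..<n. M (e i) (e (p i))))"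
  proof (rule sum.cong[OF refl])
    fix p assume "p \<in> {p. p permutes ?N}"
    then have p: "p permutes ?N" by simp
    have "(\<Prod>i \<in> I. M i (map_permutation ?N e p i)) = (\<Prod>i \<in> ?N. M (e i) (map_permutation ?N e p (e i)))"
      by (rule prod.reindex_bij_betw[OF e, symmetric])
    also have "\<dots> = (\<Prod>i \<in> ?N. M (e i) (e (p i)))"
      by (rule prod.cong) (auto simp: map_permutation_apply[OF inj])
    finally show "of_int (sign (map_permutation ?N e p)) * (\<Prod>i \<in> I. M i (map_permutation ?N e p i)) =
        signof p * (\<Prod>i = 0..<n. M (e i) (e (p i)))"
      using sign_map_permutation[OF inj p] by simp
  qed
  also have "\<dots> = (\<Sum>p \<in> {p. p permutes ?N}. signof p *
      (\<Prod>i = 0..<n. mat n n (\<lambda>(i, j). M (e i) (e j)) $$ (i, p i)))"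
    by (intro sum.cong refl arg_cong2[where f = "(*)"] prod.cong)
       (auto dest: permutes_in_image)
  finally show ?thesis
    by (simp add: det_def)
qed

definition Theta :: "('a, 'b) monoid_scheme \<Rightarrow> 'a set set \<Rightarrow> 'a set \<Rightarrow> 'a cpoly" where
  "Theta G P C = det_on (carrier G) (\<lambda>g h. indet (rep_of P C (g \<otimes>\<^bsub>G\<^esub> inv\<^bsub>G\<^esub> h)))"

definition monic_linear_factorization ::
    "('a, 'b) monoid_scheme \<Rightarrow> 'a set set \<Rightarrow> 'a set \<Rightarrow> nat \<Rightarrow> (nat \<Rightarrow> 'a \<Rightarrow> complex) \<Rightarrow> (nat \<Rightarrow> nat) \<Rightarrow> bool"
  where
  "monic_linear_factorization G P C l \<xi> m \<longleftrightarrow>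
     (\<forall>j \<in> {1..l}. m j > 0 \<and> \<xi> j \<one>\<^bsub>G\<^esub> = 1) \<and>
     inj_on (\<lambda>j. linear_form C (\<xi> j)) {1..l} \<and>
     Theta G P C = (\<Prod>j = 1..l. linear_form C (\<xi> j) ^ m j)"

definition factor_char ::
    "('a, 'b) monoid_scheme \<Rightarrow> 'a set set \<Rightarrow> 'a set \<Rightarrow> nat \<Rightarrow> ('a \<Rightarrow> complex) \<Rightarrow> 'a \<Rightarrow> complex" where
  "factor_char G P C m \<xi> =
     on_group G (\<lambda>g. of_nat m * \<xi> (rep_of P C g) / of_nat (card (part_of P g)))"

end

theory Submission
  imports Defs "Jordan_Normal_Form.Spectral_Radius"
begin

text \<open>
  The idempotents \<open>e\<^sub>\<psi>\<close> are a basis of the centre, and a central \<open>z\<close> acts on \<open>e\<^sub>\<psi> \<complex>G\<close> as the scalar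
  \<open>\<omega>\<^sub>\<psi>(z) = (\<Sum>\<^sub>g z\<^sub>g \<psi>(g)) / \<psi>(1)\<close>. The matrix defining \<open>\<Theta>\<close> is that of left multiplication by the generic
  element \<open>\<Sum>\<^sub>c x\<^sub>c hat(K\<^sub>c)\<close> of the span of the part sums, so that always
  \<open>\<Theta> = \<Prod>\<^sub>\<psi> (\<Sum>\<^sub>c \<omega>\<^sub>\<psi>(hat(K\<^sub>c)) x\<^sub>c)\<close> with exponents \<open>\<psi>(1)\<^sup>2\<close>. Monic linear factorizations being unique,
  the distinct factors correspond to the classes of characters whose \<open>\<omega>\<^sub>\<psi>\<close> agree on the span of the part
  sums. This span is contained in the span of the class idempotents, and it is closed under multiplication
  exactly if the two are equal, i.e. if there are \<open>\<ell>\<close> classes.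
\<close>

section \<open>Convolution\<close>

text \<open>The character theory comes from Schur's lemma for one representation at a time and from
  one positivity fact: the coefficient of \<open>star a \<star> a\<close> at the identity is the
  squared norm of \<open>a\<close>. Positivity stands in for complete reducibility and for
  unitarity.

  The closure criterion is a fact about functions on a finite set: a unital subalgebra contains the
  indicator function of each class of points that it does not separate. It is applied to point
  values for the Hadamard product and to central characters for the ordinary one, so that every
  supercharacter theory gets two bases of equal size.

  The exponent of a factor is the trace of multiplication by an idempotent, namely |G| times its
  coefficient at the identity. As for the values of the characters, the product of
  \<open>m j\<close> and the coefficient of x_c is the sum of \<open>sigma\<close> over the part of
  c for every invariant partition; dividing by the size of the part yields the value itself because
  \<open>sigma\<close> is constant on superclasses.\<close>

lemma sum_fun_apply: "(\<Sum>i\<in>I. f i) x = (\<Sum>i\<in>I. f i x)"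
  by (induction I rule: infinite_finite_induct) simp_all

locale finite_group = group G for G :: "('a, 'b) monoid_scheme" (structure) +
  assumes finite_carrier [simp]: "finite (carrier G)"
begin

abbreviation conv (infixl "\<star>" 70) where "a \<star> b \<equiv> ga_mult G a b"

lemma conv_outside: "g \<notin> carrier G \<Longrightarrow> (a \<star> b) g = 0"
  by (auto simp: ga_mult_def intro!: sum.neutral)

lemma conv_apply:
  assumes "g \<in> carrier G"
  shows "(a \<star> b) g = (\<Sum>h\<in>carrier G. a h * b (inv h \<otimes> g))"
  unfolding ga_mult_def
  by (rule sum.reindex_bij_witness[where j = fst and i = "\<lambda>h. (h, inv h \<otimes> g)"])
     (use assms in \<open>auto simp: m_assoc[symmetric]\<close>)

lemma conv_apply':
  assumes "g \<in> carrier G"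
  shows "(a \<star> b) g = (\<Sum>k\<in>carrier G. a (g \<otimes> inv k) * b k)"
  unfolding ga_mult_def
  by (rule sum.reindex_bij_witness[where j = snd and i = "\<lambda>k. (g \<otimes> inv k, k)"])
     (use assms in \<open>auto simp: m_assoc\<close>)

lemma group_algebra_outside: "a \<in> group_algebra G \<Longrightarrow> g \<notin> carrier G \<Longrightarrow> a g = 0"
  by (simp add: group_algebra_def)

lemma group_algebra_eqI:
  assumes "a \<in> group_algebra G" "b \<in> group_algebra G"
    and "\<And>g. g \<in> carrier G \<Longrightarrow> a g = b g"
  shows "a = b"
proof
  fix g show "a g = b g"
    using assms by (cases "g \<in> carrier G") (auto simp: group_algebra_def)
qed

lemma conv_in_group_algebra [simp]: "a \<star> b \<in> group_algebra G"
  by (simp add: group_algebra_def conv_outside)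

lemma on_group_in_group_algebra [simp]: "on_group G f \<in> group_algebra G"
  by (simp add: group_algebra_def on_group_def)

lemma hat_in_group_algebra: "K \<subseteq> carrier G \<Longrightarrow> hat K \<in> group_algebra G"
  by (auto simp: group_algebra_def hat_def)

lemma subspace_group_algebra: "cfun.subspace (group_algebra G)"
  by (auto simp: cfun.subspace_def group_algebra_def scale_fun_def)

lemma conv_assoc: "(a \<star> b) \<star> c = a \<star> (b \<star> c)"
proof
  fix g show "((a \<star> b) \<star> c) g = (a \<star> (b \<star> c)) g"
  proof (cases "g \<in> carrier G")
    case g: True
    have "((a \<star> b) \<star> c) g = (\<Sum>k\<in>carrier G. \<Sum>h\<in>carrier G. a h * b (inv h \<otimes> (g \<otimes> inv k)) * c k)"
      using g by (simp add: conv_apply'[where a = "a \<star> b"] conv_apply[where a = a] sum_distrib_right)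
    also have "\<dots> = (\<Sum>h\<in>carrier G. \<Sum>k\<in>carrier G. a h * b (inv h \<otimes> (g \<otimes> inv k)) * c k)"
      by (rule sum.swap)
    also have "\<dots> = (a \<star> (b \<star> c)) g"
      using g by (simp add: conv_apply[where a = a] conv_apply'[where a = b] sum_distrib_left mult.assoc m_assoc)
    finally show ?thesis .
  qed (simp add: conv_outside)
qed

lemma conv_add_left: "(a + b) \<star> c = a \<star> c + b \<star> c"
  by (auto simp: ga_mult_def fun_eq_iff algebra_simps sum.distrib split_def)

lemma conv_add_right: "c \<star> (a + b) = c \<star> a + c \<star> b"
  by (auto simp: ga_mult_def fun_eq_iff algebra_simps sum.distrib split_def)

lemma conv_scale_left: "scale_fun x a \<star> c = scale_fun x (a \<star> c)"
  by (auto simp: ga_mult_def fun_eq_iff scale_fun_def sum_distrib_left split_def mult.assoc intro!: sum.cong)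

lemma conv_scale_right: "c \<star> scale_fun x a = scale_fun x (c \<star> a)"
  by (auto simp: ga_mult_def fun_eq_iff scale_fun_def sum_distrib_left split_def mult.left_commute intro!: sum.cong)

lemma conv_0_right [simp]: "c \<star> 0 = 0"
  by (auto simp: ga_mult_def fun_eq_iff)

lemma conv_sum_left: "(\<Sum>i\<in>I. f i) \<star> c = (\<Sum>i\<in>I. f i \<star> c)"
  by (rule additive.sum[of "\<lambda>a. a \<star> c", OF additive.intro]) (rule conv_add_left)

lemma conv_sum_right: "c \<star> (\<Sum>i\<in>I. f i) = (\<Sum>i\<in>I. c \<star> f i)"
  by (rule additive.sum[of "\<lambda>a. c \<star> a", OF additive.intro]) (rule conv_add_right)

lemma hat_conv_apply:
  assumes "h \<in> carrier G" "g \<in> carrier G"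
  shows "(hat {h} \<star> a) g = a (inv h \<otimes> g)"
  using assms by (simp add: conv_apply hat_def sum.delta if_distrib[of "\<lambda>x. x * _"] cong: if_cong)

lemma conv_hat_apply:
  assumes "h \<in> carrier G" "g \<in> carrier G"
  shows "(a \<star> hat {h}) g = a (g \<otimes> inv h)"
  using assms by (simp add: conv_apply' hat_def sum.delta if_distrib[of "\<lambda>x. _ * x"] cong: if_cong)

lemma one_conv [simp]: "a \<in> group_algebra G \<Longrightarrow> hat {\<one>} \<star> a = a"
  by (rule group_algebra_eqI) (auto simp: hat_conv_apply)

lemma conv_one [simp]: "a \<in> group_algebra G \<Longrightarrow> a \<star> hat {\<one>} = a"
  by (rule group_algebra_eqI) (auto simp: conv_hat_apply)

lemma hat_conv_hat:
  assumes "g \<in> carrier G" "h \<in> carrier G"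
  shows "hat {g} \<star> hat {h} = hat {g \<otimes> h}"
proof (rule group_algebra_eqI)
  fix x assume "x \<in> carrier G"
  then show "(hat {g} \<star> hat {h}) x = hat {g \<otimes> h} x"
    using assms by (simp add: hat_conv_apply) (simp add: hat_def inv_solve_left')
qed (use assms in \<open>auto intro!: hat_in_group_algebra\<close>)

lemma expand_hat:
  assumes "a \<in> group_algebra G"
  shows "a = (\<Sum>g\<in>carrier G. scale_fun (a g) (hat {g}))"
proof
  fix x
  show "a x = (\<Sum>g\<in>carrier G. scale_fun (a g) (hat {g})) x"
    using assms group_algebra_outside[of a x]
    by (auto simp: sum_fun_apply scale_fun_def hat_def if_distrib[of "\<lambda>y. _ * y"] cong: if_cong)
qed

lemma group_algebra_eq_span:
  "group_algebra G = cfun.span ((\<lambda>g. hat {g}) ` carrier G)"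
proof
  show "group_algebra G \<subseteq> cfun.span ((\<lambda>g. hat {g}) ` carrier G)"
  proof
    fix a assume a: "a \<in> group_algebra G"
    have "(\<Sum>g\<in>carrier G. scale_fun (a g) (hat {g})) \<in> cfun.span ((\<lambda>g. hat {g}) ` carrier G)"
      by (rule cfun.span_sum) (rule cfun.span_scale, rule cfun.span_base, rule imageI)
    then show "a \<in> cfun.span ((\<lambda>g. hat {g}) ` carrier G)"
      unfolding expand_hat[OF a, symmetric] .
  qed
  show "cfun.span ((\<lambda>g. hat {g}) ` carrier G) \<subseteq> group_algebra G"
    by (rule cfun.span_minimal[OF _ subspace_group_algebra]) (auto intro!: hat_in_group_algebra)
qed

section \<open>The centre of the group algebra\<close>

lemma center_in_group_algebra: "z \<in> ga_center G \<Longrightarrow> z \<in> group_algebra G"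
  by (simp add: ga_center_def)

lemma center_commute: "z \<in> ga_center G \<Longrightarrow> a \<in> group_algebra G \<Longrightarrow> z \<star> a = a \<star> z"
  unfolding ga_center_def by blast

text \<open>Commuting with the single elements \<open>hat {h}\<close> already forces invariance
  under conjugation. Conversely, this invariance gives
  \<open>z (g \<otimes> inv h) = z (inv h \<otimes> g)\<close>, so the two convolution sums agree
  term by term.\<close>

lemma center_iff:
  "z \<in> ga_center G \<longleftrightarrow> z \<in> group_algebra G \<and>
     (\<forall>g\<in>carrier G. \<forall>h\<in>carrier G. z (h \<otimes> g \<otimes> inv h) = z g)"
proof safe
  fix g h assume z: "z \<in> ga_center G" and g: "g \<in> carrier G" and h: "h \<in> carrier G"
  have "(z \<star> hat {h}) (h \<otimes> g) = (hat {h} \<star> z) (h \<otimes> g)"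
    using z h by (simp add: ga_center_def hat_in_group_algebra)
  then show "z (h \<otimes> g \<otimes> inv h) = z g"
    using g h by (simp add: conv_hat_apply hat_conv_apply m_assoc[symmetric])
next
  assume z: "z \<in> group_algebra G" and
    cl: "\<forall>g\<in>carrier G. \<forall>h\<in>carrier G. z (h \<otimes> g \<otimes> inv h) = z g"
  show "z \<in> ga_center G"
    unfolding ga_center_def
  proof (intro CollectI conjI ballI z)
    fix a assume "a \<in> group_algebra G"
    show "z \<star> a = a \<star> z"
    proof (rule group_algebra_eqI)
      fix g assume g: "g \<in> carrier G"
      have "z (g \<otimes> inv h) = z (inv h \<otimes> g)" if h: "h \<in> carrier G" for h
      proof -
        have "h \<otimes> (inv h \<otimes> g) \<otimes> inv h = g \<otimes> inv h"
          using g h by (simp add: m_assoc[symmetric])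
        then show ?thesis
          using cl[THEN bspec, of "inv h \<otimes> g", THEN bspec, of h] g h by simp
      qed
      then show "(z \<star> a) g = (a \<star> z) g"
        using g by (simp add: conv_apply'[of _ z] conv_apply[of _ a] mult.commute)
    qed auto
  qed
qed (simp add: center_in_group_algebra)

lemma center_conj:
  "z \<in> ga_center G \<Longrightarrow> g \<in> carrier G \<Longrightarrow> h \<in> carrier G \<Longrightarrow> z (h \<otimes> g \<otimes> inv h) = z g"
  by (simp add: center_iff)

lemma subspace_center: "cfun.subspace (ga_center G)"
  by (auto simp: cfun.subspace_def center_iff group_algebra_def scale_fun_def)

lemma one_in_center: "hat {\<one>} \<in> ga_center G"
  by (simp add: ga_center_def hat_in_group_algebra)

lemma conv_in_center:
  assumes a: "a \<in> ga_center G" and b: "b \<in> ga_center G"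
  shows "a \<star> b \<in> ga_center G"
  unfolding ga_center_def
proof (intro CollectI conjI ballI)
  fix c assume c: "c \<in> group_algebra G"
  have "(a \<star> b) \<star> c = a \<star> (c \<star> b)"
    using center_commute[OF b c] by (simp add: conv_assoc)
  also have "\<dots> = c \<star> (a \<star> b)"
    unfolding conv_assoc[symmetric] center_commute[OF a c] ..
  finally show "(a \<star> b) \<star> c = c \<star> (a \<star> b)" .
qed simp

text \<open>The adjoint for the standard inner product: the conjugate-linear anti-automorphism that
  sends a group element to its inverse.\<close>

definition star :: "('a \<Rightarrow> complex) \<Rightarrow> 'a \<Rightarrow> complex" where
  "star a = on_group G (\<lambda>g. cnj (a (inv g)))"

lemma star_in_group_algebra [simp]: "star a \<in> group_algebra G"
  by (simp add: star_def)

lemma star_star: "a \<in> group_algebra G \<Longrightarrow> star (star a) = a"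
proof (rule group_algebra_eqI)
  fix g assume "g \<in> carrier G"
  then show "star (star a) g = a g"
    by (simp add: star_def on_group_def)
qed simp_all

lemma star_scale: "star (scale_fun c a) = scale_fun (cnj c) (star a)"
  by (auto simp: star_def on_group_def scale_fun_def)

lemma star_conv: "star (a \<star> b) = star b \<star> star a"
proof (rule group_algebra_eqI)
  fix g assume g: "g \<in> carrier G"
  have "(star b \<star> star a) g = (\<Sum>k\<in>carrier G. cnj (b (k \<otimes> inv g)) * cnj (a (inv k)))"
    using g by (simp add: conv_apply' star_def on_group_def inv_mult_group)
  also have "\<dots> = (\<Sum>k\<in>carrier G. cnj (b (inv k \<otimes> inv g)) * cnj (a k))"
    by (rule sum.reindex_bij_witness[where i = "\<lambda>k. inv k" and j = "\<lambda>k. inv k"]) auto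
  also have "\<dots> = star (a \<star> b) g"
    using g by (simp add: conv_apply star_def on_group_def mult.commute)
  finally show "star (a \<star> b) g = (star b \<star> star a) g" ..
qed auto

text \<open>The coefficient of \<open>star a \<star> a\<close> at the identity is the squared norm
  of \<open>a\<close>. This definiteness takes the place of complete reducibility in what
  follows.\<close>

lemma star_conv_self_eq_0:
  assumes "a \<in> group_algebra G" "star a \<star> a = 0"
  shows "a = 0"
proof -
  have "0 = (star a \<star> a) \<one>"
    using assms by simp
  also have "\<dots> = (\<Sum>k\<in>carrier G. cnj (a k) * a k)"
    by (simp add: conv_apply' star_def on_group_def)
  also have "\<dots> = of_real (\<Sum>k\<in>carrier G. (cmod (a k))\<^sup>2)"
    unfolding of_real_sum by (intro sum.cong refl) (metis complex_norm_square mult.commute)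
  finally have "(\<Sum>k\<in>carrier G. (cmod (a k))\<^sup>2) = 0"
    by (rule of_real_eq_0_iff[THEN iffD1, OF sym])
  then have "\<forall>k\<in>carrier G. a k = 0"
    by (simp add: sum_nonneg_eq_0_iff)
  then show ?thesis
    using assms(1) by (intro group_algebra_eqI) (auto simp: group_algebra_def)
qed

lemma star_in_center:
  assumes "z \<in> ga_center G"
  shows "star z \<in> ga_center G"
  unfolding ga_center_def
proof (intro CollectI conjI ballI)
  fix a assume a: "a \<in> group_algebra G"
  have "star (z \<star> star a) = star (star a \<star> z)"
    using center_commute[OF assms, of "star a"] by simp
  then show "star z \<star> a = a \<star> star z"
    using a assms by (simp add: star_conv star_star)
qed simp

end

section \<open>Schur's lemma and central idempotents\<close>

text \<open>Reduces the invariant subspaces in \<open>irreducible_rep\<close> to closure conditions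
  on sets of vectors. Both directions are used: to apply irreducibility and to establish it for a
  minimal left ideal.\<close>

lemma subspace_module_vec_iff:
  "VectorSpace.subspace class_ring W (module_vec TYPE(complex) n) \<longleftrightarrow>
     W \<subseteq> carrier_vec n \<and> 0\<^sub>v n \<in> W \<and> (\<forall>v\<in>W. \<forall>w\<in>W. v + w \<in> W) \<and> (\<forall>c. \<forall>v\<in>W. c \<cdot>\<^sub>v v \<in> W)"
proof -
  interpret vs: vectorspace class_ring "module_vec TYPE(complex) n" by (rule vec_vs)
  show ?thesis
    using vs.module_axioms vs.vectorspace_axioms
    by (auto simp: VectorSpace.subspace_def submodule_def module_vec_simps class_ring_simps)
qed

lemma mult_mat_vec_index_sum:
  "A \<in> carrier_mat m n \<Longrightarrow> v \<in> carrier_vec n \<Longrightarrow> i < m \<Longrightarrow>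
     (A *\<^sub>v v) $ i = (\<Sum>j<n. A $$ (i, j) * v $ j)"
  by (simp add: scalar_prod_def atLeast0LessThan)

lemma times_mat_index_sum:
  "A \<in> carrier_mat m n \<Longrightarrow> B \<in> carrier_mat n k \<Longrightarrow> i < m \<Longrightarrow> j < k \<Longrightarrow>
     (A * B) $$ (i, j) = (\<Sum>l<n. A $$ (i, l) * B $$ (l, j))"
  by (simp add: scalar_prod_def atLeast0LessThan)

lemma mat_eqI_mult_vec:
  fixes A B :: "'r :: comm_ring_1 mat"
  assumes A: "A \<in> carrier_mat m n" and B: "B \<in> carrier_mat m n"
    and eq: "\<And>v. v \<in> carrier_vec n \<Longrightarrow> A *\<^sub>v v = B *\<^sub>v v"
  shows "A = B"
proof (rule eq_matI)
  fix i j assume ij: "i < dim_row B" "j < dim_col B"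
  have "(A *\<^sub>v unit_vec n j) $ i = (B *\<^sub>v unit_vec n j) $ i"
    by (simp add: eq)
  then show "A $$ (i, j) = B $$ (i, j)"
    using A B ij by (simp add: scalar_prod_right_unit)
qed (use A B in auto)

context finite_group
begin

lemma mult_inv_cancel:
  assumes "g \<in> carrier G" "h \<in> carrier G"
  shows "h \<otimes> (inv h \<otimes> g) = g" "inv h \<otimes> (h \<otimes> g) = g"
  using assms by (simp_all add: m_assoc[symmetric])

lemma idem_apply:
  "g \<in> carrier G \<Longrightarrow>
     central_idempotent G \<psi> g = \<psi> \<one> / of_nat (card (carrier G)) * \<psi> (inv g)"
  by (simp add: central_idempotent_def on_group_def)

context
  fixes n :: nat and \<rho> :: "'a \<Rightarrow> complex mat"
  assumes irr: "irreducible_rep G n \<rho>"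
begin

lemma irr_pos: "n > 0"
  using irr by (simp add: irreducible_rep_def)

lemma irr_hom: "\<rho> \<in> hom G (GL n)"
  using irr by (simp add: irreducible_rep_def)

lemma irr_carrier: "g \<in> carrier G \<Longrightarrow> \<rho> g \<in> carrier_mat n n"
  using irr_hom by (auto simp: hom_def GL_def units_of_def Units_def ring_mat_simps)

lemma irr_mult: "g \<in> carrier G \<Longrightarrow> h \<in> carrier G \<Longrightarrow> \<rho> (g \<otimes> h) = \<rho> g * \<rho> h"
  using irr_hom by (auto simp: hom_def GL_def units_of_def ring_mat_simps)

lemma irr_mult_index:
  assumes "g \<in> carrier G" "h \<in> carrier G" "i < n" "j < n"
  shows "\<rho> (g \<otimes> h) $$ (i, j) = (\<Sum>k<n. \<rho> g $$ (i, k) * \<rho> h $$ (k, j))"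
  using assms by (simp add: irr_mult times_mat_index_sum[OF irr_carrier irr_carrier])

lemma irr_one: "\<rho> \<one> = 1\<^sub>m n"
proof -
  have "monoid (ring_mat TYPE(complex) n ())"
    using ring_mat[where 'a = complex and n = n and b = "()"] by (simp add: ring_def)
  then interpret GL: group "GL n"
    unfolding GL_def by (rule monoid.units_group)
  interpret group_hom G "GL n" \<rho>
    by unfold_locales (rule irr_hom)
  show ?thesis
    using hom_one by (simp add: GL_def units_of_def ring_mat_simps)
qed

lemma irr_invariant:
  assumes "W \<subseteq> carrier_vec n" "0\<^sub>v n \<in> W" "\<And>v w. v \<in> W \<Longrightarrow> w \<in> W \<Longrightarrow> v + w \<in> W"
    and "\<And>c v. v \<in> W \<Longrightarrow> c \<cdot>\<^sub>v v \<in> W"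
    and "\<And>g w. g \<in> carrier G \<Longrightarrow> w \<in> W \<Longrightarrow> \<rho> g *\<^sub>v w \<in> W"
    and "w \<in> W" "w \<noteq> 0\<^sub>v n"
  shows "W = carrier_vec n"
proof -
  have "VectorSpace.subspace class_ring W (module_vec TYPE(complex) n)"
    using assms(1-4) by (simp add: subspace_module_vec_iff)
  then have "W = {0\<^sub>v n} \<or> W = carrier_vec n"
    using irr assms(5) unfolding irreducible_rep_def by blast
  then show ?thesis
    using assms(6,7) by blast
qed

text \<open>A complex matrix has an eigenvalue. As \<open>A\<close> commutes with the
  representation, the eigenspace is invariant; being nonzero, it is the whole space.\<close>

lemma schur:
  assumes A: "A \<in> carrier_mat n n"
    and comm: "\<And>g. g \<in> carrier G \<Longrightarrow> A * \<rho> g = \<rho> g * A"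
  obtains c where "A = c \<cdot>\<^sub>m 1\<^sub>m n"
proof -
  obtain c where "c \<in> spectrum A"
    using spectrum_non_empty[OF A irr_pos] by blast
  then obtain v where v: "v \<in> carrier_vec n" "v \<noteq> 0\<^sub>v n" "A *\<^sub>v v = c \<cdot>\<^sub>v v"
    using A by (auto simp: spectrum_def eigenvalue_def eigenvector_def)
  define W where "W = {w \<in> carrier_vec n. A *\<^sub>v w = c \<cdot>\<^sub>v w}"
  have "W = carrier_vec n"
  proof (rule irr_invariant)
    show "v \<in> W" "v \<noteq> 0\<^sub>v n"
      using v by (auto simp: W_def)
    fix g w assume g: "g \<in> carrier G" and w: "w \<in> W"
    have "A *\<^sub>v (\<rho> g *\<^sub>v w) = (A * \<rho> g) *\<^sub>v w"
      using A w irr_carrier[OF g] by (simp add: W_def)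
    also have "\<dots> = \<rho> g *\<^sub>v (A *\<^sub>v w)"
      using A w irr_carrier[OF g] by (simp add: W_def comm[OF g])
    also have "\<dots> = c \<cdot>\<^sub>v (\<rho> g *\<^sub>v w)"
      using w irr_carrier[OF g] by (simp add: W_def mult_mat_vec)
    finally show "\<rho> g *\<^sub>v w \<in> W"
      using w irr_carrier[OF g] by (simp add: W_def)
  qed (use A in \<open>auto simp: W_def mult_add_distrib_mat_vec[OF A] mult_mat_vec[OF A] smult_add_distrib_vec smult_smult_assoc mult.commute\<close>)
  then have Av: "A *\<^sub>v v = c \<cdot>\<^sub>v v" if "v \<in> carrier_vec n" for v
    using that by (auto simp: W_def)
  have "A = c \<cdot>\<^sub>m 1\<^sub>m n"
    using A by (intro mat_eqI_mult_vec[of _ n n]) (auto simp: Av intro!: eq_vecI)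
  then show thesis by (rule that)
qed

text \<open>The intertwiners below are sums over the group given entry by entry, so this form avoids
  matrix-valued sums.\<close>

lemma schur_index:
  assumes comm: "\<And>g i j. g \<in> carrier G \<Longrightarrow> i < n \<Longrightarrow> j < n \<Longrightarrow>
     (\<Sum>k<n. a i k * \<rho> g $$ (k, j)) = (\<Sum>k<n. \<rho> g $$ (i, k) * a k j)"
  obtains c where "\<And>i j. i < n \<Longrightarrow> j < n \<Longrightarrow> a i j = (if i = j then c else 0)"
proof -
  define A where "A = mat n n (\<lambda>(i, j). a i j)"
  have A: "A \<in> carrier_mat n n" by (simp add: A_def)
  have "A * \<rho> g = \<rho> g * A" if g: "g \<in> carrier G" for g
  proof (rule eq_matI)
    fix i j assume "i < dim_row (\<rho> g * A)" "j < dim_col (\<rho> g * A)"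
    then have ij: "i < n" "j < n" using A irr_carrier[OF g] by auto
    then show "(A * \<rho> g) $$ (i, j) = (\<rho> g * A) $$ (i, j)"
      using comm[OF g ij]
      unfolding times_mat_index_sum[OF A irr_carrier[OF g] ij] times_mat_index_sum[OF irr_carrier[OF g] A ij]
      by (simp add: A_def ij)
  qed (use A irr_carrier[OF g] in auto)
  then obtain c where c: "A = c \<cdot>\<^sub>m 1\<^sub>m n"
    using schur[OF A] by blast
  have "a i j = (if i = j then c else 0)" if "i < n" "j < n" for i j
    using arg_cong[OF c, of "\<lambda>M. M $$ (i, j)"] that by (simp add: A_def)
  then show thesis by (rule that)
qed

abbreviation chi where "chi \<equiv> on_group G (\<lambda>g. trace_mat (\<rho> g))"

lemma chi_apply: "g \<in> carrier G \<Longrightarrow> chi g = (\<Sum>i<n. \<rho> g $$ (i, i))"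
  using irr_carrier[of g] by (auto simp: on_group_def trace_mat_def)

lemma chi_one: "chi \<one> = of_nat n"
  by (simp add: chi_apply irr_one)

text \<open>Summing \<open>\<rho>\<close> over the group with weights \<open>z\<close> gives a
  matrix that commutes with the representation, because \<open>z\<close> is a class function.
  Schur's lemma makes it scalar, and its trace identifies the scalar.\<close>

lemma center_acts_as_scalar:
  assumes z: "z \<in> ga_center G" and i: "i < n" and j: "j < n"
  shows "(\<Sum>g\<in>carrier G. z g * \<rho> g $$ (i, j)) =
           (if i = j then (\<Sum>g\<in>carrier G. z g * chi g) / of_nat n else 0)"
proof -
  let ?a = "\<lambda>i j. \<Sum>g\<in>carrier G. z g * \<rho> g $$ (i, j)"
  have "(\<Sum>k<n. ?a i k * \<rho> h $$ (k, j)) = (\<Sum>k<n. \<rho> h $$ (i, k) * ?a k j)"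
    if h: "h \<in> carrier G" and ij: "i < n" "j < n" for h i j
  proof -
    have "(\<Sum>k<n. ?a i k * \<rho> h $$ (k, j)) = (\<Sum>g\<in>carrier G. z g * \<rho> (g \<otimes> h) $$ (i, j))"
      using h ij
      by (simp add: irr_mult_index sum_distrib_left sum_distrib_right mult.assoc
            sum.swap[of _ "carrier G"])
    \<comment> \<open>Substituting \<open>h \<otimes> g \<otimes> inv h\<close> for \<open>g\<close>
      moves \<open>h\<close> from the right to the left inside \<open>\<rho>\<close>; the weight
      \<open>z\<close> does not notice.\<close>
    also have "\<dots> = (\<Sum>g\<in>carrier G. z (h \<otimes> g \<otimes> inv h) * \<rho> (h \<otimes> g) $$ (i, j))"
      by (rule sum.reindex_bij_witness[where i = "\<lambda>g. h \<otimes> g \<otimes> inv h" and j = "\<lambda>g. inv h \<otimes> g \<otimes> h"])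
         (use h in \<open>auto simp: m_assoc mult_inv_cancel\<close>)
    also have "\<dots> = (\<Sum>g\<in>carrier G. z g * \<rho> (h \<otimes> g) $$ (i, j))"
      using h by (simp add: center_conj[OF z])
    also have "\<dots> = (\<Sum>k<n. \<rho> h $$ (i, k) * ?a k j)"
      using h ij
      by (simp add: irr_mult_index sum_distrib_left mult.left_commute sum.swap[of _ "carrier G"])
    finally show ?thesis .
  qed
  then obtain c where c: "\<And>i j. i < n \<Longrightarrow> j < n \<Longrightarrow> ?a i j = (if i = j then c else 0)"
    using schur_index[of ?a] by blast
  have "(\<Sum>g\<in>carrier G. z g * chi g) = (\<Sum>i<n. ?a i i)"
    by (simp add: chi_apply sum_distrib_left sum.swap[of _ "carrier G"])
  also have "\<dots> = of_nat n * c"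
    by (simp add: c)
  finally show ?thesis
    using c[OF i j] irr_pos by simp
qed

text \<open>For fixed \<open>i\<close> and \<open>k\<close>, the matrix \<open>?q i k\<close> is the
  sum over the group of \<rho>(g) E \<rho>(inv g), with E the matrix unit at (i, k). This sum is an
  intertwiner, hence scalar, and its trace is |G| if i = k and 0 otherwise.\<close>

lemma chi_norm: "(\<Sum>g\<in>carrier G. chi g * chi (inv g)) = of_nat (card (carrier G))"
proof -
  let ?q = "\<lambda>j k i l. \<Sum>g\<in>carrier G. \<rho> g $$ (i, j) * \<rho> (inv g) $$ (k, l)"
  have diag: "?q i k i k = (if i = k then of_nat (card (carrier G)) / of_nat n else 0)"
    if ik: "i < n" "k < n" for i k
  proof -
    have "(\<Sum>r<n. ?q i k p r * \<rho> h $$ (r, s)) = (\<Sum>r<n. \<rho> h $$ (p, r) * ?q i k r s)"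
      if h: "h \<in> carrier G" and ps: "p < n" "s < n" for h p s
    proof -
      have "(\<Sum>r<n. ?q i k p r * \<rho> h $$ (r, s)) =
              (\<Sum>g\<in>carrier G. \<rho> g $$ (p, i) * \<rho> (inv g \<otimes> h) $$ (k, s))"
        using h ps ik
        by (simp add: irr_mult_index sum_distrib_left sum_distrib_right mult.assoc
            sum.swap[of _ "carrier G"])
      also have "\<dots> = (\<Sum>g\<in>carrier G. \<rho> (h \<otimes> g) $$ (p, i) * \<rho> (inv g) $$ (k, s))"
        by (rule sum.reindex_bij_witness[where i = "\<lambda>g. h \<otimes> g" and j = "\<lambda>g. inv h \<otimes> g"])
           (use h in \<open>auto simp: m_assoc[symmetric] inv_mult_group\<close>)
      also have "\<dots> = (\<Sum>r<n. \<rho> h $$ (p, r) * ?q i k r s)"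
        using h ps ik
        by (simp add: irr_mult_index sum_distrib_left sum_distrib_right mult.assoc sum.swap[of _ "carrier G"])
      finally show ?thesis .
    qed
    then obtain c where c: "\<And>p r. p < n \<Longrightarrow> r < n \<Longrightarrow> ?q i k p r = (if p = r then c else 0)"
      using schur_index[of "?q i k"] by blast
    have "of_nat n * c = (\<Sum>p<n. ?q i k p p)"
      by (simp add: c)
    also have "\<dots> = (\<Sum>g\<in>carrier G. \<Sum>p<n. \<rho> (inv g) $$ (k, p) * \<rho> g $$ (p, i))"
      by (subst sum.swap) (simp add: mult.commute)
    also have "\<dots> = (\<Sum>g\<in>carrier G. \<rho> (inv g \<otimes> g) $$ (k, i))"
      using ik by (intro sum.cong refl irr_mult_index[symmetric]) auto
    also have "\<dots> = (if i = k then of_nat (card (carrier G)) else 0)"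
      using ik by (simp add: irr_one)
    finally have "c = (if i = k then of_nat (card (carrier G)) / of_nat n else 0)"
      using irr_pos by (auto simp: field_simps split: if_splits)
    then show ?thesis
      using c[OF ik] by simp
  qed
  have "(\<Sum>g\<in>carrier G. chi g * chi (inv g)) = (\<Sum>i<n. \<Sum>k<n. ?q i k i k)"
    by (simp add: chi_apply sum_product sum.swap[of _ "carrier G"])
  also have "\<dots> = of_nat (card (carrier G))"
    using irr_pos by (simp add: diag)
  finally show ?thesis .
qed

lemma chi_conj:
  assumes "g \<in> carrier G" "h \<in> carrier G"
  shows "chi (h \<otimes> g \<otimes> inv h) = chi g"
proof -
  have "chi (h \<otimes> g \<otimes> inv h) = (\<Sum>i<n. \<Sum>k<n. \<rho> (h \<otimes> g) $$ (i, k) * \<rho> (inv h) $$ (k, i))"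
    using assms by (simp add: chi_apply irr_mult_index[of "h \<otimes> g" "inv h"])
  also have "\<dots> = (\<Sum>k<n. \<Sum>i<n. \<rho> (inv h) $$ (k, i) * \<rho> (h \<otimes> g) $$ (i, k))"
    by (subst sum.swap) (simp add: mult.commute)
  also have "\<dots> = chi (inv h \<otimes> (h \<otimes> g))"
    using assms by (simp add: chi_apply irr_mult_index[of "inv h" "h \<otimes> g"])
  also have "inv h \<otimes> (h \<otimes> g) = g"
    using assms by (simp add: m_assoc[symmetric])
  finally show ?thesis .
qed

text \<open>The coefficient of the product at \<open>g\<close> is, up to a constant factor, the
  trace of \<rho>(inv g) times the matrix by which \<open>z\<close> acts, and that matrix is
  scalar.\<close>

lemma center_conv_central_idempotent_chi:
  assumes z: "z \<in> ga_center G"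
  shows "z \<star> central_idempotent G chi =
           scale_fun ((\<Sum>g\<in>carrier G. z g * chi g) / chi \<one>) (central_idempotent G chi)"
proof -
  define w where "w = (\<Sum>g\<in>carrier G. z g * chi g) / chi \<one>"
  have "z \<star> central_idempotent G chi = scale_fun w (central_idempotent G chi)"
  proof (rule group_algebra_eqI)
    let ?d = "chi \<one> / of_nat (card (carrier G))"
    fix g assume g: "g \<in> carrier G"
    have "(z \<star> central_idempotent G chi) g = (\<Sum>h\<in>carrier G. z h * (?d * chi (inv g \<otimes> h)))"
      using g by (simp add: conv_apply idem_apply inv_mult_group)
    also have "\<dots> = ?d * (\<Sum>h\<in>carrier G. \<Sum>i<n. \<Sum>k<n. z h * (\<rho> (inv g) $$ (i, k) * \<rho> h $$ (k, i)))"
      using g by (simp add: chi_apply[of "inv g \<otimes> _"] irr_mult_index sum_distrib_left mult_ac)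
    also have "\<dots> = ?d * (\<Sum>i<n. \<Sum>k<n. \<Sum>h\<in>carrier G. z h * (\<rho> (inv g) $$ (i, k) * \<rho> h $$ (k, i)))"
      by (simp add: sum.swap[of _ "carrier G"])
    also have "\<dots> = ?d * (\<Sum>i<n. \<Sum>k<n. \<rho> (inv g) $$ (i, k) * (\<Sum>h\<in>carrier G. z h * \<rho> h $$ (k, i)))"
      by (simp add: sum_distrib_left mult_ac)
    also have "\<dots> = ?d * (\<Sum>i<n. \<rho> (inv g) $$ (i, i) * w)"
      by (simp add: w_def center_acts_as_scalar[OF z] chi_one if_distrib[of "\<lambda>x. _ * x"] cong: if_cong)
    also have "\<dots> = scale_fun w (central_idempotent G chi) g"
      using g by (simp add: scale_fun_def idem_apply chi_apply[of "inv g"] mult_ac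
          flip: sum_distrib_left)
    finally show "(z \<star> central_idempotent G chi) g = scale_fun w (central_idempotent G chi) g" .
  next
    show "scale_fun w (central_idempotent G chi) \<in> group_algebra G"
      by (rule cfun.subspace_scale[OF subspace_group_algebra]) (simp add: central_idempotent_def)
  qed simp
  then show ?thesis
    by (simp add: w_def)
qed

end

section \<open>Central characters and the idempotents of the centre\<close>

definition central_char :: "('a \<Rightarrow> complex) \<Rightarrow> ('a \<Rightarrow> complex) \<Rightarrow> complex" where
  "central_char \<psi> z = (\<Sum>g\<in>carrier G. z g * \<psi> g) / \<psi> \<one>"

lemma central_char_add: "central_char \<psi> (a + b) = central_char \<psi> a + central_char \<psi> b"
  by (simp add: central_char_def algebra_simps sum.distrib add_divide_distrib)

lemma central_char_scale: "central_char \<psi> (scale_fun c a) = c * central_char \<psi> a"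
  by (simp add: central_char_def scale_fun_def sum_distrib_left mult.assoc)

lemma central_char_sum: "central_char \<psi> (\<Sum>i\<in>I. f i) = (\<Sum>i\<in>I. central_char \<psi> (f i))"
  by (rule additive.sum[of "central_char \<psi>", OF additive.intro]) (rule central_char_add)

lemma Irr_cases:
  assumes "\<psi> \<in> Irr G"
  obtains n \<rho> where "irreducible_rep G n \<rho>" "\<psi> = on_group G (\<lambda>g. trace_mat (\<rho> g))"
  using assms by (auto simp: Irr_def)

lemma Irr_degree:
  assumes "\<psi> \<in> Irr G"
  obtains n where "n > 0" "\<psi> \<one> = of_nat n"
  using assms irr_pos chi_one by (elim Irr_cases) blast

lemma Irr_one_neq_0: "\<psi> \<in> Irr G \<Longrightarrow> \<psi> \<one> \<noteq> 0"
  by (auto elim: Irr_degree)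

lemma Irr_in_group_algebra: "\<psi> \<in> Irr G \<Longrightarrow> \<psi> \<in> group_algebra G"
  by (auto elim: Irr_cases)

lemma Irr_conj:
  assumes "\<psi> \<in> Irr G" "g \<in> carrier G" "h \<in> carrier G"
  shows "\<psi> (h \<otimes> g \<otimes> inv h) = \<psi> g"
  using assms chi_conj by (elim Irr_cases) blast

lemma Irr_norm:
  assumes "\<psi> \<in> Irr G"
  shows "(\<Sum>g\<in>carrier G. \<psi> g * \<psi> (inv g)) = of_nat (card (carrier G))"
  using assms chi_norm by (elim Irr_cases) blast

abbreviation idem where "idem \<equiv> central_idempotent G"

lemma center_conv_idem:
  assumes "\<psi> \<in> Irr G" "z \<in> ga_center G"
  shows "z \<star> idem \<psi> = scale_fun (central_char \<psi> z) (idem \<psi>)"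
  using assms(1)
proof (rule Irr_cases)
  fix n \<rho> assume irr: "irreducible_rep G n \<rho>" and \<psi>: "\<psi> = on_group G (\<lambda>g. trace_mat (\<rho> g))"
  show ?thesis
    using center_conv_central_idempotent_chi[OF irr assms(2)] unfolding \<psi> central_char_def .
qed

lemma card_neq_0 [simp]: "card (carrier G) \<noteq> 0"
  by auto

lemma idem_in_center:
  assumes "\<psi> \<in> Irr G"
  shows "idem \<psi> \<in> ga_center G"
  unfolding center_iff
proof (intro conjI ballI)
  fix g h assume gh: "g \<in> carrier G" "h \<in> carrier G"
  then have "inv (h \<otimes> g \<otimes> inv h) = h \<otimes> inv g \<otimes> inv h"
    by (simp add: inv_mult_group m_assoc)
  then show "idem \<psi> (h \<otimes> g \<otimes> inv h) = idem \<psi> g"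
    using gh by (simp add: idem_apply Irr_conj[OF assms])
qed (simp add: central_idempotent_def)

lemma idem_neq_0:
  assumes "\<psi> \<in> Irr G"
  shows "idem \<psi> \<noteq> 0"
proof
  assume "idem \<psi> = 0"
  then have "idem \<psi> \<one> = 0" by simp
  then show False
    using Irr_one_neq_0[OF assms] by (simp add: idem_apply)
qed

lemma central_char_idem_self:
  assumes "\<psi> \<in> Irr G"
  shows "central_char \<psi> (idem \<psi>) = 1"
proof -
  have "central_char \<psi> (idem \<psi>) =
          (\<Sum>g\<in>carrier G. \<psi> g * \<psi> (inv g)) / of_nat (card (carrier G))"
    using Irr_one_neq_0[OF assms]
    by (simp add: central_char_def idem_apply sum_divide_distrib mult_ac)
  then show ?thesis
    by (simp add: Irr_norm[OF assms])
qed

lemma idem_idem: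
  assumes "\<psi> \<in> Irr G"
  shows "idem \<psi> \<star> idem \<psi> = idem \<psi>"
  using center_conv_idem[OF assms idem_in_center[OF assms]]
  by (simp add: central_char_idem_self[OF assms])

text \<open>By \<open>center_conv_idem\<close> the product is a multiple of each of the two
  idempotents. If it were nonzero, they would be proportional and, being idempotent, equal. But an
  idempotent determines its character: it yields \<open>\<psi> \<one>\<close> times
  \<open>\<psi>\<close>, whose value at the identity is the squared degree.\<close>

lemma idem_orthogonal:
  assumes \<psi>: "\<psi> \<in> Irr G" and \<phi>: "\<phi> \<in> Irr G" and neq: "\<psi> \<noteq> \<phi>"
  shows "idem \<psi> \<star> idem \<phi> = 0"
proof (rule ccontr)
  assume nz: "idem \<psi> \<star> idem \<phi> \<noteq> 0"
  let ?x = "central_char \<phi> (idem \<psi>)" and ?y = "central_char \<psi> (idem \<phi>)"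
  have 1: "idem \<psi> \<star> idem \<phi> = scale_fun ?x (idem \<phi>)"
    by (rule center_conv_idem[OF \<phi> idem_in_center[OF \<psi>]])
  have 2: "idem \<psi> \<star> idem \<phi> = scale_fun ?y (idem \<psi>)"
    using center_conv_idem[OF \<psi> idem_in_center[OF \<phi>]]
      center_commute[OF idem_in_center[OF \<psi>] center_in_group_algebra[OF idem_in_center[OF \<phi>]]]
    by simp
  have "?x \<noteq> 0" "?y \<noteq> 0"
    using nz 1 2 by auto
  define t where "t = ?x / ?y"
  have t: "idem \<psi> = scale_fun t (idem \<phi>)"
  proof -
    have "scale_fun (1 / ?y) (scale_fun ?y (idem \<psi>)) = scale_fun (1 / ?y) (scale_fun ?x (idem \<phi>))"
      using 1 2 by simp
    then show ?thesis
      using \<open>?y \<noteq> 0\<close> by (simp add: t_def)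
  qed
  have "idem \<psi> = idem \<psi> \<star> idem \<psi>"
    by (simp add: idem_idem \<psi>)
  also have "\<dots> = scale_fun t (idem \<psi>)"
    using t by (simp add: conv_scale_left conv_scale_right idem_idem \<phi>)
  finally have "scale_fun (t - 1) (idem \<psi>) = 0"
    by (simp add: cfun.scale_left_diff_distrib)
  then have "t = 1"
    using idem_neq_0[OF \<psi>] by simp
  then have eq: "idem \<psi> = idem \<phi>"
    using t by simp
  obtain n m where n: "n > 0" "\<psi> \<one> = of_nat n" and m: "m > 0" "\<phi> \<one> = of_nat m"
    using Irr_degree[OF \<psi>] Irr_degree[OF \<phi>] by metis
  have val: "of_nat n * \<psi> g = of_nat m * \<phi> g" if "g \<in> carrier G" for g
    using fun_cong[OF eq, of "inv g"] that n m by (simp add: idem_apply)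
  have "of_nat n * of_nat n = (of_nat m * of_nat m :: complex)"
    using val[of \<one>] n m by simp
  then have "n * n = m * m"
    by (metis of_nat_eq_iff of_nat_mult)
  then have "n = m"
    by (metis power2_eq_iff_nonneg power2_eq_square zero_le)
  then have "\<psi> = \<phi>"
    using val n by (intro group_algebra_eqI Irr_in_group_algebra \<psi> \<phi>) auto
  with neq show False ..
qed

lemma central_char_idem:
  assumes "\<psi> \<in> Irr G" "\<phi> \<in> Irr G"
  shows "central_char \<psi> (idem \<phi>) = (if \<psi> = \<phi> then 1 else 0)"
proof (cases "\<psi> = \<phi>")
  case False
  then have "scale_fun (central_char \<psi> (idem \<phi>)) (idem \<psi>) = 0"
    using center_conv_idem[OF assms(1) idem_in_center[OF assms(2)]] idem_orthogonal[of \<phi> \<psi>] assms by simp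
  then show ?thesis
    using False idem_neq_0[OF assms(1)] by simp
qed (use assms in \<open>simp add: central_char_idem_self\<close>)

text \<open>\<open>central_char \<psi>\<close> is the eigenvalue on \<open>idem \<psi>\<close>, and
  eigenvalues on a common eigenvector multiply.\<close>

lemma central_char_conv:
  assumes \<psi>: "\<psi> \<in> Irr G" and a: "a \<in> ga_center G" and b: "b \<in> ga_center G"
  shows "central_char \<psi> (a \<star> b) = central_char \<psi> a * central_char \<psi> b"
proof -
  have "scale_fun (central_char \<psi> (a \<star> b)) (idem \<psi>) = (a \<star> b) \<star> idem \<psi>"
    using center_conv_idem[OF \<psi> conv_in_center[OF a b]] by simp
  also have "\<dots> = scale_fun (central_char \<psi> b) (a \<star> idem \<psi>)"
    unfolding conv_assoc center_conv_idem[OF \<psi> b] by (rule conv_scale_right)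
  also have "\<dots> = scale_fun (central_char \<psi> a * central_char \<psi> b) (idem \<psi>)"
    by (simp add: center_conv_idem[OF \<psi> a] mult.commute)
  finally show ?thesis
    using idem_neq_0[OF \<psi>] by simp
qed

lemma central_char_one: "\<psi> \<in> Irr G \<Longrightarrow> central_char \<psi> (hat {\<one>}) = 1"
  by (simp add: central_char_def hat_def Irr_one_neq_0 if_distrib[of "\<lambda>x. x * _"] cong: if_cong)

text \<open>\<open>star\<close> permutes the primitive idempotents, and \<open>star e \<star> e \<noteq> 0\<close>.\<close>

lemma star_idem:
  assumes \<psi>: "\<psi> \<in> Irr G"
  shows "star (idem \<psi>) = idem \<psi>"
proof -
  let ?e = "idem \<psi>" and ?w = "central_char \<psi> (star (idem \<psi>))"
  have eG: "?e \<in> group_algebra G"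
    by (simp add: center_in_group_algebra idem_in_center \<psi>)
  have 1: "star ?e \<star> ?e = scale_fun ?w ?e"
    by (rule center_conv_idem[OF \<psi> star_in_center[OF idem_in_center[OF \<psi>]]])
  \<comment> \<open>This product is self-adjoint and a multiple of \<open>?e\<close>, nonzero by
    positivity, so \<open>star ?e\<close> is proportional to \<open>?e\<close>. Idempotence of both
    then leaves only the factor 1.\<close>
  have "star (star ?e \<star> ?e) = star ?e \<star> ?e"
    by (simp add: star_conv star_star eG)
  then have 2: "scale_fun (cnj ?w) (star ?e) = scale_fun ?w ?e"
    unfolding 1 star_scale .
  have w: "?w \<noteq> 0"
    using star_conv_self_eq_0[OF eG] 1 idem_neq_0[OF \<psi>] by auto
  define t where "t = ?w / cnj ?w"
  have t: "star ?e = scale_fun t ?e"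
  proof -
    have "scale_fun (1 / cnj ?w) (scale_fun (cnj ?w) (star ?e)) = scale_fun (1 / cnj ?w) (scale_fun ?w ?e)"
      using 2 by simp
    then show ?thesis
      using w by (simp add: t_def)
  qed
  have "star ?e \<star> star ?e = star ?e"
    by (simp add: star_conv[symmetric] idem_idem \<psi>)
  then have "scale_fun (t * t) ?e = scale_fun t ?e"
    by (simp add: t conv_scale_left conv_scale_right idem_idem \<psi>)
  then have "t * t = t"
    using idem_neq_0[OF \<psi>] by simp
  moreover have "t \<noteq> 0"
    using w by (simp add: t_def)
  ultimately have "t = 1"
    by simp
  then show ?thesis
    using t by simp
qed

text \<open>Unitarity at the level of characters, read off from the self-adjoint idempotent instead
  of from an invariant inner product. The degree is real and nonzero, so it cancels.\<close>

lemma Irr_inv: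
  assumes \<psi>: "\<psi> \<in> Irr G" and g: "g \<in> carrier G"
  shows "\<psi> (inv g) = cnj (\<psi> g)"
proof -
  have "star (idem \<psi>) g = idem \<psi> g"
    by (simp add: star_idem \<psi>)
  moreover obtain n where "n > 0" "\<psi> \<one> = of_nat n"
    using Irr_degree[OF \<psi>] .
  ultimately show ?thesis
    using g by (simp add: star_def on_group_def idem_apply)
qed

end

section \<open>The central idempotents span the centre\<close>

text \<open>The kernel of \<open>f\<close> is a subspace that contains every other member of
  \<open>B\<close>, so \<open>b\<close> is not in their span. Point values and central characters
  serve as \<open>f\<close> below.\<close>

lemma independent_if_separated:
  assumes "\<And>b. b \<in> B \<Longrightarrow> \<exists>f :: ('a \<Rightarrow> complex) \<Rightarrow> complex. (\<forall>u v. f (u + v) = f u + f v) \<and>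
     (\<forall>c v. f (scale_fun c v) = c * f v) \<and> f b \<noteq> 0 \<and> (\<forall>b'\<in>B. b' \<noteq> b \<longrightarrow> f b' = 0)"
  shows "cfun.independent B"
proof
  assume "cfun.dependent B"
  then obtain b where b: "b \<in> B" "b \<in> cfun.span (B - {b})"
    by (auto simp: cfun.dependent_def)
  from assms[OF b(1)] obtain f :: "('a \<Rightarrow> complex) \<Rightarrow> complex" where
    f: "\<And>u v. f (u + v) = f u + f v" "\<And>c v. f (scale_fun c v) = c * f v" "f b \<noteq> 0"
       "\<And>b'. b' \<in> B \<Longrightarrow> b' \<noteq> b \<Longrightarrow> f b' = 0"
    by blast
  have "f 0 = 0"
    using f(2)[of 0 0] by simp
  then have "cfun.subspace {v. f v = 0}"
    by (simp add: cfun.subspace_def f)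
  then have "cfun.span (B - {b}) \<subseteq> {v. f v = 0}"
    by (intro cfun.span_minimal) (auto simp: f)
  with b(2) f(3) show False by auto
qed

text \<open>A generator outside the smaller span could be added to \<open>B\<close>, giving more
  independent vectors than \<open>C\<close> has elements. This turns an inclusion into an equality
  twice: for left ideals of least dimension and, at the end, for the span of the part sums.\<close>

lemma span_eq_if_card_le:
  assumes B: "cfun.independent B" "B \<subseteq> cfun.span C" and C: "finite C" "card C \<le> card B"
  shows "cfun.span B = cfun.span C"
proof
  show "cfun.span B \<subseteq> cfun.span C"
    by (rule cfun.span_minimal[OF B(2) cfun.subspace_span])
  have "c \<in> cfun.span B" if "c \<in> C" for c
  proof (rule ccontr)
    assume c: "c \<notin> cfun.span B"
    then have "cfun.independent (insert c B)"
      using B(1) by (rule cfun.independent_insertI)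
    moreover have "insert c B \<subseteq> cfun.span C"
      using B(2) that by (simp add: cfun.span_base)
    ultimately have "finite (insert c B) \<and> card (insert c B) \<le> card C"
      by (rule cfun.independent_span_bound[OF C(1)])
    moreover have "c \<notin> B"
      using c cfun.span_base[of c B] by auto
    ultimately show False
      using C(2) by auto
  qed
  then show "cfun.span C \<subseteq> cfun.span B"
    by (intro cfun.span_minimal[OF _ cfun.subspace_span] subsetI)
qed

context finite_group
begin

section \<open>Minimal left ideals and completeness of the idempotents\<close>

lemma finite_if_independent:
  assumes "cfun.independent B" "B \<subseteq> group_algebra G"
  shows "finite B" "card B \<le> card (carrier G)"
proof -
  have "finite B \<and> card B \<le> card ((\<lambda>g. hat {g} :: 'a \<Rightarrow> complex) ` carrier G)"
    using assms by (intro cfun.independent_span_bound) (auto simp: group_algebra_eq_span)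
  moreover have "card ((\<lambda>g. hat {g} :: 'a \<Rightarrow> complex) ` carrier G) \<le> card (carrier G)"
    by (rule card_image_le) simp
  ultimately show "finite B" "card B \<le> card (carrier G)" by auto
qed

lemma conv_expand_left:
  assumes "z \<in> group_algebra G"
  shows "z \<star> w = (\<Sum>g\<in>carrier G. scale_fun (z g) (hat {g} \<star> w))"
  by (subst expand_hat[OF assms]) (simp add: conv_sum_left conv_scale_left)

text \<open>These are the left ideals: the single group elements span the algebra, so stability
  under them suffices.\<close>

definition invariant :: "('a \<Rightarrow> complex) set \<Rightarrow> bool" where
  "invariant W \<longleftrightarrow> cfun.subspace W \<and> W \<subseteq> group_algebra G \<and> (\<forall>g\<in>carrier G. \<forall>w\<in>W. hat {g} \<star> w \<in> W)"

text \<open>Written in a basis, a minimal left ideal is an irreducible matrix representation, so its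
  character lies in \<open>Irr G\<close>. There \<open>z\<close> acts as a scalar by Schur's lemma,
  and \<open>orth\<close> says that the trace of this scalar matrix is zero.\<close>

lemma center_annihilates_minimal:
  assumes W: "invariant W" "W \<noteq> {0}"
    and min: "\<And>U. invariant U \<Longrightarrow> U \<subseteq> W \<Longrightarrow> U = {0} \<or> U = W"
    and z: "z \<in> ga_center G"
    and orth: "\<And>\<psi>. \<psi> \<in> Irr G \<Longrightarrow> (\<Sum>g\<in>carrier G. z g * \<psi> g) = 0"
    and w: "w \<in> W"
  shows "z \<star> w = 0"
proof -
  have sub: "cfun.subspace W" and WG: "W \<subseteq> group_algebra G"
    and inv: "\<And>g w. g \<in> carrier G \<Longrightarrow> w \<in> W \<Longrightarrow> hat {g} \<star> w \<in> W"
    using W by (auto simp: invariant_def)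
  obtain B where B: "B \<subseteq> W" "cfun.independent B" "W \<subseteq> cfun.span B" "card B = cfun.dim W"
    by (rule cfun.basis_exists)
  have fin: "finite B"
    using B(1,2) WG by (intro finite_if_independent(1)) auto
  define n where "n = card B"
  obtain e where e: "bij_betw e {..<n} B"
    using ex_bij_betw_nat_finite[OF fin] by (auto simp: n_def atLeast0LessThan)
  have eB: "e i \<in> B" "e i \<in> W" "e i \<in> cfun.span B" if "i < n" for i
    using e B that cfun.span_base by (auto simp: bij_betw_def)
  define co where "co w i = cfun.representation B w (e i)" for w i
  have expand: "w = (\<Sum>i<n. scale_fun (co w i) (e i))" if "w \<in> W" for w
  proof -
    have "w = (\<Sum>b\<in>B. scale_fun (cfun.representation B w b) b)"
      using cfun.sum_representation_eq[OF B(2) _ fin subset_refl] that B(3) by auto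
    also have "\<dots> = (\<Sum>i<n. scale_fun (co w i) (e i))"
      unfolding co_def by (rule sum.reindex_bij_betw[OF e, symmetric])
    finally show ?thesis .
  qed
  \<comment> \<open>\<open>\<Phi>\<close> and \<open>co\<close> are the two directions of the
    coordinate isomorphism between vectors of length \<open>n\<close> and \<open>W\<close>.\<close>
  define \<Phi> where "\<Phi> v = (\<Sum>i<n. scale_fun (v $ i) (e i))" for v
  have co_\<Phi>: "co (\<Phi> v) i = v $ i" if "i < n" for v i
  proof -
    have "co (\<Phi> v) i = (\<Sum>j<n. v $ j * cfun.representation B (e j) (e i))"
      unfolding co_def \<Phi>_def
      by (subst cfun.representation_sum[OF B(2)])
         (auto simp: eB cfun.span_scale cfun.representation_scale[OF B(2)])
    also have "\<dots> = (\<Sum>j<n. v $ j * (if j = i then 1 else 0))"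
      using e that eB by (intro sum.cong refl) (auto simp: cfun.representation_basis[OF B(2)] bij_betw_def inj_on_def)
    finally show ?thesis
      using that by (simp add: if_distrib[of "\<lambda>x. _ * x"] cong: if_cong)
  qed
  have \<Phi>_inj: "v = v'" if "v \<in> carrier_vec n" "v' \<in> carrier_vec n" "\<Phi> v = \<Phi> v'" for v v'
    using that co_\<Phi>[of _ v] co_\<Phi>[of _ v'] by (intro eq_vecI) auto
  have \<Phi>_W: "\<Phi> v \<in> W" for v
    unfolding \<Phi>_def using eB by (intro cfun.subspace_sum[OF sub] cfun.subspace_scale[OF sub]) auto
  have \<Phi>_add: "\<Phi> (v + v') = \<Phi> v + \<Phi> v'" if "v \<in> carrier_vec n" "v' \<in> carrier_vec n" for v v'
    using that by (simp add: \<Phi>_def cfun.scale_left_distrib sum.distrib)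
  have \<Phi>_scale: "\<Phi> (c \<cdot>\<^sub>v v) = scale_fun c (\<Phi> v)" if "v \<in> carrier_vec n" for v c
    using that by (simp add: \<Phi>_def cfun.scale_sum_right)
  have \<Phi>_0: "\<Phi> (0\<^sub>v n) = 0"
    by (simp add: \<Phi>_def)
  \<comment> \<open>Left multiplication by \<open>g\<close> in the basis \<open>e\<close>: column
    \<open>j\<close> holds the coordinates of \<open>hat {g} \<star> e j\<close>.\<close>
  define \<rho> where "\<rho> g = mat n n (\<lambda>(i, j). co (hat {g} \<star> e j) i)" for g
  have \<rho>_carrier: "\<rho> g \<in> carrier_mat n n" for g
    by (simp add: \<rho>_def)
  have act: "hat {g} \<star> e j = (\<Sum>i<n. scale_fun (\<rho> g $$ (i, j)) (e i))"
    if "g \<in> carrier G" "j < n" for g j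
    using expand[OF inv[OF that(1) eB(2)[OF that(2)]]] that by (simp add: \<rho>_def)
  have \<Phi>_\<rho>: "\<Phi> (\<rho> g *\<^sub>v v) = hat {g} \<star> \<Phi> v" if "g \<in> carrier G" "v \<in> carrier_vec n" for g v
  proof -
    have "hat {g} \<star> \<Phi> v = (\<Sum>j<n. \<Sum>i<n. scale_fun (\<rho> g $$ (i, j) * v $ j) (e i))"
      using that by (simp add: \<Phi>_def conv_sum_right conv_scale_right act cfun.scale_sum_right mult.commute)
    also have "\<dots> = (\<Sum>i<n. \<Sum>j<n. scale_fun (\<rho> g $$ (i, j) * v $ j) (e i))"
      by (rule sum.swap)
    also have "\<dots> = \<Phi> (\<rho> g *\<^sub>v v)"
      using that by (simp add: \<Phi>_def mult_mat_vec_index_sum[OF \<rho>_carrier] cfun.scale_sum_left del: index_mult_mat_vec)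
    finally show ?thesis ..
  qed
  have \<rho>_mult: "\<rho> (g \<otimes> h) = \<rho> g * \<rho> h" if gh: "g \<in> carrier G" "h \<in> carrier G" for g h
  proof (rule mat_eqI_mult_vec[of _ n n])
    fix v :: "complex vec" assume v: "v \<in> carrier_vec n"
    have \<rho>v: "\<rho> g *\<^sub>v (\<rho> h *\<^sub>v v) \<in> carrier_vec n" "\<rho> h *\<^sub>v v \<in> carrier_vec n"
      using v \<rho>_carrier by (auto intro!: mult_mat_vec_carrier)
    have "\<Phi> (\<rho> (g \<otimes> h) *\<^sub>v v) = hat {g} \<star> (hat {h} \<star> \<Phi> v)"
      using gh v by (simp add: \<Phi>_\<rho> conv_assoc[symmetric] hat_conv_hat)
    also have "\<dots> = \<Phi> (\<rho> g *\<^sub>v (\<rho> h *\<^sub>v v))"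
      using gh v \<rho>v by (simp add: \<Phi>_\<rho>)
    finally have "\<rho> (g \<otimes> h) *\<^sub>v v = \<rho> g *\<^sub>v (\<rho> h *\<^sub>v v)"
      using v \<rho>_carrier \<rho>v by (intro \<Phi>_inj) (auto intro!: mult_mat_vec_carrier)
    then show "\<rho> (g \<otimes> h) *\<^sub>v v = (\<rho> g * \<rho> h) *\<^sub>v v"
      using v by (simp add: assoc_mult_mat_vec[OF \<rho>_carrier \<rho>_carrier])
  qed (rule \<rho>_carrier mult_carrier_mat[OF \<rho>_carrier \<rho>_carrier])+
  have \<rho>_one: "\<rho> \<one> = 1\<^sub>m n"
  proof (rule mat_eqI_mult_vec[of _ n n])
    fix v :: "complex vec" assume v: "v \<in> carrier_vec n"
    have "\<Phi> (\<rho> \<one> *\<^sub>v v) = \<Phi> v"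
      using v by (simp add: \<Phi>_\<rho> one_conv[OF subsetD[OF WG \<Phi>_W]])
    then have "\<rho> \<one> *\<^sub>v v = v"
      using v \<rho>_carrier by (intro \<Phi>_inj) (auto intro!: mult_mat_vec_carrier)
    then show "\<rho> \<one> *\<^sub>v v = 1\<^sub>m n *\<^sub>v v"
      using v by simp
  qed (use \<rho>_carrier in auto)
  have "\<rho> g \<in> Units (ring_mat TYPE(complex) n ())" if "g \<in> carrier G" for g
    unfolding Units_def using that \<rho>_mult[of "inv g" g] \<rho>_mult[of g "inv g"] \<rho>_carrier
    by (auto simp: ring_mat_simps \<rho>_one intro!: bexI[of _ "\<rho> (inv g)"])
  then have hom: "\<rho> \<in> hom G (GL n)"
    by (auto simp: hom_def GL_def units_of_def ring_mat_simps \<rho>_mult)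
  have "n > 0"
  proof (rule ccontr)
    assume "\<not> n > 0"
    then have "W \<subseteq> {0}" using expand by auto
    with W(2) cfun.subspace_0[OF sub] show False by auto
  qed
  have irr: "irreducible_rep G n \<rho>"
    unfolding irreducible_rep_def
  proof (intro conjI allI impI hom \<open>n > 0\<close>)
    fix U assume "VectorSpace.subspace class_ring U (module_vec TYPE(complex) n)"
      and Uinv: "\<forall>g\<in>carrier G. \<forall>w\<in>U. \<rho> g *\<^sub>v w \<in> U"
    then have U: "U \<subseteq> carrier_vec n" "0\<^sub>v n \<in> U" "\<And>v w. v \<in> U \<Longrightarrow> w \<in> U \<Longrightarrow> v + w \<in> U"
      "\<And>c v. v \<in> U \<Longrightarrow> c \<cdot>\<^sub>v v \<in> U"
      by (auto simp: subspace_module_vec_iff)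
    \<comment> \<open>An invariant subspace of vectors corresponds to a left ideal inside
      \<open>W\<close>, to which minimality applies.\<close>
    have "invariant (\<Phi> ` U)"
      unfolding invariant_def cfun.subspace_def
    proof (intro conjI ballI allI)
      show "0 \<in> \<Phi> ` U"
        using U(2) \<Phi>_0 by force
      show "\<Phi> ` U \<subseteq> group_algebra G"
        using \<Phi>_W WG by auto
      fix x assume "x \<in> \<Phi> ` U"
      then obtain u where u: "u \<in> U" "x = \<Phi> u" by auto
      have uc: "u \<in> carrier_vec n" using u U(1) by auto
      show "scale_fun c x \<in> \<Phi> ` U" for c
        by (rule image_eqI[of _ _ "c \<cdot>\<^sub>v u"]) (simp_all add: \<Phi>_scale[OF uc] u U(4))
      show "hat {g} \<star> x \<in> \<Phi> ` U" if "g \<in> carrier G" for g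
        by (rule image_eqI[of _ _ "\<rho> g *\<^sub>v u"]) (use \<Phi>_\<rho>[OF that uc] u Uinv that in auto)
      fix y assume "y \<in> \<Phi> ` U"
      then obtain u' where u': "u' \<in> U" "y = \<Phi> u'" by auto
      have "u' \<in> carrier_vec n" using u' U(1) by auto
      then show "x + y \<in> \<Phi> ` U"
        by (intro image_eqI[of _ _ "u + u'"]) (simp_all add: \<Phi>_add[OF uc] u u' U(3))
    qed
    moreover have "\<Phi> ` U \<subseteq> W"
      using \<Phi>_W by auto
    ultimately consider "\<Phi> ` U = {0}" | "\<Phi> ` U = W"
      using min by blast
    then show "U = {0\<^sub>v n} \<or> U = carrier_vec n"
    proof cases
      case 1
      have "u = 0\<^sub>v n" if "u \<in> U" for u
      proof (rule \<Phi>_inj)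
        from that have "\<Phi> u \<in> \<Phi> ` U" by simp
        with 1 show "\<Phi> u = \<Phi> (0\<^sub>v n)" by (simp add: \<Phi>_0)
      qed (use that U(1) in auto)
      then show ?thesis using U(2) by blast
    next
      case 2
      have "v \<in> U" if v: "v \<in> carrier_vec n" for v
      proof -
        have "\<Phi> v \<in> \<Phi> ` U" by (simp add: 2 \<Phi>_W)
        then obtain u where u: "u \<in> U" "\<Phi> v = \<Phi> u" by blast
        have "v = u"
          by (rule \<Phi>_inj[OF v subsetD[OF U(1) u(1)] u(2)])
        with u show ?thesis by simp
      qed
      then show ?thesis using U(1) by blast
    qed
  qed
  have "on_group G (\<lambda>g. trace_mat (\<rho> g)) \<in> Irr G"
    using irr by (auto simp: Irr_def)
  then have zero: "(\<Sum>g\<in>carrier G. z g * \<rho> g $$ (i, j)) = 0" if "i < n" "j < n" for i j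
    using center_acts_as_scalar[OF irr z that] orth by simp
  have ze: "z \<star> e j = 0" if "j < n" for j
  proof -
    have "z \<star> e j = (\<Sum>g\<in>carrier G. \<Sum>i<n. scale_fun (z g * \<rho> g $$ (i, j)) (e i))"
      using that by (simp add: conv_expand_left[OF center_in_group_algebra[OF z]] act cfun.scale_sum_right)
    also have "\<dots> = (\<Sum>i<n. scale_fun (\<Sum>g\<in>carrier G. z g * \<rho> g $$ (i, j)) (e i))"
      by (subst sum.swap) (simp add: cfun.scale_sum_left)
    also have "\<dots> = 0"
      using that by (simp add: zero)
    finally show ?thesis .
  qed
  have "z \<star> w = (\<Sum>j<n. scale_fun (co w j) (z \<star> e j))"
    by (subst expand[OF w]) (simp add: conv_sum_right conv_scale_right)
  then show ?thesis
    by (simp add: ze)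
qed

text \<open>Otherwise \<open>z\<close> would annihilate a minimal left ideal inside the ideal that it generates, which
  the positive definiteness of \<open>star\<close> forbids.\<close>

lemma center_eq_0_if_orthogonal:
  assumes z: "z \<in> ga_center G"
    and orth: "\<And>\<psi>. \<psi> \<in> Irr G \<Longrightarrow> (\<Sum>g\<in>carrier G. z g * \<psi> g) = 0"
  shows "z = 0"
proof (rule ccontr)
  assume nz: "z \<noteq> 0"
  have zG: "z \<in> group_algebra G"
    by (rule center_in_group_algebra[OF z])
  define Y where "Y = (\<lambda>a. z \<star> a) ` group_algebra G"
  define Q where "Q W \<longleftrightarrow> invariant W \<and> W \<subseteq> Y \<and> W \<noteq> {0}" for W
  have "invariant Y"
    unfolding invariant_def cfun.subspace_def
  proof (intro conjI ballI allI)
    show "0 \<in> Y"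
      unfolding Y_def by (rule image_eqI[of _ _ 0]) (simp_all add: cfun.subspace_0[OF subspace_group_algebra])
    show "Y \<subseteq> group_algebra G"
      by (auto simp: Y_def)
    fix x assume "x \<in> Y"
    then obtain a where a: "a \<in> group_algebra G" "x = z \<star> a" by (auto simp: Y_def)
    show "scale_fun c x \<in> Y" for c
      unfolding Y_def by (rule image_eqI[of _ _ "scale_fun c a"])
        (simp_all add: a conv_scale_right cfun.subspace_scale[OF subspace_group_algebra])
    show "hat {g} \<star> x \<in> Y" if "g \<in> carrier G" for g
    proof -
      have "hat {g} \<star> x = z \<star> (hat {g} \<star> a)"
        unfolding a(2) conv_assoc[symmetric]
        using center_commute[OF z, of "hat {g}"] that by (simp add: hat_in_group_algebra)
      then show ?thesis by (simp add: Y_def)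
    qed
    fix y assume "y \<in> Y"
    then obtain b where b: "b \<in> group_algebra G" "y = z \<star> b" by (auto simp: Y_def)
    show "x + y \<in> Y"
      unfolding Y_def by (rule image_eqI[of _ _ "a + b"])
        (simp_all add: a b conv_add_right cfun.subspace_add[OF subspace_group_algebra])
  qed
  moreover have "z \<in> Y"
    unfolding Y_def by (rule image_eqI[of _ _ "hat {\<one>}"]) (simp_all add: zG hat_in_group_algebra)
  ultimately have "Q Y"
    using nz by (auto simp: Q_def)
  \<comment> \<open>A nonzero left ideal of least dimension is minimal, because an inclusion between
    spaces of equal dimension is an equality.\<close>
  then obtain W where W: "Q W" and least: "\<And>U. Q U \<Longrightarrow> cfun.dim W \<le> cfun.dim U"
    using ex_has_least_nat[of Q Y cfun.dim] by metis
  have min: "U = {0} \<or> U = W" if U: "invariant U" "U \<subseteq> W" for U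
  proof (rule disjCI)
    assume "U \<noteq> W"
    show "U = {0}"
    proof (rule ccontr)
      assume "U \<noteq> {0}"
      then have "Q U" using U W by (auto simp: Q_def)
      have "W \<subseteq> group_algebra G" using W by (auto simp: Q_def invariant_def)
      obtain B where B: "B \<subseteq> U" "cfun.independent B" "U \<subseteq> cfun.span B" "card B = cfun.dim U"
        by (rule cfun.basis_exists)
      obtain C where C: "C \<subseteq> W" "cfun.independent C" "W \<subseteq> cfun.span C" "card C = cfun.dim W"
        by (rule cfun.basis_exists)
      have "finite C"
        using C \<open>W \<subseteq> group_algebra G\<close> by (intro finite_if_independent(1)) auto
      then have "cfun.span B = cfun.span C"
        using least[OF \<open>Q U\<close>] B C U(2) by (intro span_eq_if_card_le) auto
      moreover have "cfun.span B = U" "cfun.span C = W"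
        using U(1) W by (auto simp only: invariant_def Q_def intro!: cfun.span_subspace[OF B(1,3)] cfun.span_subspace[OF C(1,3)])
      ultimately show False using \<open>U \<noteq> W\<close> by simp
    qed
  qed
  have ann: "z \<star> w = 0" if "w \<in> W" for w
    using W that by (intro center_annihilates_minimal[OF _ _ min z orth]) (auto simp: Q_def)
  have "0 \<in> W"
    using W cfun.subspace_0 unfolding Q_def invariant_def by blast
  then obtain w where w: "w \<in> W" "w \<noteq> 0"
    using W unfolding Q_def by blast
  \<comment> \<open>The elements of \<open>W\<close> are multiples of \<open>z\<close> and are
    annihilated by \<open>z\<close>. As \<open>z\<close> commutes with \<open>star z\<close>,
    positivity shows that \<open>star z\<close> annihilates \<open>w\<close> too; then
    \<open>star w \<star> w\<close>, which contains the factor \<open>star z \<star> w\<close>,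
    vanishes.\<close>
  obtain a where a: "w = z \<star> a"
    using W w unfolding Q_def Y_def by blast
  have "star (star z \<star> w) \<star> (star z \<star> w) = star w \<star> (z \<star> (star z \<star> w))"
    by (simp add: star_conv star_star zG conv_assoc)
  also have "z \<star> (star z \<star> w) = star z \<star> (z \<star> w)"
    by (simp add: conv_assoc[symmetric] center_commute[OF z])
  finally have "star (star z \<star> w) \<star> (star z \<star> w) = 0"
    by (simp only: ann[OF w(1)] conv_0_right)
  then have sw: "star z \<star> w = 0"
    by (rule star_conv_self_eq_0[rotated]) simp
  have "star w \<star> w = star a \<star> (star z \<star> w)"
    unfolding a star_conv conv_assoc ..
  then have "star w \<star> w = 0"
    by (simp add: sw)
  then have "w = 0"
    by (rule star_conv_self_eq_0[rotated]) (simp add: a)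
  with w show False by simp
qed

lemma inj_on_idem: "inj_on idem (Irr G)"
proof (rule inj_onI, rule ccontr)
  fix \<psi> \<phi> assume *: "\<psi> \<in> Irr G" "\<phi> \<in> Irr G" "idem \<psi> = idem \<phi>" "\<psi> \<noteq> \<phi>"
  then show False
    using central_char_idem[of \<psi> \<phi>] central_char_idem[of \<psi> \<psi>] by simp
qed

text \<open>\<open>Irr G\<close> collects the characters of matrix representations of every degree;
  finiteness comes from the independence of their idempotents in a space of dimension |G|.\<close>

lemma finite_Irr: "finite (Irr G)"
proof -
  have "cfun.independent (idem ` Irr G)"
  proof (rule independent_if_separated)
    fix b assume "b \<in> idem ` Irr G"
    then obtain \<psi> where \<psi>: "\<psi> \<in> Irr G" "b = idem \<psi>" by auto
    then show "\<exists>f :: ('a \<Rightarrow> complex) \<Rightarrow> complex. (\<forall>u v. f (u + v) = f u + f v) \<and>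
        (\<forall>c v. f (scale_fun c v) = c * f v) \<and> f b \<noteq> 0 \<and> (\<forall>b'\<in>idem ` Irr G. b' \<noteq> b \<longrightarrow> f b' = 0)"
      by (intro exI[of _ "central_char \<psi>"] conjI allI ballI impI)
         (auto simp: central_char_add central_char_scale central_char_idem)
  qed
  then have "finite (idem ` Irr G)"
    by (rule finite_if_independent) (auto simp: central_idempotent_def)
  then show ?thesis
    by (rule finite_imageD[OF _ inj_on_idem])
qed

text \<open>The difference of the two sides is central and all its central characters
  vanish.\<close>

lemma center_expand:
  assumes z: "z \<in> ga_center G"
  shows "z = (\<Sum>\<psi>\<in>Irr G. scale_fun (central_char \<psi> z) (idem \<psi>))"
proof -
  let ?s = "\<Sum>\<psi>\<in>Irr G. scale_fun (central_char \<psi> z) (idem \<psi>)"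
  have s: "?s \<in> ga_center G"
    by (intro cfun.subspace_sum[OF subspace_center] cfun.subspace_scale[OF subspace_center] idem_in_center)
  have "z - ?s = 0"
  proof (rule center_eq_0_if_orthogonal)
    show "z - ?s \<in> ga_center G"
      by (rule cfun.subspace_diff[OF subspace_center z s])
    fix \<phi> assume \<phi>: "\<phi> \<in> Irr G"
    have "central_char \<phi> ?s = (\<Sum>\<psi>\<in>Irr G. central_char \<psi> z * (if \<phi> = \<psi> then 1 else 0))"
      using \<phi> by (simp add: central_char_sum central_char_scale central_char_idem)
    also have "\<dots> = central_char \<phi> z"
      using \<phi> finite_Irr by (simp add: if_distrib[of "\<lambda>x. _ * x"] cong: if_cong)
    finally have "central_char \<phi> (z - ?s) = 0"
      using central_char_add[of \<phi> "z - ?s" ?s] by simp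
    then show "(\<Sum>g\<in>carrier G. (z - ?s) g * \<phi> g) = 0"
      using Irr_one_neq_0[OF \<phi>] by (simp add: central_char_def)
  qed
  then show ?thesis by simp
qed

end

section \<open>Subalgebras spanned by idempotents\<close>

text \<open>The coordinates identify \<open>A\<close> with the functions on \<open>I\<close> under
  pointwise multiplication. The two instances are point values on the group algebra with the
  Hadamard product, and central characters on the centre with convolution. \<open>Cl\<close> and
  \<open>Ch\<close> thereby become the same construction.\<close>

locale idempotent_coordinates =
  fixes I :: "'i set" and E :: "'i \<Rightarrow> 'a \<Rightarrow> complex"
    and \<omega> :: "'i \<Rightarrow> ('a \<Rightarrow> complex) \<Rightarrow> complex"
    and A :: "('a \<Rightarrow> complex) set"
    and mul :: "('a \<Rightarrow> complex) \<Rightarrow> ('a \<Rightarrow> complex) \<Rightarrow> 'a \<Rightarrow> complex"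
  assumes finite_index: "finite I"
    and subspace_A: "cfun.subspace A"
    and E_in: "\<And>i. i \<in> I \<Longrightarrow> E i \<in> A"
    and coord_add: "\<And>i u v. \<omega> i (u + v) = \<omega> i u + \<omega> i v"
    and coord_scale: "\<And>i c v. \<omega> i (scale_fun c v) = c * \<omega> i v"
    and coord_E: "\<And>i j. i \<in> I \<Longrightarrow> j \<in> I \<Longrightarrow> \<omega> i (E j) = (if i = j then 1 else 0)"
    and coord_expand: "\<And>s. s \<in> A \<Longrightarrow> s = (\<Sum>i\<in>I. scale_fun (\<omega> i s) (E i))"
    and mul_in: "\<And>s t. s \<in> A \<Longrightarrow> t \<in> A \<Longrightarrow> mul s t \<in> A"
    and coord_mul: "\<And>i s t. i \<in> I \<Longrightarrow> s \<in> A \<Longrightarrow> t \<in> A \<Longrightarrow> \<omega> i (mul s t) = \<omega> i s * \<omega> i t"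
begin

definition block_sum :: "'i set \<Rightarrow> 'a \<Rightarrow> complex" where
  "block_sum X = (\<Sum>i\<in>X. E i)"

definition coord_class :: "('a \<Rightarrow> complex) set \<Rightarrow> 'i \<Rightarrow> 'i set" where
  "coord_class S i = {j \<in> I. \<forall>s\<in>S. \<omega> j s = \<omega> i s}"

definition parts :: "('a \<Rightarrow> complex) set \<Rightarrow> 'i set set" where
  "parts S = coord_class S ` I"

lemma coord_sum: "\<omega> i (\<Sum>j\<in>J. f j) = (\<Sum>j\<in>J. \<omega> i (f j))"
  by (rule additive.sum[of "\<omega> i", OF additive.intro]) (rule coord_add)

lemma coord_0: "\<omega> i 0 = 0"
  using coord_add[of i 0 0] by simp

lemma coord_diff: "\<omega> i (u - v) = \<omega> i u - \<omega> i v"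
  using coord_add[of i "u - v" v] by simp

lemma coord_eqI:
  assumes "s \<in> A" "t \<in> A" "\<And>i. i \<in> I \<Longrightarrow> \<omega> i s = \<omega> i t"
  shows "s = t"
proof -
  have "s = (\<Sum>i\<in>I. scale_fun (\<omega> i s) (E i))"
    by (rule coord_expand[OF assms(1)])
  also have "\<dots> = (\<Sum>i\<in>I. scale_fun (\<omega> i t) (E i))"
    by (rule sum.cong) (simp_all add: assms(3))
  also have "\<dots> = t"
    by (rule coord_expand[OF assms(2), symmetric])
  finally show ?thesis .
qed

lemma block_sum_in: "X \<subseteq> I \<Longrightarrow> block_sum X \<in> A"
  unfolding block_sum_def by (intro cfun.subspace_sum[OF subspace_A] E_in) auto

lemma coord_block_sum:
  assumes "X \<subseteq> I" "i \<in> I"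
  shows "\<omega> i (block_sum X) = (if i \<in> X then 1 else 0)"
proof -
  have "\<omega> i (block_sum X) = (\<Sum>j\<in>X. if i = j then 1 else 0)"
    unfolding block_sum_def coord_sum using assms by (intro sum.cong refl coord_E) auto
  then show ?thesis
    using finite_subset[OF assms(1) finite_index] by simp
qed

lemma inj_on_block_sum: "inj_on block_sum (Pow I)"
proof (rule inj_onI)
  fix X Y assume XY: "X \<in> Pow I" "Y \<in> Pow I" "block_sum X = block_sum Y"
  have "i \<in> X \<longleftrightarrow> i \<in> Y" if "i \<in> I" for i
    using coord_block_sum[of X i] coord_block_sum[of Y i] XY that by (auto split: if_splits)
  then show "X = Y" using XY by blast
qed

lemma partition_on_subset: "partition_on I \<X> \<Longrightarrow> X \<in> \<X> \<Longrightarrow> X \<subseteq> I"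
  by (auto simp: partition_on_def)

lemma partition_on_nonempty:
  assumes "partition_on I \<X>" "X \<in> \<X>"
  shows "\<exists>i. i \<in> X"
proof -
  have "X \<noteq> {}"
    using assms by (auto simp: partition_on_def)
  then show ?thesis by blast
qed

lemma partition_on_eq:
  "partition_on I \<X> \<Longrightarrow> X \<in> \<X> \<Longrightarrow> Y \<in> \<X> \<Longrightarrow> i \<in> X \<Longrightarrow> i \<in> Y \<Longrightarrow> X = Y"
  by (auto simp: partition_on_def disjoint_def)

lemma orthogonal_block_sums:
  assumes "partition_on I \<X>"
  shows "orthogonal_idempotents mul (block_sum ` \<X>)"
  unfolding orthogonal_idempotents_def
proof (intro ballI)
  fix u v assume "u \<in> block_sum ` \<X>" "v \<in> block_sum ` \<X>"
  then obtain X Y where X: "X \<in> \<X>" "u = block_sum X" and Y: "Y \<in> \<X>" "v = block_sum Y" by auto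
  note sub = partition_on_subset[OF assms X(1)] partition_on_subset[OF assms Y(1)]
  have eq: "u = v \<longleftrightarrow> X = Y"
    using inj_onD[OF inj_on_block_sum, of X Y] sub by (auto simp: X Y)
  have "mul u v = (if X = Y then u else 0)"
  proof (rule coord_eqI)
    show "mul u v \<in> A" "(if X = Y then u else 0) \<in> A"
      using sub by (auto simp: X Y intro!: mul_in block_sum_in cfun.subspace_0[OF subspace_A])
    fix i assume "i \<in> I"
    then show "\<omega> i (mul u v) = \<omega> i (if X = Y then u else 0)"
      using partition_on_eq[OF assms X(1) Y(1), of i] sub
      by (auto simp: X(2) Y(2) coord_mul block_sum_in coord_block_sum coord_0)
  qed
  then show "mul u v = (if u = v then u else 0)"
    by (simp only: eq)
qed

lemma independent_block_sums:
  assumes "partition_on I \<X>"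
  shows "cfun.independent (block_sum ` \<X>)"
proof (rule independent_if_separated)
  fix b assume "b \<in> block_sum ` \<X>"
  then obtain X where X: "X \<in> \<X>" "b = block_sum X" by auto
  then obtain i where i: "i \<in> X"
    using partition_on_nonempty[OF assms] by blast
  have iI: "i \<in> I" and XI: "X \<subseteq> I"
    using partition_on_subset[OF assms X(1)] i by auto
  have "\<omega> i b' = 0" if b': "b' \<in> block_sum ` \<X>" "b' \<noteq> b" for b'
  proof -
    obtain Y where Y: "Y \<in> \<X>" "b' = block_sum Y" using b' by auto
    then have "i \<notin> Y"
      using partition_on_eq[OF assms X(1) Y(1) i] X b' by auto
    then show ?thesis
      using partition_on_subset[OF assms Y(1)] iI by (simp add: Y coord_block_sum)
  qed
  then show "\<exists>f :: ('a \<Rightarrow> complex) \<Rightarrow> complex. (\<forall>u v. f (u + v) = f u + f v) \<and>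
      (\<forall>c v. f (scale_fun c v) = c * f v) \<and> f b \<noteq> 0 \<and> (\<forall>b'\<in>block_sum ` \<X>. b' \<noteq> b \<longrightarrow> f b' = 0)"
    using X iI XI i
    by (intro exI[of _ "\<omega> i"] conjI allI ballI impI) (simp_all add: coord_add coord_scale coord_block_sum)
qed

lemma card_block_sums:
  assumes "partition_on I \<X>"
  shows "card (block_sum ` \<X>) = card \<X>"
  using partition_on_subset[OF assms] by (intro card_image inj_on_subset[OF inj_on_block_sum]) auto

section \<open>Spans of block sums and the partition belonging to a subalgebra\<close>

definition const_on :: "'i set set \<Rightarrow> ('a \<Rightarrow> complex) \<Rightarrow> bool" where
  "const_on \<X> s \<longleftrightarrow> (\<forall>X\<in>\<X>. \<forall>i\<in>X. \<forall>j\<in>X. \<omega> i s = \<omega> j s)"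

lemma const_onI: "(\<And>X i j. X \<in> \<X> \<Longrightarrow> i \<in> X \<Longrightarrow> j \<in> X \<Longrightarrow> \<omega> i s = \<omega> j s) \<Longrightarrow> const_on \<X> s"
  unfolding const_on_def by blast

lemma const_onD: "const_on \<X> s \<Longrightarrow> X \<in> \<X> \<Longrightarrow> i \<in> X \<Longrightarrow> j \<in> X \<Longrightarrow> \<omega> i s = \<omega> j s"
  unfolding const_on_def by blast

lemma subspace_const_on: "cfun.subspace {s \<in> A. const_on \<X> s}"
  unfolding cfun.subspace_def
proof (intro conjI ballI allI)
  show "0 \<in> {s \<in> A. const_on \<X> s}"
    using cfun.subspace_0[OF subspace_A] by (simp add: const_on_def coord_0)
  fix s assume s: "s \<in> {s \<in> A. const_on \<X> s}"
  have "const_on \<X> (scale_fun c s)" for c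
  proof (rule const_onI)
    fix X i j assume X: "X \<in> \<X>" "i \<in> X" "j \<in> X"
    have "\<omega> i s = \<omega> j s"
      using s X by (auto intro: const_onD)
    then show "\<omega> i (scale_fun c s) = \<omega> j (scale_fun c s)"
      by (simp only: coord_scale)
  qed
  then show "scale_fun c s \<in> {s \<in> A. const_on \<X> s}" for c
    using s cfun.subspace_scale[OF subspace_A] by simp
  fix t assume t: "t \<in> {s \<in> A. const_on \<X> s}"
  have "const_on \<X> (s + t)"
  proof (rule const_onI)
    fix X i j assume X: "X \<in> \<X>" "i \<in> X" "j \<in> X"
    have "\<omega> i s = \<omega> j s" "\<omega> i t = \<omega> j t"
      using s t X by (auto intro: const_onD)
    then show "\<omega> i (s + t) = \<omega> j (s + t)"
      by (simp only: coord_add)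
  qed
  then show "s + t \<in> {s \<in> A. const_on \<X> s}"
    using s t cfun.subspace_add[OF subspace_A] by simp
qed

text \<open>In coordinates a block sum is the indicator function of its block. The description of
  the span by conditions on coordinates makes its closure under \<open>mul\<close>
  immediate.\<close>

lemma span_block_sums:
  assumes P: "partition_on I \<X>"
  shows "cfun.span (block_sum ` \<X>) = {s \<in> A. const_on \<X> s}" (is "_ = ?R")
proof
  have "cfun.subspace ?R"
    by (rule subspace_const_on)
  moreover have "block_sum X \<in> ?R" if X: "X \<in> \<X>" for X
  proof -
    have "\<omega> i (block_sum X) = \<omega> j (block_sum X)" if Y: "Y \<in> \<X>" "i \<in> Y" "j \<in> Y" for Y i j
    proof -
      have "i \<in> X \<longleftrightarrow> j \<in> X"
      proof
        assume "i \<in> X"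
        from partition_on_eq[OF P X Y(1) this Y(2)] show "j \<in> X" using Y(3) by simp
      next
        assume "j \<in> X"
        from partition_on_eq[OF P X Y(1) this Y(3)] show "i \<in> X" using Y(2) by simp
      qed
      moreover have "i \<in> I" "j \<in> I"
        using partition_on_subset[OF P Y(1)] Y(2,3) by auto
      ultimately show ?thesis
        by (simp add: coord_block_sum[OF partition_on_subset[OF P X]])
    qed
    then have "const_on \<X> (block_sum X)"
      by (rule const_onI)
    then show ?thesis
      using block_sum_in[OF partition_on_subset[OF P X]] by simp
  qed
  ultimately show "cfun.span (block_sum ` \<X>) \<subseteq> ?R"
    by (intro cfun.span_minimal[OF image_subsetI])
next
  show "?R \<subseteq> cfun.span (block_sum ` \<X>)"
  proof
    fix s assume "s \<in> ?R"
    then have sA: "s \<in> A" and const: "\<And>X i j. X \<in> \<X> \<Longrightarrow> i \<in> X \<Longrightarrow> j \<in> X \<Longrightarrow> \<omega> i s = \<omega> j s"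
      by (auto intro: const_onD)
    have fin: "finite X" if "X \<in> \<X>" for X
      using partition_on_subset[OF P that] finite_index by (rule finite_subset)
    have part: "(\<Sum>j\<in>X. scale_fun (\<omega> j s) (E j)) \<in> cfun.span (block_sum ` \<X>)" if X: "X \<in> \<X>" for X
    proof -
      obtain i where i: "i \<in> X"
        using partition_on_nonempty[OF P X] by blast
      have "(\<Sum>j\<in>X. scale_fun (\<omega> j s) (E j)) = (\<Sum>j\<in>X. scale_fun (\<omega> i s) (E j))"
        by (intro sum.cong refl arg_cong2[where f = scale_fun] const[OF X _ i])
      then have "(\<Sum>j\<in>X. scale_fun (\<omega> j s) (E j)) = scale_fun (\<omega> i s) (block_sum X)"
        by (simp only: block_sum_def cfun.scale_sum_right)
      then show ?thesis
        using X by (simp add: cfun.span_scale cfun.span_base)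
    qed
    have disj: "\<forall>X\<in>\<X>. \<forall>Y\<in>\<X>. X \<noteq> Y \<longrightarrow> X \<inter> Y = {}"
      using P by (simp add: partition_on_def disjoint_def)
    have "\<forall>X\<in>\<X>. finite X"
      using fin by blast
    note sum.Union_disjoint[OF this disj, of "\<lambda>i. scale_fun (\<omega> i s) (E i)"]
    moreover have "\<Union>\<X> = I"
      using P by (simp add: partition_on_def)
    ultimately have "(\<Sum>i\<in>I. scale_fun (\<omega> i s) (E i)) = (\<Sum>X\<in>\<X>. \<Sum>i\<in>X. scale_fun (\<omega> i s) (E i))"
      by simp
    then have "s = (\<Sum>X\<in>\<X>. \<Sum>i\<in>X. scale_fun (\<omega> i s) (E i))"
      by (rule trans[OF coord_expand[OF sA]])
    moreover have "(\<Sum>X\<in>\<X>. \<Sum>i\<in>X. scale_fun (\<omega> i s) (E i)) \<in> cfun.span (block_sum ` \<X>)"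
      by (rule cfun.span_sum[OF part])
    ultimately show "s \<in> cfun.span (block_sum ` \<X>)"
      by (rule ssubst[of _ _ "\<lambda>x. x \<in> cfun.span (block_sum ` \<X>)"])
  qed
qed

lemma span_block_sums_mul:
  assumes "partition_on I \<X>" "s \<in> cfun.span (block_sum ` \<X>)" "t \<in> cfun.span (block_sum ` \<X>)"
  shows "mul s t \<in> cfun.span (block_sum ` \<X>)"
proof -
  have "\<omega> i (mul s t) = \<omega> j (mul s t)" if "X \<in> \<X>" "i \<in> X" "j \<in> X" for X i j
  proof -
    have "i \<in> I" "j \<in> I"
      using that partition_on_subset[OF assms(1)] by auto
    moreover have "\<omega> i s = \<omega> j s" "\<omega> i t = \<omega> j t" "s \<in> A" "t \<in> A"
      using assms(2,3) const_onD[OF _ that] unfolding span_block_sums[OF assms(1)] by auto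
    ultimately show ?thesis
      by (simp add: coord_mul)
  qed
  moreover have "mul s t \<in> A"
    using assms(2,3) unfolding span_block_sums[OF assms(1)] by (intro mul_in) auto
  ultimately show ?thesis
    unfolding span_block_sums[OF assms(1)] by (auto intro: const_onI)
qed

text \<open>The span remembers the partition: its elements are constant on blocks, while
  \<open>block_sum X\<close> separates \<open>X\<close> from everything else. This gives the
  uniqueness in \<open>The_parts\<close> and later recovers \<open>P\<close> from the span of its
  part sums.\<close>

lemma eq_parts_if_span:
  assumes P: "partition_on I \<X>" and S: "cfun.span (block_sum ` \<X>) = S"
  shows "\<X> = parts S"
proof -
  have coord_class: "coord_class S i = X" if X: "X \<in> \<X>" "i \<in> X" for X i
  proof
    have XI: "X \<subseteq> I" by (rule partition_on_subset[OF P X(1)])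
    show "X \<subseteq> coord_class S i"
    proof
      fix j assume "j \<in> X"
      then show "j \<in> coord_class S i"
        using XI const_onD[OF _ X(1) _ X(2)] unfolding coord_class_def S[symmetric] span_block_sums[OF P] by auto
    qed
    show "coord_class S i \<subseteq> X"
    proof
      fix j assume j: "j \<in> coord_class S i"
      have "block_sum X \<in> S"
        unfolding S[symmetric] using X by (intro cfun.span_base) auto
      then have "\<omega> j (block_sum X) = \<omega> i (block_sum X)" and "j \<in> I"
        using j by (auto simp: coord_class_def)
      then show "j \<in> X"
        using X XI coord_block_sum[of X i] coord_block_sum[of X j] by (auto split: if_splits)
    qed
  qed
  show ?thesis
  proof
    show "\<X> \<subseteq> parts S"
    proof
      fix X assume X: "X \<in> \<X>"
      then obtain i where i: "i \<in> X"
        using partition_on_nonempty[OF P] by blast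
      then have "i \<in> I" using partition_on_subset[OF P X] by auto
      then show "X \<in> parts S"
        using coord_class[OF X i] by (auto simp: parts_def)
    qed
    show "parts S \<subseteq> \<X>"
    proof
      fix X assume "X \<in> parts S"
      then obtain i where i: "i \<in> I" "X = coord_class S i" by (auto simp: parts_def)
      then obtain Y where "Y \<in> \<X>" "i \<in> Y"
        using P by (auto simp: partition_on_def)
      then show "X \<in> \<X>" using coord_class i by simp
    qed
  qed
qed

lemma partition_parts: "partition_on I (parts S)"
proof (rule partition_onI)
  show "\<Union> (parts S) = I"
    by (auto simp: parts_def coord_class_def)
  fix p q assume pq: "p \<in> parts S" "q \<in> parts S" "p \<noteq> q"
  then obtain i j where ij: "p = coord_class S i" "q = coord_class S j" by (auto simp: parts_def)
  show "disjnt p q"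
    unfolding disjnt_def
  proof (rule ccontr)
    assume "p \<inter> q \<noteq> {}"
    then obtain k where "k \<in> p" "k \<in> q" by blast
    then have "\<forall>s\<in>S. \<omega> i s = \<omega> j s"
      by (auto simp: ij coord_class_def)
    then have "p = q"
      by (auto simp: ij coord_class_def)
    with pq show False by simp
  qed
qed (auto simp: parts_def coord_class_def)

text \<open>Lagrange interpolation inside \<open>S\<close>: for each \<open>j\<close> outside the
  class of \<open>i\<close>, some element of \<open>S\<close> has different coordinates at
  \<open>i\<close> and \<open>j\<close>. An affine change turns these into 1 and 0, and the product
  of such elements serves all of \<open>J\<close>.\<close>

lemma separate:
  assumes S: "cfun.subspace S" "S \<subseteq> A" "\<And>s t. s \<in> S \<Longrightarrow> t \<in> S \<Longrightarrow> mul s t \<in> S" "block_sum I \<in> S"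
    and i: "i \<in> I" and J: "finite J" "J \<subseteq> I - coord_class S i"
  shows "\<exists>t\<in>S. \<omega> i t = 1 \<and> (\<forall>j\<in>J. \<omega> j t = 0)"
  using J
proof (induction J rule: finite_induct)
  case empty
  then show ?case
    using S(4) i coord_block_sum[of I i] by auto
next
  case (insert j J)
  then obtain t where t: "t \<in> S" "\<omega> i t = 1" "\<forall>j\<in>J. \<omega> j t = 0" by auto
  have j: "j \<in> I" "j \<notin> coord_class S i" using insert.prems by auto
  then obtain s where s: "s \<in> S" "\<omega> j s \<noteq> \<omega> i s" by (auto simp: coord_class_def)
  \<comment> \<open>\<open>block_sum I\<close> is the unit, with all coordinates 1; subtracting its
    multiple kills the coordinate at \<open>j\<close>, and the scalar normalizes the one at
    \<open>i\<close>.\<close>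
  define u where "u = scale_fun (1 / (\<omega> i s - \<omega> j s)) (s - scale_fun (\<omega> j s) (block_sum I))"
  have u: "u \<in> S"
    unfolding u_def using s S(4)
    by (intro cfun.subspace_scale[OF S(1)] cfun.subspace_diff[OF S(1)])
  have uk: "\<omega> k u = (\<omega> k s - \<omega> j s) / (\<omega> i s - \<omega> j s)" if "k \<in> I" for k
    using that coord_block_sum[of I k] by (simp add: u_def coord_scale coord_diff)
  have "\<omega> k (mul t u) = 0" if "k \<in> insert j J" for k
  proof -
    have "k \<in> I" using that insert.prems by auto
    then show ?thesis
      using that t u uk[of k] S(2) by (auto simp: coord_mul subsetD)
  qed
  moreover have "\<omega> i (mul t u) = 1"
    using uk[OF i] t u s S(2) i by (simp add: coord_mul subsetD)
  ultimately show ?case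
    using S(3)[OF t(1) u] by blast
qed

text \<open>A finite Stone-Weierstrass statement. Interpolating against all indices outside a class
  gives an element of \<open>S\<close> that is constant on the class, hence its indicator
  function.\<close>

lemma span_parts:
  assumes S: "cfun.subspace S" "S \<subseteq> A" "\<And>s t. s \<in> S \<Longrightarrow> t \<in> S \<Longrightarrow> mul s t \<in> S" "block_sum I \<in> S"
  shows "cfun.span (block_sum ` parts S) = S"
proof
  have "block_sum X \<in> S" if "X \<in> parts S" for X
  proof -
    obtain i where i: "i \<in> I" "X = coord_class S i" using \<open>X \<in> parts S\<close> by (auto simp: parts_def)
    obtain t where t: "t \<in> S" "\<omega> i t = 1" "\<forall>j\<in>I - coord_class S i. \<omega> j t = 0"
      using separate[OF S i(1), of "I - coord_class S i"] finite_index by auto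
    have XI: "X \<subseteq> I" by (auto simp: i coord_class_def)
    have "block_sum X = t"
    proof (rule coord_eqI)
      fix j assume j: "j \<in> I"
      show "\<omega> j (block_sum X) = \<omega> j t"
      proof (cases "j \<in> X")
        case True
        then have "\<omega> j t = \<omega> i t"
          using t(1) by (auto simp: i coord_class_def)
        then show ?thesis using True t(2) coord_block_sum[OF XI j] by simp
      next
        case False
        then show ?thesis using t(3) j coord_block_sum[OF XI j] by (simp add: i)
      qed
    qed (use t(1) S(2) block_sum_in[OF XI] in auto)
    then show ?thesis using t(1) by simp
  qed
  then show "cfun.span (block_sum ` parts S) \<subseteq> S"
    by (intro cfun.span_minimal S(1)) auto
  show "S \<subseteq> cfun.span (block_sum ` parts S)"
  proof
    fix s assume s: "s \<in> S"
    have "\<omega> i s = \<omega> j s" if "X \<in> parts S" "i \<in> X" "j \<in> X" for X i j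
    proof -
      obtain k where "X = coord_class S k" using \<open>X \<in> parts S\<close> by (auto simp: parts_def)
      then have "\<omega> i s = \<omega> k s" "\<omega> j s = \<omega> k s"
        using that s by (auto simp: coord_class_def)
      then show ?thesis by simp
    qed
    then show "s \<in> cfun.span (block_sum ` parts S)"
      unfolding span_block_sums[OF partition_parts] using s S(2) by (auto intro: const_onI)
  qed
qed

text \<open>The description has the shape of those in \<open>Cl\<close> and \<open>Ch\<close>, so
  that one argument gives existence and uniqueness for both.\<close>

lemma The_parts:
  assumes S: "cfun.subspace S" "S \<subseteq> A" "\<And>s t. s \<in> S \<Longrightarrow> t \<in> S \<Longrightarrow> mul s t \<in> S" "block_sum I \<in> S"
  shows "(THE \<X>. partition_on I \<X> \<and> basis_of (block_sum ` \<X>) S \<and> orthogonal_idempotents mul (block_sum ` \<X>)) = parts S"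
proof (rule the_equality)
  show "partition_on I (parts S) \<and> basis_of (block_sum ` parts S) S \<and> orthogonal_idempotents mul (block_sum ` parts S)"
    using partition_parts[of S] independent_block_sums orthogonal_block_sums span_parts[OF S] by (simp add: basis_of_def)
next
  fix \<X> assume "partition_on I \<X> \<and> basis_of (block_sum ` \<X>) S \<and> orthogonal_idempotents mul (block_sum ` \<X>)"
  then show "\<X> = parts S"
    by (intro eq_parts_if_span) (auto simp: basis_of_def)
qed

end

section \<open>Uniqueness of monic linear factorizations\<close>

text \<open>The values are univariate polynomials, so that multiplicities of factors can be read off
  as orders of roots.\<close>

definition mon_eval :: "('a \<Rightarrow> complex poly) \<Rightarrow> ('a \<Rightarrow>\<^sub>0 nat) \<Rightarrow> complex poly" where
  "mon_eval \<alpha> m = (\<Prod>i\<in>Poly_Mapping.keys m. \<alpha> i ^ Poly_Mapping.lookup m i)"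

definition cpoly_eval :: "('a \<Rightarrow> complex poly) \<Rightarrow> 'a cpoly \<Rightarrow> complex poly" where
  "cpoly_eval \<alpha> p = (\<Sum>m\<in>Poly_Mapping.keys p. Polynomial.smult (Poly_Mapping.lookup p m) (mon_eval \<alpha> m))"

lemma mon_eval_superset:
  assumes "finite K" "Poly_Mapping.keys m \<subseteq> K"
  shows "mon_eval \<alpha> m = (\<Prod>i\<in>K. \<alpha> i ^ Poly_Mapping.lookup m i)"
  unfolding mon_eval_def
  by (rule prod.mono_neutral_left) (use assms in \<open>auto simp: in_keys_iff\<close>)

lemma mon_eval_0 [simp]: "mon_eval \<alpha> 0 = 1"
  by (simp add: mon_eval_def)

lemma mon_eval_add: "mon_eval \<alpha> (m + m') = mon_eval \<alpha> m * mon_eval \<alpha> m'"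
proof -
  let ?K = "Poly_Mapping.keys m \<union> Poly_Mapping.keys m'"
  have "mon_eval \<alpha> (m + m') = (\<Prod>i\<in>?K. \<alpha> i ^ Poly_Mapping.lookup (m + m') i)"
    by (rule mon_eval_superset) (simp_all add: Poly_Mapping.keys_add)
  also have "\<dots> = (\<Prod>i\<in>?K. \<alpha> i ^ Poly_Mapping.lookup m i) * (\<Prod>i\<in>?K. \<alpha> i ^ Poly_Mapping.lookup m' i)"
    by (simp add: lookup_add power_add prod.distrib)
  also have "\<dots> = mon_eval \<alpha> m * mon_eval \<alpha> m'"
    by (simp add: mon_eval_superset[of ?K, symmetric])
  finally show ?thesis .
qed

lemma cpoly_eval_superset:
  assumes "finite K" "Poly_Mapping.keys p \<subseteq> K"
  shows "cpoly_eval \<alpha> p = (\<Sum>m\<in>K. Polynomial.smult (Poly_Mapping.lookup p m) (mon_eval \<alpha> m))"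
  unfolding cpoly_eval_def
  by (rule sum.mono_neutral_left) (use assms in \<open>auto simp: in_keys_iff\<close>)

lemma cpoly_eval_add: "cpoly_eval \<alpha> (p + q) = cpoly_eval \<alpha> p + cpoly_eval \<alpha> q"
proof -
  let ?K = "Poly_Mapping.keys p \<union> Poly_Mapping.keys q"
  have "cpoly_eval \<alpha> (p + q) = (\<Sum>m\<in>?K. Polynomial.smult (Poly_Mapping.lookup (p + q) m) (mon_eval \<alpha> m))"
    by (rule cpoly_eval_superset) (simp_all add: Poly_Mapping.keys_add)
  also have "\<dots> = (\<Sum>m\<in>?K. Polynomial.smult (Poly_Mapping.lookup p m) (mon_eval \<alpha> m)) +
      (\<Sum>m\<in>?K. Polynomial.smult (Poly_Mapping.lookup q m) (mon_eval \<alpha> m))"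
    by (simp add: lookup_add smult_add_left sum.distrib)
  also have "\<dots> = cpoly_eval \<alpha> p + cpoly_eval \<alpha> q"
    by (simp add: cpoly_eval_superset[of ?K, symmetric])
  finally show ?thesis .
qed

lemma cpoly_eval_sum: "cpoly_eval \<alpha> (\<Sum>i\<in>I. f i) = (\<Sum>i\<in>I. cpoly_eval \<alpha> (f i))"
  by (rule additive.sum[of "cpoly_eval \<alpha>", OF additive.intro]) (rule cpoly_eval_add)

lemma cpoly_eval_single: "cpoly_eval \<alpha> (Poly_Mapping.single m c) = Polynomial.smult c (mon_eval \<alpha> m)"
  by (cases "c = 0") (simp_all add: cpoly_eval_def)

lemma cpoly_expand: "p = (\<Sum>m\<in>Poly_Mapping.keys p. Poly_Mapping.single m (Poly_Mapping.lookup p m))"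
proof (rule poly_mapping_eqI)
  fix k
  show "Poly_Mapping.lookup p k =
      Poly_Mapping.lookup (\<Sum>m\<in>Poly_Mapping.keys p. Poly_Mapping.single m (Poly_Mapping.lookup p m)) k"
    by (cases "k \<in> Poly_Mapping.keys p") (auto simp: lookup_sum lookup_single when_def in_keys_iff)
qed

lemma cpoly_eval_mult: "cpoly_eval \<alpha> (p * q) = cpoly_eval \<alpha> p * cpoly_eval \<alpha> q"
proof -
  have "p * q = (\<Sum>m\<in>Poly_Mapping.keys p. \<Sum>m'\<in>Poly_Mapping.keys q.
      Poly_Mapping.single (m + m') (Poly_Mapping.lookup p m * Poly_Mapping.lookup q m'))"
    by (subst cpoly_expand[of p], subst cpoly_expand[of q]) (simp add: sum_product mult_single)
  then have "cpoly_eval \<alpha> (p * q) = (\<Sum>m\<in>Poly_Mapping.keys p. \<Sum>m'\<in>Poly_Mapping.keys q.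
      Polynomial.smult (Poly_Mapping.lookup p m) (mon_eval \<alpha> m) *
      Polynomial.smult (Poly_Mapping.lookup q m') (mon_eval \<alpha> m'))"
    by (simp add: cpoly_eval_sum cpoly_eval_single mon_eval_add mult.commute)
  also have "\<dots> = cpoly_eval \<alpha> p * cpoly_eval \<alpha> q"
    unfolding cpoly_eval_def by (simp only: sum_product)
  finally show ?thesis .
qed

lemma cpoly_eval_one: "cpoly_eval \<alpha> 1 = 1"
  by (simp add: cpoly_eval_def)

lemma cpoly_eval_power: "cpoly_eval \<alpha> (p ^ k) = cpoly_eval \<alpha> p ^ k"
  by (induction k) (simp_all add: cpoly_eval_one cpoly_eval_mult)

lemma cpoly_eval_prod: "cpoly_eval \<alpha> (\<Prod>i\<in>I. f i) = (\<Prod>i\<in>I. cpoly_eval \<alpha> (f i))"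
  by (induction I rule: infinite_finite_induct) (simp_all add: cpoly_eval_one cpoly_eval_mult)

section \<open>Linear forms and generic points\<close>

lemma const_poly_mult_indet:
  "const_poly c * indet g = Poly_Mapping.single (Poly_Mapping.single g 1) c"
  by (simp add: const_poly_def indet_def mult_single)

lemma cpoly_eval_linear_form:
  "cpoly_eval \<alpha> (linear_form C \<xi>) = (\<Sum>g\<in>C. Polynomial.smult (\<xi> g) (\<alpha> g))"
  by (simp add: linear_form_def const_poly_mult_indet cpoly_eval_sum cpoly_eval_single mon_eval_def)

text \<open>The coefficients are recovered by looking up single indeterminates. A form determines
  its coefficient function on \<open>C\<close> only, which is why such functions are always compared
  on \<open>C\<close>.\<close>

lemma linear_form_eq_iff:
  assumes "finite C"
  shows "linear_form C \<xi> = linear_form C \<eta> \<longleftrightarrow> (\<forall>g\<in>C. \<xi> g = \<eta> g)"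
proof
  have key: "Poly_Mapping.single x (Suc 0) = Poly_Mapping.single g (Suc 0) \<longleftrightarrow> x = g" for x g :: 'a
  proof
    assume "Poly_Mapping.single x (Suc 0) = Poly_Mapping.single g (Suc 0)"
    from arg_cong[OF this, of Poly_Mapping.keys] show "x = g" by simp
  qed simp
  have lookup: "Poly_Mapping.lookup (linear_form C \<zeta>) (Poly_Mapping.single g 1) = \<zeta> g"
    if "g \<in> C" for \<zeta> :: "'a \<Rightarrow> complex" and g
    using that assms
    by (simp add: linear_form_def const_poly_mult_indet lookup_sum lookup_single when_def key)
  assume "linear_form C \<xi> = linear_form C \<eta>"
  then show "\<forall>g\<in>C. \<xi> g = \<eta> g"
    using lookup[of _ \<xi>] lookup[of _ \<eta>] by simp
qed (simp add: linear_form_def)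

text \<open>The point lies on the moment curve, where each functional is a nonzero polynomial in the
  parameter.\<close>

lemma exists_generic_point:
  fixes D :: "('a \<Rightarrow> complex) set"
  assumes "finite C" "finite D" and D: "\<And>d. d \<in> D \<Longrightarrow> \<exists>g\<in>C. d g \<noteq> 0"
  shows "\<exists>v. \<forall>d\<in>D. (\<Sum>g\<in>C. d g * v g) \<noteq> 0"
proof -
  \<comment> \<open>Distinct exponents keep the monomials of \<open>p d\<close> apart, so that its
    coefficients are the values of \<open>d\<close>.\<close>
  obtain e :: "'a \<Rightarrow> nat" where e: "inj_on e C"
    using finite_imp_inj_to_nat_seg[OF assms(1)] by blast
  define p :: "('a \<Rightarrow> complex) \<Rightarrow> complex poly" where "p d = (\<Sum>g\<in>C. monom (d g) (e g))" for d
  have "p d \<noteq> 0" if d: "d \<in> D" for d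
  proof -
    obtain g where g: "g \<in> C" "d g \<noteq> 0" using D[OF d] by blast
    have "coeff (p d) (e g) = (\<Sum>h\<in>C. if h = g then d h else 0)"
      unfolding p_def coeff_sum using e g by (intro sum.cong) (auto dest: inj_onD)
    then have "coeff (p d) (e g) = d g"
      using g assms(1) by simp
    with g show ?thesis by auto
  qed
  then have "finite (\<Union>d\<in>D. {s. poly (p d) s = 0})"
    using assms(2) by (simp add: poly_roots_finite)
  then obtain s where s: "s \<notin> (\<Union>d\<in>D. {s. poly (p d) s = 0})"
    using ex_new_if_finite[OF infinite_UNIV_char_0] by blast
  have "(\<Sum>g\<in>C. d g * s ^ e g) \<noteq> 0" if "d \<in> D" for d
  proof -
    have "poly (p d) s \<noteq> 0" using s that by auto
    then show ?thesis
      by (simp add: p_def poly_sum poly_monom)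
  qed
  then show ?thesis
    by (intro exI[of _ "\<lambda>g. s ^ e g"]) simp
qed

text \<open>Indices may share a root, and then their exponents add up; on the side of the characters
  many of them give the same linear form. The root of \<open>[:a j, 1:]\<close> is
  \<open>- a j\<close>, whence the sign.\<close>

lemma order_prod_linear_powers:
  fixes a :: "'j \<Rightarrow> complex"
  assumes "finite J"
  shows "order x (\<Prod>j\<in>J. [:a j, 1:] ^ m j) = (\<Sum>j | j \<in> J \<and> a j = - x. m j)"
  using assms
proof (induction J rule: finite_induct)
  case (insert j J)
  have nz: "[:a j, 1:] ^ m j * (\<Prod>j\<in>J. [:a j, 1:] ^ m j) \<noteq> 0"
    using insert.hyps by simp
  have single: "order x ([:a j, 1:] ^ m j) = (if a j = - x then m j else 0)"
  proof (cases "a j = - x")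
    case True
    then show ?thesis using order_power_n_n[of x "m j"] by simp
  next
    case False
    then have "a j + x \<noteq> 0"
      by (simp add: eq_neg_iff_add_eq_0)
    then show ?thesis using False by (simp add: order_0I)
  qed
  have "{i. i \<in> insert j J \<and> a i = - x} =
      (if a j = - x then insert j {i. i \<in> J \<and> a i = - x} else {i. i \<in> J \<and> a i = - x})"
    by auto
  then show ?case
    using insert single by (simp add: order_mult[OF nz])
qed simp

text \<open>Substituting \<open>t + v\<^sub>1\<close> for \<open>x\<^sub>1\<close> and \<open>v\<^sub>g\<close> for the other \<open>x\<^sub>g\<close>, with \<open>v\<close> generic, turns distinct monic
  linear forms into coprime polynomials in \<open>t\<close>, whose exponents are root multiplicities.\<close>

lemma monic_linear_factorization_unique:
  assumes "finite C" "c \<in> C" "finite J" "finite K"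
    and \<xi>: "\<And>j. j \<in> J \<Longrightarrow> \<xi> j c = 1" and \<eta>: "\<And>k. k \<in> K \<Longrightarrow> \<eta> k c = 1"
    and eq: "(\<Prod>j\<in>J. linear_form C (\<xi> j) ^ m j) = (\<Prod>k\<in>K. linear_form C (\<eta> k) ^ n k)"
  shows "(\<Sum>j | j \<in> J \<and> (\<forall>g\<in>C. \<xi> j g = \<mu> g). m j) = (\<Sum>k | k \<in> K \<and> (\<forall>g\<in>C. \<eta> k g = \<mu> g). n k)"
proof -
  \<comment> \<open>The point has to separate \<open>\<mu>\<close> from each coefficient function
    that differs from it on \<open>C\<close>. Differences that vanish on \<open>C\<close> are
    dropped, since no point detects them.\<close>
  define D where "D = {d \<in> (\<lambda>\<zeta> g. \<zeta> g - \<mu> g) ` (\<xi> ` J \<union> \<eta> ` K). \<exists>g\<in>C. d g \<noteq> 0}"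
  have "finite D"
    using assms(3,4) by (simp add: D_def)
  moreover have "\<exists>g\<in>C. d g \<noteq> 0" if "d \<in> D" for d
    using that by (simp add: D_def)
  ultimately have "\<exists>v. \<forall>d\<in>D. (\<Sum>g\<in>C. d g * v g) \<noteq> 0"
    by (rule exists_generic_point[OF assms(1)])
  then obtain v where v: "\<And>d. d \<in> D \<Longrightarrow> (\<Sum>g\<in>C. d g * v g) \<noteq> 0"
    by blast
  define a where "a \<zeta> = (\<Sum>g\<in>C. \<zeta> g * v g)" for \<zeta>
  have a_iff: "a \<zeta> = a \<mu> \<longleftrightarrow> (\<forall>g\<in>C. \<zeta> g = \<mu> g)" if "\<zeta> \<in> \<xi> ` J \<union> \<eta> ` K" for \<zeta>
  proof
    assume *: "a \<zeta> = a \<mu>"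
    show "\<forall>g\<in>C. \<zeta> g = \<mu> g"
    proof (rule ccontr)
      assume "\<not> (\<forall>g\<in>C. \<zeta> g = \<mu> g)"
      then have "(\<lambda>g. \<zeta> g - \<mu> g) \<in> D"
        using that by (auto simp: D_def)
      then have "(\<Sum>g\<in>C. (\<zeta> g - \<mu> g) * v g) \<noteq> 0" by (rule v)
      then show False
        using * by (simp add: a_def left_diff_distrib sum_subtractf)
    qed
  qed (simp add: a_def)
  \<comment> \<open>The parameter enters only through the indeterminate of \<open>c\<close>, whose
    coefficient is 1, so every form becomes a monic polynomial of degree one.\<close>
  define \<alpha> where "\<alpha> g = [:v g, if g = c then 1 else 0:]" for g
  have lin: "cpoly_eval \<alpha> (linear_form C \<zeta>) = [:a \<zeta>, 1:]" if "\<zeta> c = 1" for \<zeta>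
  proof -
    have "cpoly_eval \<alpha> (linear_form C \<zeta>) = (\<Sum>g\<in>C. [:\<zeta> g * v g:] + [:0, if g = c then \<zeta> g else 0:])"
      unfolding cpoly_eval_linear_form by (intro sum.cong) (auto simp: \<alpha>_def)
    also have "\<dots> = [:a \<zeta>:] + (\<Sum>g\<in>C. [:0, if g = c then \<zeta> g else 0:])"
      unfolding sum.distrib by (simp only: sum_to_poly a_def)
    also have "(\<Sum>g\<in>C. [:0, if g = c then \<zeta> g else 0:]) = (\<Sum>g\<in>C. if g = c then [:0, \<zeta> g:] else 0)"
      by (intro sum.cong) auto
    also have "\<dots> = [:0, 1:]"
      using assms(1,2) that by simp
    finally show ?thesis by simp
  qed
  have "(\<Prod>j\<in>J. [:a (\<xi> j), 1:] ^ m j) = (\<Prod>k\<in>K. [:a (\<eta> k), 1:] ^ n k)"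
    using arg_cong[OF eq, of "cpoly_eval \<alpha>"] by (simp add: cpoly_eval_prod cpoly_eval_power lin \<xi> \<eta>)
  then have "order (- a \<mu>) (\<Prod>j\<in>J. [:a (\<xi> j), 1:] ^ m j) = order (- a \<mu>) (\<Prod>k\<in>K. [:a (\<eta> k), 1:] ^ n k)"
    by simp
  then have "(\<Sum>j | j \<in> J \<and> a (\<xi> j) = a \<mu>. m j) = (\<Sum>k | k \<in> K \<and> a (\<eta> k) = a \<mu>. n k)"
    using assms(3,4) by (simp add: order_prod_linear_powers)
  moreover have "{j. j \<in> J \<and> a (\<xi> j) = a \<mu>} = {j. j \<in> J \<and> (\<forall>g\<in>C. \<xi> j g = \<mu> g)}"
    by (rule Collect_cong) (use a_iff in auto)
  moreover have "{k. k \<in> K \<and> a (\<eta> k) = a \<mu>} = {k. k \<in> K \<and> (\<forall>g\<in>C. \<eta> k g = \<mu> g)}"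
    by (rule Collect_cong) (use a_iff in auto)
  ultimately show ?thesis by simp
qed

section \<open>Factorization of the determinant\<close>

lemma const_poly_0 [simp]: "const_poly 0 = 0"
  by (simp add: const_poly_def)

lemma const_poly_1 [simp]: "const_poly 1 = 1"
  by (simp add: const_poly_def)

lemma const_poly_add: "const_poly (a + b) = const_poly a + const_poly b"
  by (simp add: const_poly_def single_add)

lemma const_poly_mult: "const_poly (a * b) = const_poly a * const_poly b"
  by (simp add: const_poly_def mult_single)

lemma const_poly_sum: "const_poly (\<Sum>i\<in>I. f i) = (\<Sum>i\<in>I. const_poly (f i))"
  by (rule additive.sum[of const_poly, OF additive.intro]) (rule const_poly_add)

lemma comm_ring_hom_const_poly: "comm_ring_hom (const_poly :: complex \<Rightarrow> 'a cpoly)"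
  by unfold_locales (simp_all add: const_poly_add const_poly_mult)

lemma trace_mat_mult_commute:
  assumes "A \<in> carrier_mat m n" "B \<in> carrier_mat n m"
  shows "trace_mat (A * B) = trace_mat (B * A)"
proof -
  have "trace_mat (A * B) = (\<Sum>i<m. \<Sum>j<n. A $$ (i, j) * B $$ (j, i))"
    using assms by (auto simp: trace_mat_def times_mat_index_sum[OF assms] simp del: index_mult_mat(1))
  also have "\<dots> = (\<Sum>j<n. \<Sum>i<m. B $$ (j, i) * A $$ (i, j))"
    by (subst sum.swap) (simp add: mult.commute)
  also have "\<dots> = trace_mat (B * A)"
    using assms by (auto simp: trace_mat_def times_mat_index_sum[OF assms(2,1)] simp del: index_mult_mat(1))
  finally show ?thesis .
qed

lemma det_diagonal:
  fixes d :: "nat \<Rightarrow> 'r :: comm_ring_1"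
  shows "det (mat n n (\<lambda>(i, j). if i = j then d i else 0)) = (\<Prod>i<n. d i)"
proof -
  let ?D = "mat n n (\<lambda>(i, j). if i = j then d i else 0)"
  have "det ?D = prod_list (diag_mat ?D)"
    by (rule det_upper_triangular[of _ n]) auto
  also have "diag_mat ?D = map d [0..<n]"
    by (simp add: diag_mat_def)
  also have "prod_list \<dots> = (\<Prod>i<n. d i)"
    by (simp add: prod.distinct_set_conv_list[symmetric] atLeast0LessThan)
  finally show ?thesis .
qed

context finite_group
begin

section \<open>Simultaneous eigenvectors of the centre\<close>

lemma independent_hats: "cfun.independent ((\<lambda>g. hat {g}) ` carrier G)"
proof (rule independent_if_separated)
  fix b :: "'a \<Rightarrow> complex" assume "b \<in> (\<lambda>g. hat {g}) ` carrier G"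
  then obtain g where g: "b = hat {g}" by auto
  show "\<exists>f :: ('a \<Rightarrow> complex) \<Rightarrow> complex. (\<forall>u v. f (u + v) = f u + f v) \<and>
      (\<forall>c v. f (scale_fun c v) = c * f v) \<and> f b \<noteq> 0 \<and>
      (\<forall>b'\<in>(\<lambda>g. hat {g}) ` carrier G. b' \<noteq> b \<longrightarrow> f b' = 0)"
    by (intro exI[of _ "\<lambda>a. a g"] conjI allI ballI impI) (auto simp: g scale_fun_def hat_def)
qed

lemma inj_on_hats: "inj_on (\<lambda>g. hat {g} :: 'a \<Rightarrow> complex) UNIV"
proof (rule inj_onI)
  fix g h :: 'a assume "(hat {g} :: 'a \<Rightarrow> complex) = hat {h}"
  from fun_cong[OF this, of g] show "g = h"
    by (simp add: hat_def split: if_splits)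
qed

lemma one_eq_sum_idem: "hat {\<one>} = (\<Sum>\<psi>\<in>Irr G. idem \<psi>)"
proof -
  have "hat {\<one>} = (\<Sum>\<psi>\<in>Irr G. scale_fun (central_char \<psi> (hat {\<one>})) (idem \<psi>))"
    by (rule center_expand[OF one_in_center])
  also have "\<dots> = (\<Sum>\<psi>\<in>Irr G. idem \<psi>)"
    by (rule sum.cong) (simp_all add: central_char_one)
  finally show ?thesis .
qed

text \<open>The translates \<open>idem \<psi> \<star> hat {g}\<close> are eigenvectors of the whole
  centre. They span because the idempotents add up to the identity, so a maximal independent set of
  them is a basis.\<close>

lemma simultaneous_eigenbasis:
  obtains B where "cfun.independent B" "card B = card (carrier G)" "finite B" "B \<subseteq> group_algebra G"
    and "\<And>b. b \<in> B \<Longrightarrow> \<exists>\<psi>\<in>Irr G. \<forall>z\<in>ga_center G. z \<star> b = scale_fun (central_char \<psi> z) b"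
proof -
  define T where "T = (\<Union>\<psi>\<in>Irr G. (\<lambda>g. idem \<psi> \<star> hat {g}) ` carrier G)"
  obtain B where B: "B \<subseteq> T" "cfun.independent B" "T \<subseteq> cfun.span B"
    by (rule cfun.maximal_independent_subset)
  have BG: "B \<subseteq> group_algebra G"
    using B(1) by (auto simp: T_def)
  have fin: "finite B" and le: "card B \<le> card (carrier G)"
    using finite_if_independent[OF B(2) BG] by auto
  have "hat {g} \<in> cfun.span B" if g: "g \<in> carrier G" for g
  proof -
    have "(\<Sum>\<psi>\<in>Irr G. idem \<psi> \<star> hat {g}) \<in> cfun.span B"
      using B(3) g by (intro cfun.span_sum) (auto simp: T_def)
    moreover have "(\<Sum>\<psi>\<in>Irr G. idem \<psi> \<star> hat {g}) = hat {g}"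
      using g by (simp only: conv_sum_left[symmetric] one_eq_sum_idem[symmetric])
        (simp add: hat_in_group_algebra)
    ultimately show ?thesis by simp
  qed
  then have "card ((\<lambda>g. hat {g} :: 'a \<Rightarrow> complex) ` carrier G) \<le> card B"
    using cfun.independent_span_bound[OF fin independent_hats] by blast
  moreover have "card ((\<lambda>g. hat {g} :: 'a \<Rightarrow> complex) ` carrier G) = card (carrier G)"
    by (intro card_image inj_on_subset[OF inj_on_hats]) simp
  ultimately have card: "card B = card (carrier G)"
    using le by simp
  show thesis
  proof (rule that[OF B(2) card fin BG])
    fix b assume "b \<in> B"
    then obtain \<psi> g where \<psi>: "\<psi> \<in> Irr G" and b: "b = idem \<psi> \<star> hat {g}"
      using B(1) by (auto simp: T_def)
    have "z \<star> b = scale_fun (central_char \<psi> z) b" if "z \<in> ga_center G" for z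
      by (simp only: b conv_assoc[symmetric] center_conv_idem[OF \<psi> that] conv_scale_left)
    with \<psi> show "\<exists>\<psi>\<in>Irr G. \<forall>z\<in>ga_center G. z \<star> b = scale_fun (central_char \<psi> z) b" by blast
  qed
qed

end

locale invariant_partition = finite_group G for G :: "('a, 'b) monoid_scheme" (structure) +
  fixes P :: "'a set set" and C :: "'a set"
  assumes partition: "partition_on (carrier G) P"
    and invariant: "K \<in> P \<Longrightarrow> conj_invariant G K"
    and one_part: "{\<one>} \<in> P"
    and reps: "representatives P C"
begin

section \<open>Parts, representatives and the determinant\<close>

lemma part_of_eq: "K \<in> P \<Longrightarrow> g \<in> K \<Longrightarrow> part_of P g = K"
  unfolding part_of_def
proof (rule the_equality)
  fix L assume "K \<in> P" "g \<in> K" "L \<in> P \<and> g \<in> L"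
  then show "L = K"
    using disjointD[OF partition_onD2[OF partition], of L K] by auto
qed simp

lemma part_of_props:
  assumes "g \<in> carrier G"
  shows part_of_in: "part_of P g \<in> P" and in_part_of: "g \<in> part_of P g"
proof -
  obtain K where "K \<in> P" "g \<in> K"
    using assms partition by (auto simp: partition_on_def)
  then show "part_of P g \<in> P" "g \<in> part_of P g"
    by (simp_all add: part_of_eq)
qed

lemma part_subset: "K \<in> P \<Longrightarrow> K \<subseteq> carrier G"
  using partition by (auto simp: partition_on_def)

lemma C_subset: "C \<subseteq> carrier G"
  using reps partition by (auto simp: representatives_def partition_on_def)

lemma finite_C: "finite C"
  using C_subset finite_carrier by (rule finite_subset)

lemma rep_of_eq:
  assumes "g \<in> carrier G" "c \<in> C" "c \<in> part_of P g"
  shows "rep_of P C g = c"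
proof -
  have "\<exists>!c. c \<in> C \<inter> part_of P g"
    using reps part_of_in[OF assms(1)] unfolding representatives_def by blast
  then show ?thesis
    unfolding rep_of_def using assms(2,3) by (intro the1_equality) auto
qed

lemma rep_of_props:
  assumes "g \<in> carrier G"
  shows rep_of_in: "rep_of P C g \<in> C" and rep_of_in_part: "rep_of P C g \<in> part_of P g"
proof -
  obtain c where "c \<in> C" "c \<in> part_of P g"
    using reps part_of_in[OF assms] unfolding representatives_def by blast
  then show "rep_of P C g \<in> C" "rep_of P C g \<in> part_of P g"
    using rep_of_eq[OF assms] by auto
qed

lemma part_of_rep_of: "g \<in> carrier G \<Longrightarrow> part_of P (rep_of P C g) = part_of P g"
  by (rule part_of_eq[OF part_of_in rep_of_in_part])

lemma rep_of_eq_iff: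
  assumes "g \<in> carrier G" "c \<in> C"
  shows "rep_of P C g = c \<longleftrightarrow> g \<in> part_of P c"
proof
  assume "rep_of P C g = c"
  then show "g \<in> part_of P c"
    using part_of_rep_of[OF assms(1)] in_part_of[OF assms(1)] by simp
next
  assume "g \<in> part_of P c"
  moreover have "c \<in> carrier G" using assms C_subset by auto
  ultimately have "part_of P g = part_of P c"
    by (intro part_of_eq part_of_in)
  then show "rep_of P C g = c"
    using assms in_part_of[OF \<open>c \<in> carrier G\<close>] by (intro rep_of_eq) auto
qed

lemma part_of_one: "part_of P \<one> = {\<one>}"
  using one_part by (intro part_of_eq) auto

lemma one_in_C: "\<one> \<in> C"
  using rep_of_props[of \<one>] by (simp add: part_of_one)

lemma bij_betw_part_of: "bij_betw (part_of P) C P"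
  unfolding bij_betw_def
proof
  show "inj_on (part_of P) C"
  proof (rule inj_onI)
    fix c d assume cd: "c \<in> C" "d \<in> C" "part_of P c = part_of P d"
    then have "c \<in> carrier G" "d \<in> carrier G" using C_subset by auto
    then have "rep_of P C c = c" "rep_of P C c = d"
      using cd in_part_of[of c] in_part_of[of d] by (auto intro!: rep_of_eq)
    then show "c = d" by simp
  qed
  show "part_of P ` C = P"
  proof
    show "part_of P ` C \<subseteq> P" using C_subset part_of_in by auto
    show "P \<subseteq> part_of P ` C"
    proof
      fix K assume K: "K \<in> P"
      then obtain c where "c \<in> C" "c \<in> K" using reps unfolding representatives_def by blast
      with part_of_eq[OF K] show "K \<in> part_of P ` C" by blast
    qed
  qed
qed

lemma hat_in_center:
  assumes "K \<in> P"
  shows "hat K \<in> ga_center G"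
  unfolding center_iff
proof (intro conjI ballI)
  show "hat K \<in> group_algebra G"
    by (rule hat_in_group_algebra[OF part_subset[OF assms]])
  fix g h assume gh: "g \<in> carrier G" "h \<in> carrier G"
  have K: "a \<otimes> k \<otimes> inv a \<in> K" if "k \<in> K" "a \<in> carrier G" for k a
    using invariant[OF assms] that by (simp add: conj_invariant_def)
  have "h \<otimes> g \<otimes> inv h \<in> K \<longleftrightarrow> g \<in> K"
  proof
    assume "h \<otimes> g \<otimes> inv h \<in> K"
    from K[OF this, of "inv h"] show "g \<in> K"
      using gh by (simp add: m_assoc mult_inv_cancel)
  qed (rule K[OF _ gh(2)])
  then show "hat K (h \<otimes> g \<otimes> inv h) = hat K g"
    by (simp add: hat_def)
qed

definition part_eigenvalue :: "('a \<Rightarrow> complex) \<Rightarrow> 'a \<Rightarrow> complex" where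
  "part_eigenvalue \<psi> c = central_char \<psi> (hat (part_of P c))"

lemma part_eigenvalue_one: "\<psi> \<in> Irr G \<Longrightarrow> part_eigenvalue \<psi> \<one> = 1"
  by (simp add: part_eigenvalue_def part_of_one central_char_one)

text \<open>The matrix of \<open>Theta\<close> combines the matrices of convolution by the part
  sums, with the indeterminates as coefficients. A common eigenvector of the centre is therefore an
  eigenvector of it, with a linear form as eigenvalue.\<close>

lemma eigenvector_indet:
  assumes b: "\<And>z. z \<in> ga_center G \<Longrightarrow> z \<star> b = scale_fun (central_char \<psi> z) b"
    and g: "g \<in> carrier G"
  shows "(\<Sum>h\<in>carrier G. indet (rep_of P C (g \<otimes> inv h)) * const_poly (b h)) =
           const_poly (b g) * linear_form C (part_eigenvalue \<psi>)"
proof -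
  have "indet (rep_of P C (g \<otimes> inv h)) =
      (\<Sum>c\<in>C. const_poly (hat (part_of P c) (g \<otimes> inv h)) * indet c)" if h: "h \<in> carrier G" for h
  proof -
    have gh: "g \<otimes> inv h \<in> carrier G" using g h by simp
    have "(\<Sum>c\<in>C. const_poly (hat (part_of P c) (g \<otimes> inv h)) * indet c) =
        (\<Sum>c\<in>C. if c = rep_of P C (g \<otimes> inv h) then indet c else 0)"
      using rep_of_eq_iff[OF gh] by (intro sum.cong) (auto simp: hat_def)
    also have "\<dots> = indet (rep_of P C (g \<otimes> inv h))"
      using rep_of_in[OF gh] finite_C by simp
    finally show ?thesis ..
  qed
  then have "(\<Sum>h\<in>carrier G. indet (rep_of P C (g \<otimes> inv h)) * const_poly (b h)) =
      (\<Sum>h\<in>carrier G. \<Sum>c\<in>C. const_poly (hat (part_of P c) (g \<otimes> inv h) * b h) * indet c)"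
    by (simp add: sum_distrib_left sum_distrib_right const_poly_mult mult_ac)
  also have "\<dots> = (\<Sum>c\<in>C. const_poly ((hat (part_of P c) \<star> b) g) * indet c)"
    using g by (subst sum.swap) (simp add: conv_apply' const_poly_sum sum_distrib_right)
  also have "\<dots> = (\<Sum>c\<in>C. const_poly (part_eigenvalue \<psi> c * b g) * indet c)"
  proof (rule sum.cong)
    fix c assume "c \<in> C"
    then have "hat (part_of P c) \<in> ga_center G"
      using C_subset by (intro hat_in_center part_of_in) auto
    then show "const_poly ((hat (part_of P c) \<star> b) g) * indet c = const_poly (part_eigenvalue \<psi> c * b g) * indet c"
      by (simp add: b part_eigenvalue_def scale_fun_def)
  qed simp
  also have "\<dots> = const_poly (b g) * linear_form C (part_eigenvalue \<psi>)"
    by (simp add: linear_form_def const_poly_mult sum_distrib_left mult_ac)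
  finally show ?thesis .
qed

text \<open>A complex change of basis to simultaneous eigenvectors diagonalizes the matrix of
  \<open>Theta\<close>. The exponent \<open>d \<psi>\<close> counts the basis vectors belonging to
  \<open>\<psi>\<close>; it is the trace of convolution by \<open>idem \<psi>\<close>.\<close>

lemma Theta_factorization:
  obtains d where "\<forall>\<psi>\<in>Irr G. of_nat (d \<psi>) = (\<psi> \<one>)\<^sup>2"
    and "Theta G P C = (\<Prod>\<psi>\<in>Irr G. linear_form C (part_eigenvalue \<psi>) ^ d \<psi>)"
proof -
  define n where "n = card (carrier G)"
  obtain B where B: "cfun.independent B" "card B = n" "finite B" "B \<subseteq> group_algebra G"
    and eig: "\<And>b. b \<in> B \<Longrightarrow> \<exists>\<psi>\<in>Irr G. \<forall>z\<in>ga_center G. z \<star> b = scale_fun (central_char \<psi> z) b"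
    using simultaneous_eigenbasis n_def by metis
  obtain b where b: "bij_betw b {0..<n} B"
    using ex_bij_betw_nat_finite[OF B(3)] B(2) by auto
  obtain e where e: "bij_betw e {0..<n} (carrier G)"
    using ex_bij_betw_nat_finite[OF finite_carrier] n_def by auto
  have eG: "e i \<in> carrier G" if "i < n" for i
    using e that by (auto simp: bij_betw_def)
  have bB: "b k \<in> B" if "k < n" for k
    using b that by (auto simp: bij_betw_def)
  have "\<forall>k\<in>{..<n}. \<exists>\<psi>. \<psi> \<in> Irr G \<and> (\<forall>z\<in>ga_center G. z \<star> b k = scale_fun (central_char \<psi> z) (b k))"
    using eig bB by blast
  then obtain t where t: "\<And>k. k < n \<Longrightarrow> t k \<in> Irr G"
    and teig: "\<And>k z. k < n \<Longrightarrow> z \<in> ga_center G \<Longrightarrow> z \<star> b k = scale_fun (central_char (t k) z) (b k)"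
    by (auto dest!: bchoice)
  define M where "M = mat n n (\<lambda>(i, k). b k (e i))"
  have M: "M \<in> carrier_mat n n" by (simp add: M_def)
  have reindex: "(\<Sum>j<n. f (e j)) = (\<Sum>h\<in>carrier G. f h)" for f :: "'a \<Rightarrow> 'c :: comm_monoid_add"
    using sum.reindex_bij_betw[OF e, of f] by (simp add: atLeast0LessThan)
  \<comment> \<open>The columns of \<open>M\<close> are the basis vectors, so a kernel vector would
    be a linear relation between them.\<close>
  have det_M: "det M \<noteq> 0"
  proof
    assume "det M = 0"
    then obtain v where v: "v \<in> carrier_vec n" "v \<noteq> 0\<^sub>v n" "M *\<^sub>v v = 0\<^sub>v n"
      using det_0_iff_vec_prod_zero[OF M] by blast
    have "(\<Sum>k<n. scale_fun (v $ k) (b k)) = 0"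
    proof (rule group_algebra_eqI)
      show "(\<Sum>k<n. scale_fun (v $ k) (b k)) \<in> group_algebra G"
        using bB B(4) by (intro cfun.subspace_sum[OF subspace_group_algebra]
            cfun.subspace_scale[OF subspace_group_algebra]) auto
      show "0 \<in> group_algebra G"
        by (rule cfun.subspace_0[OF subspace_group_algebra])
      fix g assume "g \<in> carrier G"
      then have "g \<in> e ` {0..<n}"
        using e by (simp add: bij_betw_def)
      then obtain i where i: "i < n" "g = e i" by auto
      have "(\<Sum>k<n. M $$ (i, k) * v $ k) = 0"
        using i v(3) by (simp only: mult_mat_vec_index_sum[OF M v(1) i(1), symmetric]) simp
      then have "(\<Sum>k<n. b k g * v $ k) = 0"
        using i by (simp add: M_def)
      then show "(\<Sum>k<n. scale_fun (v $ k) (b k)) g = 0 g"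
        by (simp add: sum_fun_apply scale_fun_def mult.commute)
    qed
    moreover define u where "u x = v $ (the_inv_into {0..<n} b x)" for x
    have "(\<Sum>x\<in>B. scale_fun (u x) x) = (\<Sum>k\<in>{0..<n}. scale_fun (u (b k)) (b k))"
      by (rule sum.reindex_bij_betw[OF b, symmetric])
    moreover have ub: "u (b k) = v $ k" if "k < n" for k
      using b that by (simp add: u_def the_inv_into_f_f bij_betw_def)
    ultimately have "(\<Sum>x\<in>B. scale_fun (u x) x) = 0"
      by (simp add: atLeast0LessThan)
    then have "u (b k) = 0" if "k < n" for k
      using cfun.independentD[OF B(1) B(3) subset_refl _ bB[OF that], of u] by simp
    then have "v = 0\<^sub>v n"
      using v(1) ub by (intro eq_vecI) auto
    with v(2) show False by simp
  qed
  define d where "d \<psi> = card {k. k < n \<and> t k = \<psi>}" for \<psi>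

  have "Theta G P C = det (mat n n (\<lambda>(i, j). indet (rep_of P C (e i \<otimes> inv (e j)))))" (is "_ = det ?L")
    unfolding Theta_def by (rule det_on_conv_det[OF e])
  moreover have "det ?L = (\<Prod>k<n. linear_form C (part_eigenvalue (t k)))"
  proof -
    interpret c: comm_ring_hom "const_poly :: complex \<Rightarrow> 'a cpoly"
      by (rule comm_ring_hom_const_poly)
    let ?M = "map_mat const_poly M :: 'a cpoly mat"
    let ?D = "mat n n (\<lambda>(i, j). if i = j then linear_form C (part_eigenvalue (t i)) else 0)"
    have L: "?L \<in> carrier_mat n n" and M': "?M \<in> carrier_mat n n" and D: "?D \<in> carrier_mat n n"
      using M by auto
    have "?L * ?M = ?M * ?D"
    proof (rule eq_matI)
      fix i k assume "i < dim_row (?M * ?D)" "k < dim_col (?M * ?D)"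
      then have ik: "i < n" "k < n" using M by auto
      have "(?L * ?M) $$ (i, k) = (\<Sum>j<n. indet (rep_of P C (e i \<otimes> inv (e j))) * const_poly (b k (e j)))"
        unfolding times_mat_index_sum[OF L M' ik] using ik M by (intro sum.cong) (auto simp: M_def)
      also have "\<dots> = const_poly (b k (e i)) * linear_form C (part_eigenvalue (t k))"
        unfolding reindex[of "\<lambda>h. indet (rep_of P C (e i \<otimes> inv h)) * const_poly (b k h)"]
        by (rule eigenvector_indet[OF teig eG]) (use ik in auto)
      also have "\<dots> = (\<Sum>j<n. if j = k then const_poly (b j (e i)) * linear_form C (part_eigenvalue (t j)) else 0)"
        using ik by simp
      also have "\<dots> = (?M * ?D) $$ (i, k)"
        unfolding times_mat_index_sum[OF M' D ik] using ik M by (intro sum.cong) (auto simp: M_def)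
      finally show "(?L * ?M) $$ (i, k) = (?M * ?D) $$ (i, k)" .
    qed (use M in auto)
    then have "det (?L * ?M) = det (?M * ?D)"
      by simp
    then have "det ?L * const_poly (det M) = const_poly (det M) * det ?D"
      by (simp only: det_mult[OF L M'] det_mult[OF M' D] c.hom_det)
    \<comment> \<open>\<open>det M\<close> is a nonzero complex number, hence a unit among the
      polynomials, and is cancelled by its inverse.\<close>
    then have "(det ?L * const_poly (det M)) * const_poly (1 / det M) =
        (const_poly (det M) * det ?D) * const_poly (1 / det M)"
      by simp
    then have "det ?L * const_poly (det M * (1 / det M)) = const_poly (det M * (1 / det M)) * det ?D"
      unfolding const_poly_mult by (simp only: mult_ac)
    then have "det ?L = det ?D"
      using det_M by simp
    then show ?thesis
      by (simp only: det_diagonal)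
  qed
  moreover have "(\<Prod>k<n. linear_form C (part_eigenvalue (t k))) = (\<Prod>\<psi>\<in>Irr G. linear_form C (part_eigenvalue \<psi>) ^ d \<psi>)"
  proof -
    have "(\<Prod>k<n. linear_form C (part_eigenvalue (t k))) =
        (\<Prod>\<psi>\<in>Irr G. \<Prod>k\<in>{k \<in> {..<n}. t k = \<psi>}. linear_form C (part_eigenvalue (t k)))"
      using t finite_Irr by (intro prod.group[symmetric]) auto
    also have "\<dots> = (\<Prod>\<psi>\<in>Irr G. linear_form C (part_eigenvalue \<psi>) ^ d \<psi>)"
      by (intro prod.cong refl) (simp add: d_def)
    finally show ?thesis .
  qed
  ultimately have 1: "Theta G P C = (\<Prod>\<psi>\<in>Irr G. linear_form C (part_eigenvalue \<psi>) ^ d \<psi>)"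
    by simp

  have 2: "of_nat (d \<phi>) = (\<phi> \<one>)\<^sup>2" if \<phi>: "\<phi> \<in> Irr G" for \<phi>
  proof -
    \<comment> \<open>\<open>?E\<close> is the matrix of convolution by \<open>idem \<phi>\<close>,
      and all its diagonal entries equal \<open>idem \<phi> \<one>\<close>. In the eigenbasis it
      becomes \<open>?D\<close>, whose trace is \<open>d \<phi>\<close>.\<close>
    let ?E = "mat n n (\<lambda>(i, j). idem \<phi> (e i \<otimes> inv (e j)))"
    let ?D = "mat n n (\<lambda>(i, j). if i = j \<and> t i = \<phi> then 1 else 0) :: complex mat"
    have E: "?E \<in> carrier_mat n n" and D: "?D \<in> carrier_mat n n" by auto
    obtain Q where Q: "Q \<in> carrier_mat n n" "Q * M = 1\<^sub>m n" "M * Q = 1\<^sub>m n"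
      using det_non_zero_imp_unit[OF M det_M, of "()"] by (auto simp: Units_def ring_mat_simps)
    have EM: "?E * M = M * ?D"
    proof (rule eq_matI)
      fix i k assume "i < dim_row (M * ?D)" "k < dim_col (M * ?D)"
      then have ik: "i < n" "k < n" using M by auto
      have "(?E * M) $$ (i, k) = (\<Sum>j<n. idem \<phi> (e i \<otimes> inv (e j)) * b k (e j))"
        unfolding times_mat_index_sum[OF E M ik] using ik by (intro sum.cong) (auto simp: M_def)
      also have "\<dots> = (idem \<phi> \<star> b k) (e i)"
        unfolding reindex[of "\<lambda>h. idem \<phi> (e i \<otimes> inv h) * b k h"] conv_apply'[OF eG[OF ik(1)]] ..
      also have "\<dots> = (\<Sum>j<n. if j = k then b j (e i) * (if t j = \<phi> then 1 else 0) else 0)"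
        using ik t[OF ik(2)] \<phi>
        by (simp add: teig idem_in_center central_char_idem scale_fun_def)
      also have "\<dots> = (M * ?D) $$ (i, k)"
        unfolding times_mat_index_sum[OF M D ik] using ik by (intro sum.cong) (auto simp: M_def)
      finally show "(?E * M) $$ (i, k) = (M * ?D) $$ (i, k)" .
    qed (use M in auto)
    have "?E = ?E * (M * Q)"
      using Q E by simp
    also have "\<dots> = (M * ?D) * Q"
      by (simp only: assoc_mult_mat[OF E M Q(1), symmetric] EM)
    finally have "trace_mat ?E = trace_mat (M * ?D * Q)"
      by simp
    also have "\<dots> = trace_mat (Q * (M * ?D))"
      by (rule trace_mat_mult_commute[OF mult_carrier_mat[OF M D] Q(1)])
    also have "Q * (M * ?D) = ?D"
      using D by (simp add: assoc_mult_mat[OF Q(1) M D, symmetric] Q(2))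
    also have "trace_mat ?D = of_nat (d \<phi>)"
    proof -
      have "trace_mat ?D = (\<Sum>k<n. if t k = \<phi> then 1 else 0)"
        by (simp add: trace_mat_def)
      also have "\<dots> = of_nat (card {k \<in> {..<n}. t k = \<phi>})"
        by (simp add: sum.If_cases Int_def)
      finally show ?thesis by (simp add: d_def)
    qed
    finally have "of_nat (d \<phi>) = trace_mat ?E" ..
    also have "\<dots> = (\<Sum>i<n. idem \<phi> \<one>)"
      using eG by (simp add: trace_mat_def)
    also have "\<dots> = (\<phi> \<one>)\<^sup>2"
      by (simp add: idem_apply n_def power2_eq_square)
    finally show ?thesis .
  qed
  show thesis
    by (rule that[OF _ 1]) (use 2 in blast)
qed

end

section \<open>Supercharacter theories and factorizations\<close>

context finite_group
begin

section \<open>Both products as instances of the coordinate setting\<close>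

sublocale hadamard: idempotent_coordinates "carrier G" "\<lambda>g. hat {g}" "\<lambda>g a. a g" "group_algebra G" "(*)"
proof
  show "finite (carrier G)" by simp
  show "cfun.subspace (group_algebra G)" by (rule subspace_group_algebra)
  show "hat {g} \<in> group_algebra G" if "g \<in> carrier G" for g
    using that by (simp add: hat_in_group_algebra)
  show "s = (\<Sum>g\<in>carrier G. scale_fun (s g) (hat {g}))" if "s \<in> group_algebra G" for s
    by (rule expand_hat[OF that])
  show "s * t \<in> group_algebra G" if "s \<in> group_algebra G" "t \<in> group_algebra G" for s t
    using that by (simp add: group_algebra_def)
qed (simp_all add: scale_fun_def hat_def)

sublocale ordinary: idempotent_coordinates "Irr G" idem central_char "ga_center G" "ga_mult G"
proof
  show "finite (Irr G)" by (rule finite_Irr)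
  show "cfun.subspace (ga_center G)" by (rule subspace_center)
  show "s = (\<Sum>\<psi>\<in>Irr G. scale_fun (central_char \<psi> s) (idem \<psi>))" if "s \<in> ga_center G" for s
    by (rule center_expand[OF that])
qed (simp_all add: idem_in_center central_char_add central_char_scale central_char_idem
       conv_in_center central_char_conv)

lemma hadamard_block:
  assumes "K \<subseteq> carrier G"
  shows "hadamard.block_sum K = hat K"
proof
  fix x
  have "finite K" using assms finite_carrier by (rule finite_subset)
  then show "hadamard.block_sum K x = hat K x"
    unfolding hadamard.block_sum_def sum_fun_apply by (simp add: hat_def)
qed

lemma hadamard_block_image:
  assumes "partition_on (carrier G) \<K>"
  shows "hadamard.block_sum ` \<K> = hat ` \<K>"
  using hadamard.partition_on_subset[OF assms] by (intro image_cong refl hadamard_block)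

lemma supercharacter_theory_Cl:
  assumes S: "supercharacter_theory G S"
  shows "Cl G S = hadamard.parts S" "cfun.span (hat ` Cl G S) = S" "partition_on (carrier G) (Cl G S)"
proof -
  have *: "cfun.subspace S" "S \<subseteq> group_algebra G" "\<And>s t. s \<in> S \<Longrightarrow> t \<in> S \<Longrightarrow> s * t \<in> S"
    "hadamard.block_sum (carrier G) \<in> S"
    using S center_in_group_algebra by (auto simp: supercharacter_theory_def hadamard_block)
  have "Cl G S = (THE \<X>. partition_on (carrier G) \<X> \<and> basis_of (hadamard.block_sum ` \<X>) S \<and>
      orthogonal_idempotents (*) (hadamard.block_sum ` \<X>))"
    unfolding Cl_def
  proof (rule arg_cong[of _ _ The], rule ext)
    fix \<K>
    \<comment> \<open>\<open>hat K\<close> and the block sum of \<open>K\<close> agree for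
      \<open>K\<close> inside the finite carrier, which the first conjunct ensures.\<close>
    show "(partition_on (carrier G) \<K> \<and> basis_of (hat ` \<K>) S \<and> orthogonal_idempotents (*) (hat ` \<K>)) =
        (partition_on (carrier G) \<K> \<and> basis_of (hadamard.block_sum ` \<K>) S \<and> orthogonal_idempotents (*) (hadamard.block_sum ` \<K>))"
      using hadamard_block_image[of \<K>] by (cases "partition_on (carrier G) \<K>") simp_all
  qed
  also have "\<dots> = hadamard.parts S"
    by (rule hadamard.The_parts[OF *])
  finally show 1: "Cl G S = hadamard.parts S" .
  show 2: "partition_on (carrier G) (Cl G S)"
    unfolding 1 by (rule hadamard.partition_parts)
  show "cfun.span (hat ` Cl G S) = S"
    unfolding hadamard_block_image[OF 2, symmetric] unfolding 1 by (rule hadamard.span_parts[OF *])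
qed

lemma supercharacter_theory_Ch:
  assumes S: "supercharacter_theory G S"
  shows "Ch G S = ordinary.parts S" "cfun.span (ordinary.block_sum ` ordinary.parts S) = S"
proof -
  have *: "cfun.subspace S" "S \<subseteq> ga_center G" "\<And>s t. s \<in> S \<Longrightarrow> t \<in> S \<Longrightarrow> s \<star> t \<in> S"
    "ordinary.block_sum (Irr G) \<in> S"
    using S by (auto simp: supercharacter_theory_def ordinary.block_sum_def one_eq_sum_idem[symmetric])
  show "Ch G S = ordinary.parts S"
    using ordinary.The_parts[OF *] unfolding Ch_def ordinary.block_sum_def[abs_def] .
  show "cfun.span (ordinary.block_sum ` ordinary.parts S) = S"
    by (rule ordinary.span_parts[OF *])
qed

end

context invariant_partition
begin

text \<open>The only candidate for \<open>S\<close>, since a supercharacter theory is the span of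
  its superclass sums.\<close>

definition part_span :: "('a \<Rightarrow> complex) set" where
  "part_span = cfun.span (hat ` P)"

text \<open>Indexed by an arbitrary coefficient function, so that it applies to the factors of a
  given factorization as well as to characters.\<close>

definition char_class :: "('a \<Rightarrow> complex) \<Rightarrow> ('a \<Rightarrow> complex) set" where
  "char_class \<xi> = {\<psi> \<in> Irr G. \<forall>c\<in>C. part_eigenvalue \<psi> c = \<xi> c}"

lemma part_span_eq: "part_span = cfun.span (hadamard.block_sum ` P)"
  by (simp only: part_span_def hadamard_block_image[OF partition])

lemma independent_hat_P: "cfun.independent (hat ` P)"
  using hadamard.independent_block_sums[OF partition] unfolding hadamard_block_image[OF partition] .

lemma card_hat_P: "card (hat ` P :: ('a \<Rightarrow> complex) set) = card P"
  using hadamard.card_block_sums[OF partition] unfolding hadamard_block_image[OF partition] .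

lemma part_span_subset_center: "part_span \<subseteq> ga_center G"
  unfolding part_span_def using hat_in_center by (intro cfun.span_minimal subspace_center) auto

lemma coord_class_part_span:
  "ordinary.coord_class part_span \<psi> = char_class (part_eigenvalue \<psi>)"
proof -
  have "(\<forall>s\<in>part_span. central_char \<phi> s = central_char \<psi> s) \<longleftrightarrow> (\<forall>c\<in>C. part_eigenvalue \<phi> c = part_eigenvalue \<psi> c)" for \<phi>
  proof
    assume *: "\<forall>s\<in>part_span. central_char \<phi> s = central_char \<psi> s"
    show "\<forall>c\<in>C. part_eigenvalue \<phi> c = part_eigenvalue \<psi> c"
    proof
      fix c assume "c \<in> C"
      then have "hat (part_of P c) \<in> part_span"
        using C_subset part_of_in unfolding part_span_def by (intro cfun.span_base) auto
      with * show "part_eigenvalue \<phi> c = part_eigenvalue \<psi> c"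
        by (simp add: part_eigenvalue_def)
    qed
  next
    assume *: "\<forall>c\<in>C. part_eigenvalue \<phi> c = part_eigenvalue \<psi> c"
    have "cfun.subspace {s. central_char \<phi> s = central_char \<psi> s}"
      using ordinary.coord_0 by (simp add: cfun.subspace_def central_char_add central_char_scale)
    moreover have "hat ` P \<subseteq> {s. central_char \<phi> s = central_char \<psi> s}"
    proof (rule image_subsetI)
      fix K assume "K \<in> P"
      then obtain c where "c \<in> C" "K = part_of P c"
        using bij_betw_part_of by (auto simp: bij_betw_def)
      then show "hat K \<in> {s. central_char \<phi> s = central_char \<psi> s}"
        using * by (simp add: part_eigenvalue_def)
    qed
    ultimately show "\<forall>s\<in>part_span. central_char \<phi> s = central_char \<psi> s"
      unfolding part_span_def using cfun.span_minimal by blast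
  qed
  then show ?thesis
    by (simp add: ordinary.coord_class_def char_class_def)
qed

lemma parts_part_span: "ordinary.parts part_span = (\<lambda>\<psi>. char_class (part_eigenvalue \<psi>)) ` Irr G"
  by (simp add: ordinary.parts_def coord_class_part_span)

text \<open>\<open>S\<close> has two bases, the superclass sums and the sums of idempotents over the
  members of \<open>Ch G S\<close>; both are counted by its dimension.\<close>

lemma card_parts_if_supercharacter_theory:
  assumes "supercharacter_theory G S" "Cl G S = P"
  shows "S = part_span" "card (ordinary.parts part_span) = card P"
proof -
  show S: "S = part_span"
    using supercharacter_theory_Cl(2)[OF assms(1)] by (simp add: assms(2) part_span_def)
  have "card (ordinary.parts S) = cfun.dim S"
    using cfun.dim_span_eq_card_independent[OF ordinary.independent_block_sums[OF ordinary.partition_parts[of S]]]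
    by (simp add: ordinary.card_block_sums[OF ordinary.partition_parts] supercharacter_theory_Ch(2)[OF assms(1)])
  moreover have "card P = cfun.dim S"
    using cfun.dim_span_eq_card_independent[OF independent_hat_P]
    by (simp add: S part_span_def card_hat_P)
  ultimately show "card (ordinary.parts part_span) = card P"
    by (simp add: S)
qed

text \<open>By the definition of the classes, each part sum is a combination of class idempotents.
  Equal numbers make the two spans equal, which gives closure under convolution; closure under the
  Hadamard product comes from \<open>P\<close> being a partition.\<close>

lemma supercharacter_theory_part_span:
  assumes "card (ordinary.parts part_span) = card P"
  shows "supercharacter_theory G part_span" "Cl G part_span = P"
proof -
  let ?X = "ordinary.parts part_span"
  have X: "partition_on (Irr G) ?X" by (rule ordinary.partition_parts)
  have "hat K \<in> cfun.span (ordinary.block_sum ` ?X)" if K: "K \<in> P" for K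
  proof -
    have "hat K \<in> part_span"
      using K unfolding part_span_def by (intro cfun.span_base) auto
    then have "ordinary.const_on ?X (hat K)"
      by (intro ordinary.const_onI) (auto simp: ordinary.parts_def ordinary.coord_class_def)
    then show ?thesis
      unfolding ordinary.span_block_sums[OF X] using hat_in_center[OF K] by simp
  qed
  moreover have "finite (ordinary.block_sum ` ?X)"
    using finite_Irr by (simp add: ordinary.parts_def)
  ultimately have "cfun.span (hat ` P) = cfun.span (ordinary.block_sum ` ?X)"
    using assms independent_hat_P
    by (intro span_eq_if_card_le) (auto simp: card_hat_P ordinary.card_block_sums[OF X])
  then have eq: "part_span = cfun.span (ordinary.block_sum ` ?X)"
    by (rule trans[OF part_span_def])
  show S: "supercharacter_theory G part_span"
    unfolding supercharacter_theory_def
  proof (intro conjI ballI part_span_subset_center)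
    show "cfun.subspace part_span" by (simp add: part_span_def)
    show "hat {\<one>} \<in> part_span"
      unfolding part_span_def using one_part by (intro cfun.span_base) auto
    show "a \<star> b \<in> part_span" if "a \<in> part_span" "b \<in> part_span" for a b
      using ordinary.span_block_sums_mul[OF X, of a b] that by (simp only: eq[symmetric])
    show "hat (carrier G) \<in> part_span"
    proof -
      have "hadamard.const_on P (hat (carrier G))"
        using part_subset by (intro hadamard.const_onI) (auto simp: hat_def)
      then show ?thesis
        unfolding part_span_eq hadamard.span_block_sums[OF partition] by (simp add: hat_in_group_algebra)
    qed
    show "a * b \<in> part_span" if "a \<in> part_span" "b \<in> part_span" for a b
      using hadamard.span_block_sums_mul[OF partition, of a b] that by (simp only: part_span_eq)
  qed
  show "Cl G part_span = P"
    unfolding supercharacter_theory_Cl(1)[OF S]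
    by (rule hadamard.eq_parts_if_span[OF partition part_span_eq[symmetric], symmetric])
qed

section \<open>Classes of characters and factors of the determinant\<close>

lemma char_class_eq:
  assumes "\<psi> \<in> char_class \<xi>"
  shows "char_class \<xi> = char_class (part_eigenvalue \<psi>)"
  using assms by (auto simp: char_class_def)

lemma char_class_self: "\<psi> \<in> Irr G \<Longrightarrow> \<psi> \<in> char_class (part_eigenvalue \<psi>)"
  by (simp add: char_class_def)

lemma finite_char_class: "finite (char_class \<xi>)"
  using finite_Irr by (simp add: char_class_def)

text \<open>Two factorizations of \<open>Theta\<close> are compared at the form with coefficients
  \<open>\<mu>\<close>. The left sum has at most one term, as the given forms are distinct; the
  right one collects all characters with that form.\<close>

lemma factorization_multiplicity:
  assumes d: "Theta G P C = (\<Prod>\<psi>\<in>Irr G. linear_form C (part_eigenvalue \<psi>) ^ d \<psi>)"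
    and f: "monic_linear_factorization G P C l \<xi> m"
  shows "(\<Sum>j | j \<in> {1..l} \<and> (\<forall>g\<in>C. \<xi> j g = \<mu> g). m j) = (\<Sum>\<psi>\<in>char_class \<mu>. d \<psi>)"
  unfolding char_class_def
proof (rule monic_linear_factorization_unique[OF finite_C one_in_C])
  show "(\<Prod>j\<in>{1..l}. linear_form C (\<xi> j) ^ m j) = (\<Prod>\<psi>\<in>Irr G. linear_form C (part_eigenvalue \<psi>) ^ d \<psi>)"
    using f d by (simp add: monic_linear_factorization_def)
  show "\<xi> j \<one> = 1" if "j \<in> {1..l}" for j
    using f that by (simp add: monic_linear_factorization_def)
qed (use finite_Irr in \<open>auto simp: part_eigenvalue_one\<close>)

text \<open>Positive \<open>m j\<close> makes the class of each factor nonempty, and positive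
  \<open>d \<psi>\<close> makes every class of characters occur. As \<open>l\<close> is arbitrary
  here, it is forced to be the number of classes.\<close>

lemma factorization_classes:
  assumes d: "Theta G P C = (\<Prod>\<psi>\<in>Irr G. linear_form C (part_eigenvalue \<psi>) ^ d \<psi>)"
    and d_pos: "\<And>\<psi>. \<psi> \<in> Irr G \<Longrightarrow> d \<psi> > 0"
    and f: "monic_linear_factorization G P C l \<xi> m"
  shows "\<And>j. j \<in> {1..l} \<Longrightarrow> m j = (\<Sum>\<psi>\<in>char_class (\<xi> j). d \<psi>)"
    and "bij_betw (\<lambda>j. char_class (\<xi> j)) {1..l} (ordinary.parts part_span)"
proof -
  have inj: "j = k" if "j \<in> {1..l}" "k \<in> {1..l}" "\<forall>g\<in>C. \<xi> j g = \<xi> k g" for j k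
  proof -
    have "linear_form C (\<xi> j) = linear_form C (\<xi> k)"
      using that(3) by (simp add: linear_form_eq_iff[OF finite_C])
    then show ?thesis
      using f that(1,2) by (auto simp: monic_linear_factorization_def dest: inj_onD)
  qed
  show m: "m j = (\<Sum>\<psi>\<in>char_class (\<xi> j). d \<psi>)" if j: "j \<in> {1..l}" for j
  proof -
    have "{k. k \<in> {1..l} \<and> (\<forall>g\<in>C. \<xi> k g = \<xi> j g)} = {j}"
    proof (intro equalityI subsetI)
      fix k assume "k \<in> {k. k \<in> {1..l} \<and> (\<forall>g\<in>C. \<xi> k g = \<xi> j g)}"
      then show "k \<in> {j}" using inj[OF _ j, of k] by simp
    qed (use j in simp)
    then show ?thesis
      using factorization_multiplicity[OF d f, of "\<xi> j"] by simp
  qed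
  have nonempty: "\<exists>\<psi>. \<psi> \<in> char_class (\<xi> j)" if j: "j \<in> {1..l}" for j
  proof (rule ccontr)
    assume "\<nexists>\<psi>. \<psi> \<in> char_class (\<xi> j)"
    then have "char_class (\<xi> j) = {}" by blast
    then have "m j = 0" using m[OF j] by simp
    moreover have "m j > 0"
      using f j unfolding monic_linear_factorization_def by blast
    ultimately show False by simp
  qed
  show "bij_betw (\<lambda>j. char_class (\<xi> j)) {1..l} (ordinary.parts part_span)"
    unfolding bij_betw_def
  proof
    show "inj_on (\<lambda>j. char_class (\<xi> j)) {1..l}"
    proof (rule inj_onI)
      fix j k assume jk: "j \<in> {1..l}" "k \<in> {1..l}" "char_class (\<xi> j) = char_class (\<xi> k)"
      obtain \<psi> where "\<psi> \<in> char_class (\<xi> j)" using nonempty[OF jk(1)] by blast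
      then have "\<psi> \<in> char_class (\<xi> j)" "\<psi> \<in> char_class (\<xi> k)" using jk(3) by simp_all
      then have "\<forall>g\<in>C. \<xi> j g = \<xi> k g"
        by (simp add: char_class_def)
      then show "j = k" by (rule inj[OF jk(1,2)])
    qed
    show "(\<lambda>j. char_class (\<xi> j)) ` {1..l} = ordinary.parts part_span"
      unfolding parts_part_span
    proof (intro equalityI image_subsetI)
      fix j assume j: "j \<in> {1..l}"
      obtain \<psi> where \<psi>: "\<psi> \<in> char_class (\<xi> j)" using nonempty[OF j] by blast
      then have "\<psi> \<in> Irr G" by (simp add: char_class_def)
      then show "char_class (\<xi> j) \<in> (\<lambda>\<psi>. char_class (part_eigenvalue \<psi>)) ` Irr G"
        using char_class_eq[OF \<psi>] by blast
    next
      fix \<psi> assume \<psi>: "\<psi> \<in> Irr G"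
      have "0 < d \<psi>" by (rule d_pos[OF \<psi>])
      also have "d \<psi> \<le> (\<Sum>\<phi>\<in>char_class (part_eigenvalue \<psi>). d \<phi>)"
        by (rule member_le_sum[OF char_class_self[OF \<psi>]]) (simp_all add: finite_char_class)
      finally have "(\<Sum>j | j \<in> {1..l} \<and> (\<forall>g\<in>C. \<xi> j g = part_eigenvalue \<psi> g). m j) \<noteq> 0"
        unfolding factorization_multiplicity[OF d f] by simp
      then obtain j where j: "j \<in> {1..l}" "\<forall>g\<in>C. \<xi> j g = part_eigenvalue \<psi> g"
        by (metis (mono_tags, lifting) mem_Collect_eq sum.not_neutral_contains_not_neutral)
      then have "char_class (\<xi> j) = char_class (part_eigenvalue \<psi>)"
        by (simp add: char_class_def)
      then show "char_class (part_eigenvalue \<psi>) \<in> (\<lambda>j. char_class (\<xi> j)) ` {1..l}"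
        using j(1) by blast
    qed
  qed
qed

text \<open>The factors of \<open>Theta\<close> coincide exactly within a class, so grouping by
  classes leaves one form for each, with the exponents added.\<close>

lemma factorization_exists:
  assumes d: "Theta G P C = (\<Prod>\<psi>\<in>Irr G. linear_form C (part_eigenvalue \<psi>) ^ d \<psi>)"
    and d_pos: "\<And>\<psi>. \<psi> \<in> Irr G \<Longrightarrow> d \<psi> > 0"
    and l: "card (ordinary.parts part_span) = l"
  shows "\<exists>\<xi> m. monic_linear_factorization G P C l \<xi> m"
proof -
  let ?X = "ordinary.parts part_span"
  have X: "partition_on (Irr G) ?X" by (rule ordinary.partition_parts)
  have "finite ?X" using finite_Irr by (simp add: ordinary.parts_def)
  then obtain h where h: "bij_betw h {1..l} ?X"
    using ex_bij_betw_nat_finite_1[of ?X] l by auto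
  define rep where "rep Y = (SOME \<psi>. \<psi> \<in> Irr G \<and> Y = char_class (part_eigenvalue \<psi>))" for Y
  have rep: "rep Y \<in> Irr G" "Y = char_class (part_eigenvalue (rep Y))" if "Y \<in> ?X" for Y
  proof -
    have "\<exists>\<psi>. \<psi> \<in> Irr G \<and> Y = char_class (part_eigenvalue \<psi>)"
      using that unfolding parts_part_span by blast
    then show "rep Y \<in> Irr G" "Y = char_class (part_eigenvalue (rep Y))"
      using someI_ex[of "\<lambda>\<psi>. \<psi> \<in> Irr G \<and> Y = char_class (part_eigenvalue \<psi>)"] unfolding rep_def by blast+
  qed
  have hX: "h j \<in> ?X" if "j \<in> {1..l}" for j
    using h that by (auto simp: bij_betw_def)
  define \<xi> where "\<xi> j = part_eigenvalue (rep (h j))" for j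
  define m where "m j = (\<Sum>\<psi>\<in>h j. d \<psi>)" for j
  have "m j > 0" if j: "j \<in> {1..l}" for j
  proof -
    have r: "rep (h j) \<in> h j"
      using char_class_self[OF rep(1)[OF hX[OF j]]] rep(2)[OF hX[OF j]] by simp
    have "finite (h j)"
      using finite_char_class rep(2)[OF hX[OF j]] by metis
    then have "d (rep (h j)) \<le> m j"
      unfolding m_def by (intro member_le_sum r) simp_all
    then show ?thesis
      using d_pos[OF rep(1)[OF hX[OF j]]] by simp
  qed
  moreover have "\<xi> j \<one> = 1" if "j \<in> {1..l}" for j
    unfolding \<xi>_def by (rule part_eigenvalue_one[OF rep(1)[OF hX[OF that]]])
  moreover have "inj_on (\<lambda>j. linear_form C (\<xi> j)) {1..l}"
  proof (rule inj_onI)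
    fix j k assume jk: "j \<in> {1..l}" "k \<in> {1..l}" "linear_form C (\<xi> j) = linear_form C (\<xi> k)"
    then have "char_class (\<xi> j) = char_class (\<xi> k)"
      by (simp add: linear_form_eq_iff[OF finite_C] char_class_def)
    then have "h j = h k"
      using rep(2)[OF hX[OF jk(1)]] rep(2)[OF hX[OF jk(2)]] by (simp add: \<xi>_def)
    then show "j = k"
      using h jk(1,2) by (auto simp: bij_betw_def dest: inj_onD)
  qed
  moreover have "Theta G P C = (\<Prod>j = 1..l. linear_form C (\<xi> j) ^ m j)"
  proof -
    have disj: "\<forall>A\<in>?X. \<forall>B\<in>?X. A \<noteq> B \<longrightarrow> A \<inter> B = {}"
      using X by (simp add: partition_on_def disjoint_def)
    have fin: "\<forall>A\<in>?X. finite A"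
      using finite_char_class by (auto simp: parts_part_span)
    have "(\<Prod>\<psi>\<in>Irr G. linear_form C (part_eigenvalue \<psi>) ^ d \<psi>) = (\<Prod>Y\<in>?X. \<Prod>\<psi>\<in>Y. linear_form C (part_eigenvalue \<psi>) ^ d \<psi>)"
      using prod.Union_disjoint[OF fin disj] X by (simp add: partition_on_def)
    also have "\<dots> = (\<Prod>Y\<in>?X. linear_form C (part_eigenvalue (rep Y)) ^ (\<Sum>\<psi>\<in>Y. d \<psi>))"
    proof (rule prod.cong[OF refl])
      fix Y assume Y: "Y \<in> ?X"
      have "linear_form C (part_eigenvalue \<psi>) = linear_form C (part_eigenvalue (rep Y))" if "\<psi> \<in> Y" for \<psi>
        using that rep(2)[OF Y] by (auto simp: linear_form_eq_iff[OF finite_C] char_class_def)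
      then show "(\<Prod>\<psi>\<in>Y. linear_form C (part_eigenvalue \<psi>) ^ d \<psi>) = linear_form C (part_eigenvalue (rep Y)) ^ (\<Sum>\<psi>\<in>Y. d \<psi>)"
        by (simp add: power_sum)
    qed
    also have "\<dots> = (\<Prod>j = 1..l. linear_form C (\<xi> j) ^ m j)"
      unfolding \<xi>_def m_def
      by (rule prod.reindex_bij_betw[OF h, symmetric])
    finally show ?thesis unfolding d .
  qed
  ultimately have "monic_linear_factorization G P C l \<xi> m"
    by (simp add: monic_linear_factorization_def)
  then show ?thesis by blast
qed

section \<open>Values of the basic characters\<close>

lemma sum_Irr_part:
  assumes \<psi>: "\<psi> \<in> Irr G" and g: "g \<in> carrier G"
  shows "(\<Sum>k\<in>part_of P g. \<psi> k) = \<psi> \<one> * part_eigenvalue \<psi> (rep_of P C g)"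
proof -
  have "(\<Sum>k\<in>carrier G. hat (part_of P g) k * \<psi> k) = (\<Sum>k\<in>part_of P g. \<psi> k)"
    using part_subset[OF part_of_in[OF g]]
    by (intro sum.mono_neutral_cong_right) (auto simp: hat_def)
  then show ?thesis
    using Irr_one_neq_0[OF \<psi>] by (simp add: part_eigenvalue_def part_of_rep_of[OF g] central_char_def)
qed

text \<open>\<open>\<sigma>\<^sub>X\<close> is, up to a scalar and complex conjugation, the idempotent of \<open>X\<close>, hence constant on
  superclasses; its value is then its average over the class.\<close>

lemma factor_char_eq_sigma:
  assumes d: "\<And>\<psi>. \<psi> \<in> Irr G \<Longrightarrow> of_nat (d \<psi>) = (\<psi> \<one>)\<^sup>2"
    and block_sum: "ordinary.block_sum (char_class \<xi>) \<in> part_span"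
    and m: "m = (\<Sum>\<psi>\<in>char_class \<xi>. d \<psi>)"
  shows "factor_char G P C m \<xi> = sigma G (char_class \<xi>)"
proof (rule group_algebra_eqI)
  let ?X = "char_class \<xi>"
  have XI: "\<psi> \<in> Irr G" if "\<psi> \<in> ?X" for \<psi>
    using that by (simp add: char_class_def)
  show "factor_char G P C m \<xi> \<in> group_algebra G"
    by (simp add: factor_char_def)
  show "sigma G ?X \<in> group_algebra G"
    unfolding sigma_def
    by (intro cfun.subspace_sum[OF subspace_group_algebra] cfun.subspace_scale[OF subspace_group_algebra]
        Irr_in_group_algebra XI)
  fix g assume g: "g \<in> carrier G"
  let ?K = "part_of P g"
  have K: "?K \<in> P" "g \<in> ?K" "?K \<subseteq> carrier G"
    using part_of_props[OF g] part_subset by auto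
  have finK: "finite ?K"
    using K(3) finite_carrier by (rule finite_subset)
  have sigma: "sigma G ?X x = (\<Sum>\<psi>\<in>?X. \<psi> \<one> * \<psi> x)" for x
    by (simp add: sigma_def sum_fun_apply scale_fun_def)
  \<comment> \<open>An idempotent involves character values at inverses, which are complex
    conjugates, while degrees are real.\<close>
  have block_sigma: "ordinary.block_sum ?X k = cnj (sigma G ?X k) / of_nat (card (carrier G))" if k: "k \<in> carrier G" for k
  proof -
    have "ordinary.block_sum ?X k = (\<Sum>\<psi>\<in>?X. cnj (\<psi> \<one> * \<psi> k) / of_nat (card (carrier G)))"
      unfolding ordinary.block_sum_def sum_fun_apply
    proof (rule sum.cong[OF refl])
      fix \<psi> assume "\<psi> \<in> ?X"
      then have \<psi>: "\<psi> \<in> Irr G" by (rule XI)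
      then obtain n where "\<psi> \<one> = of_nat n" by (rule Irr_degree)
      then show "idem \<psi> k = cnj (\<psi> \<one> * \<psi> k) / of_nat (card (carrier G))"
        using k by (simp add: idem_apply Irr_inv[OF \<psi>])
    qed
    then show ?thesis
      by (simp add: sigma sum_divide_distrib)
  qed
  \<comment> \<open>Membership of the block sum in \<open>part_span\<close> enters here: elements of
    that span are constant on the parts.\<close>
  have const: "sigma G ?X k = sigma G ?X g" if k: "k \<in> ?K" for k
  proof -
    have "hadamard.const_on P (ordinary.block_sum ?X)"
      using block_sum unfolding part_span_eq hadamard.span_block_sums[OF partition] by simp
    from hadamard.const_onD[OF this K(1) k K(2)]
    have "cnj (sigma G ?X k) / of_nat (card (carrier G)) = cnj (sigma G ?X g) / of_nat (card (carrier G))"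
      unfolding block_sigma[OF g] block_sigma[OF subsetD[OF K(3) k]] .
    then show ?thesis by simp
  qed
  \<comment> \<open>Constancy turns the value at \<open>g\<close> into a sum over the part, which
    the eigenvalues in \<open>\<xi>\<close> compute.\<close>
  have "of_nat (card ?K) * sigma G ?X g = (\<Sum>k\<in>?K. sigma G ?X k)"
    using const by simp
  also have "\<dots> = (\<Sum>\<psi>\<in>?X. \<psi> \<one> * (\<Sum>k\<in>?K. \<psi> k))"
    unfolding sigma by (subst sum.swap) (simp add: sum_distrib_left)
  also have "\<dots> = (\<Sum>\<psi>\<in>?X. of_nat (d \<psi>) * \<xi> (rep_of P C g))"
  proof (rule sum.cong[OF refl])
    fix \<psi> assume \<psi>: "\<psi> \<in> ?X"
    then have "part_eigenvalue \<psi> (rep_of P C g) = \<xi> (rep_of P C g)"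
      using rep_of_in[OF g] by (simp add: char_class_def)
    then show "\<psi> \<one> * (\<Sum>k\<in>?K. \<psi> k) = of_nat (d \<psi>) * \<xi> (rep_of P C g)"
      by (simp add: sum_Irr_part[OF XI[OF \<psi>] g] d[OF XI[OF \<psi>]] power2_eq_square)
  qed
  also have "\<dots> = of_nat m * \<xi> (rep_of P C g)"
    by (simp add: m sum_distrib_right)
  finally have "of_nat (card ?K) * sigma G ?X g = of_nat m * \<xi> (rep_of P C g)" .
  moreover have "card ?K \<noteq> 0"
    using K(2) finK by auto
  ultimately show "factor_char G P C m \<xi> g = sigma G ?X g"
    using g by (simp add: factor_char_def on_group_def field_simps)
qed

lemma factor_char_one:
  assumes "\<xi> \<one> = 1"
  shows "factor_char G P C m \<xi> \<one> = of_nat m"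
proof -
  have "rep_of P C \<one> = \<one>"
    using rep_of_in_part[of \<one>] by (simp add: part_of_one)
  then show ?thesis
    using assms by (simp add: factor_char_def on_group_def part_of_one)
qed

lemma superclasses_iff_factorization:
  "(\<exists>S. supercharacter_theory G S \<and> Cl G S = P) \<longleftrightarrow>
     (\<exists>\<xi> m. monic_linear_factorization G P C (card P) \<xi> m)"
proof -
  obtain d where d: "\<forall>\<psi>\<in>Irr G. of_nat (d \<psi>) = (\<psi> \<one>)\<^sup>2"
    and Theta: "Theta G P C = (\<Prod>\<psi>\<in>Irr G. linear_form C (part_eigenvalue \<psi>) ^ d \<psi>)"
    by (rule Theta_factorization)
  have d_pos: "d \<psi> > 0" if "\<psi> \<in> Irr G" for \<psi>
    using d[rule_format, OF that] Irr_one_neq_0[OF that] by (cases "d \<psi>") auto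
  show ?thesis
  proof
    assume "\<exists>S. supercharacter_theory G S \<and> Cl G S = P"
    then have "card (ordinary.parts part_span) = card P"
      using card_parts_if_supercharacter_theory(2) by blast
    then show "\<exists>\<xi> m. monic_linear_factorization G P C (card P) \<xi> m"
      by (intro factorization_exists[OF Theta d_pos]) simp_all
  next
    assume "\<exists>\<xi> m. monic_linear_factorization G P C (card P) \<xi> m"
    then obtain \<xi> m where f: "monic_linear_factorization G P C (card P) \<xi> m" by blast
    have "card (ordinary.parts part_span) = card P"
      using bij_betw_same_card[OF factorization_classes(2)[OF Theta d_pos f]] by simp
    then show "\<exists>S. supercharacter_theory G S \<and> Cl G S = P"
      using supercharacter_theory_part_span by blast
  qed
qed

lemma BCh_eq_factor_chars:
  assumes S: "supercharacter_theory G S" "Cl G S = P"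
    and f: "monic_linear_factorization G P C l \<xi> m"
  shows "BCh G S = (\<lambda>j. factor_char G P C (m j) (\<xi> j)) ` {1..l}"
proof -
  obtain d where d: "\<forall>\<psi>\<in>Irr G. of_nat (d \<psi>) = (\<psi> \<one>)\<^sup>2"
    and Theta: "Theta G P C = (\<Prod>\<psi>\<in>Irr G. linear_form C (part_eigenvalue \<psi>) ^ d \<psi>)"
    by (rule Theta_factorization)
  have d_pos: "d \<psi> > 0" if "\<psi> \<in> Irr G" for \<psi>
    using d[rule_format, OF that] Irr_one_neq_0[OF that] by (cases "d \<psi>") auto
  have eq: "S = part_span"
    by (rule card_parts_if_supercharacter_theory(1)[OF S])
  have im: "(\<lambda>j. char_class (\<xi> j)) ` {1..l} = ordinary.parts part_span"
    using factorization_classes(2)[OF Theta d_pos f] by (simp add: bij_betw_def)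
  have "factor_char G P C (m j) (\<xi> j) = sigma G (char_class (\<xi> j))" if j: "j \<in> {1..l}" for j
  proof (rule factor_char_eq_sigma[where d = d])
    show "of_nat (d \<psi>) = (\<psi> \<one>)\<^sup>2" if "\<psi> \<in> Irr G" for \<psi>
      using d that by blast
    \<comment> \<open>The class idempotents lie in \<open>S\<close> because it is a unital
      subalgebra for convolution; for a general partition \<open>part_span\<close> may be smaller
      than their span.\<close>
    have "ordinary.block_sum (char_class (\<xi> j)) \<in> cfun.span (ordinary.block_sum ` ordinary.parts part_span)"
      using j unfolding im[symmetric] by (intro cfun.span_base imageI)
    then show "ordinary.block_sum (char_class (\<xi> j)) \<in> part_span"
      using supercharacter_theory_Ch(2)[OF S(1)] by (simp add: eq)
    show "m j = (\<Sum>\<psi>\<in>char_class (\<xi> j). d \<psi>)"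
      by (rule factorization_classes(1)[OF Theta d_pos f j])
  qed
  then have "(\<lambda>j. factor_char G P C (m j) (\<xi> j)) ` {1..l} = sigma G ` ((\<lambda>j. char_class (\<xi> j)) ` {1..l})"
    by (simp add: image_image)
  also have "\<dots> = BCh G S"
    using supercharacter_theory_Ch(1)[OF S(1)] by (simp only: im BCh_def eq)
  finally show ?thesis ..
qed

end

theorem theorem2:
  fixes G :: "('a, 'b) monoid_scheme" (structure)
    and P :: "'a set set" and C :: "'a set" and l :: nat
  assumes "group G" and "finite (carrier G)"
    and "partition_on (carrier G) P" and "card P = l"
    and "\<forall>K \<in> P. conj_invariant G K"
    and "{\<one>} \<in> P"
    and "representatives P C"
  shows "((\<exists>S. supercharacter_theory G S \<and> Cl G S = P) \<longleftrightarrow>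
            (\<exists>\<xi> m. monic_linear_factorization G P C l \<xi> m)) \<and>
         (\<forall>S \<xi> m. supercharacter_theory G S \<longrightarrow> Cl G S = P \<longrightarrow>
            monic_linear_factorization G P C l \<xi> m \<longrightarrow>
              BCh G S = (\<lambda>j. factor_char G P C (m j) (\<xi> j)) ` {1..l} \<and>
              (\<forall>j \<in> {1..l}. factor_char G P C (m j) (\<xi> j) \<one> = of_nat (m j)))"
proof -
  interpret group G by (rule assms(1))
  interpret invariant_partition G P C
    using assms by unfold_locales auto
  show ?thesis
  proof (intro conjI allI impI ballI)
    show "(\<exists>S. supercharacter_theory G S \<and> Cl G S = P) \<longleftrightarrow>
        (\<exists>\<xi> m. monic_linear_factorization G P C l \<xi> m)"
      using superclasses_iff_factorization assms(4) by simp
  next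
    fix S \<xi> m assume "supercharacter_theory G S" "Cl G S = P" "monic_linear_factorization G P C l \<xi> m"
    then show "BCh G S = (\<lambda>j. factor_char G P C (m j) (\<xi> j)) ` {1..l}"
      by (rule BCh_eq_factor_chars)
  next
    fix S \<xi> m j assume "monic_linear_factorization G P C l \<xi> m" "j \<in> {1..l}"
    then show "factor_char G P C (m j) (\<xi> j) \<one> = of_nat (m j)"
      by (intro factor_char_one) (simp add: monic_linear_factorization_def)
  qed
qed

end
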